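(* Let $\Gamma$ be a Brauer tree of type $(m,e)$ and let $A_\Gamma$ be the basic Brauer tree algebra of $\Gamma$ with the grading constructed by taking Green's walk around $\Gamma$; let $S_1,\dots,S_e$ be the simple modules, numbered by the Green's walk, identified with the vertices of the quiver $Q$ of $A_\Gamma$, and let $C=(c_{ij})$ be the graded Cartan matrix of $A_\Gamma$. Then: (i) if $S_i$ and $S_j$ do not belong to the same cycle of $Q$, then $c_{ij}=0$; (ii) if $S_i$ belongs to the exceptional cycle, then $c_{ii}=1+q^e+q^{2e}+\dots+q^{me}$; if $S_i$ does not belong to the exceptional cycle, then $c_{ii}=1+q^{me}$; (iii) if $i\ne j$ and $S_i$ and $S_j$ belong to the same non-exceptional cycle, then $c_{ij}=1$ if $i>j$ and $c_{ij}=q^{me}$ if $i<j$; (iv) if $i\neq j$ and $S_i$ and $S_j$ belong to the exceptional cycle, then $c_{ij}=q^{i-j}+q^{i-j+e}+\dots+q^{i-j+(m-1)e}$ if $i>j$, and $c_{ij}=q^{e-(j-i)}+q^{2e-(j-i)}+\dots+q^{me-(j-i)}$ if $i<j$.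
   Context: $k$ is an algebraically closed field of positive characteristic; modules are left modules. A Brauer tree $\Gamma$ of type $(m,e)$ is a finite connected planar tree with $e\ge 1$ edges, a distinguished exceptional vertex with multiplicity $m\ge1$, and at each vertex the counter-clockwise cyclic ordering of the adjacent edges. The basic Brauer tree algebra $A_\Gamma=kQ/I$: the vertices of $Q$ are the edges of $\Gamma$. For each vertex $u$ of $\Gamma$ with $r\ge2$ adjacent edges $j_1,\dots,j_r$ in cyclic order there are $r$ arrows $j_{s+1}\to j_s$ ($s$ modulo $r$), forming a cycle of $Q$; if the exceptional vertex has only one adjacent edge and $m>1$ (or $e=1$) there is a loop at that edge. The cycle (or loop) coming from the exceptional vertex is the exceptional cycle. Paths are multiplied left to right. If all edges are adjacent to the exceptional vertex (the star), $I$ is generated by all paths of length $me+1$. Otherwise $I$ is generated by: $ab$ for consecutive arrows $a,b$ in different cycles; $\alpha-\beta$ for two non-exceptional cycles $\alpha,\beta$ (full turns) based at the same vertex; $\alpha^m-\beta$ if $\alpha$ is the exceptional and $\beta$ a non-exceptional cycle based at the same vertex; paths of length $r+1$ along a non-exceptional cycle of length $r$ and paths of length $mr+1$ along the exceptional cycle of length $r$. The projective cover $P_{S_j}$ of $S_j$ is spanned by the paths ending at $S_j$. Green's walk numbering: start at the exceptional vertex with an arbitrary adjacent edge and walk around $\Gamma$ counter-clockwise, numbering the edges $S_1,\dots,S_e$ in order of first visit (depth-first; on arriving at a vertex along an edge, the remaining edges there are visited in counter-clockwise order starting after the incoming edge; at the exceptional vertex, in counter-clockwise order from the starting edge). The grading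 constructed by taking Green's walk: an arrow $S_i\to S_j$ of the exceptional cycle has degree $i-j$ if $i>j$, $e-(j-i)$ if $i<j$, and $e$ if it is a loop; an arrow of a non-exceptional cycle, coming from a vertex $u$ of $\Gamma$, has degree $me$ if its source is the edge at $u$ closest to the exceptional vertex, and degree $0$ otherwise. The graded Cartan matrix is the $e\times e$ matrix over $\mathbb Z[q,q^{-1}]$ with $c_{ij}=\sum_{l\in\mathbb Z}q^l\dim\mathrm{Hom}(P_{S_i},P_{S_j}\langle l\rangle)$, where $\mathrm{Hom}$ denotes degree-preserving homomorphisms, $M\langle l\rangle_n=M_{l+n}$, and each $P_{S_i}$ is graded with top in degree $0$; equivalently, the coefficient of $q^l$ is the multiplicity of $S_i$ in degree $l$ as a composition factor of $P_{S_j}$. *)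

theory Defs
  imports
    "HOL-Combinatorics.Orbits"
    "HOL-Library.Poly_Mapping"
    "HOL-Library.FuncSet"
    "HOL-Computational_Algebra.Polynomial"
    "Jordan_Normal_Form.Missing_VectorSpace"
    "Jordan_Normal_Form.VS_Connect"
    "HOL-Algebra.QuotRing"
begin

section \<open>Brauer trees\<close>

text \<open>
  Edges are two-element sets of vertices. The planar structure is the map \<open>bt_next\<close>:
  \<open>bt_next G u f\<close> is the counter-clockwise successor of the edge \<open>f\<close> at the vertex \<open>u\<close>.
\<close>

record 'v brauer_tree =
  bt_verts :: "'v set"
  bt_edges :: "'v set set"
  bt_exc   :: 'v
  bt_mult  :: nat
  bt_next  :: "'v \<Rightarrow> 'v set \<Rightarrow> 'v set"

definition bt_adj :: "'v brauer_tree \<Rightarrow> ('v \<times> 'v) set" where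
  "bt_adj G = {(u, v). {u, v} \<in> bt_edges G}"

definition bt_incident :: "'v brauer_tree \<Rightarrow> 'v \<Rightarrow> 'v set set" where
  "bt_incident G u = {f \<in> bt_edges G. u \<in> f}"

definition bt_connected :: "'v brauer_tree \<Rightarrow> bool" where
  "bt_connected G \<longleftrightarrow> (\<forall>u \<in> bt_verts G. \<forall>v \<in> bt_verts G. (u, v) \<in> (bt_adj G)\<^sup>*)"

definition bt_circuit :: "'v brauer_tree \<Rightarrow> 'v list \<Rightarrow> bool" where
  "bt_circuit G vs \<longleftrightarrow> length vs \<ge> 3 \<and> distinct vs \<and>
     successively (\<lambda>u v. (u, v) \<in> bt_adj G) vs \<and> (last vs, hd vs) \<in> bt_adj G"

definition brauer_tree_of_type :: "nat \<Rightarrow> nat \<Rightarrow> 'v brauer_tree \<Rightarrow> bool" where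
  "brauer_tree_of_type m e G \<longleftrightarrow>
     finite (bt_verts G) \<and>
     (\<forall>f \<in> bt_edges G. f \<subseteq> bt_verts G \<and> card f = 2) \<and>
     bt_connected G \<and> (\<nexists>vs. bt_circuit G vs) \<and>
     e = card (bt_edges G) \<and> e \<ge> 1 \<and>
     bt_exc G \<in> bt_verts G \<and> m = bt_mult G \<and> m \<ge> 1 \<and>
     (\<forall>u \<in> bt_verts G. cyclic_on (bt_next G u) (bt_incident G u))"

definition bt_dist :: "'v brauer_tree \<Rightarrow> 'v \<Rightarrow> nat" where
  "bt_dist G u = (LEAST n. (bt_exc G, u) \<in> bt_adj G ^^ n)"

definition bt_edge_dist :: "'v brauer_tree \<Rightarrow> 'v set \<Rightarrow> nat" where
  "bt_edge_dist G f = Min (bt_dist G ` f)"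

definition bt_closest :: "'v brauer_tree \<Rightarrow> 'v \<Rightarrow> 'v set \<Rightarrow> bool" where
  "bt_closest G u f \<longleftrightarrow> f \<in> bt_incident G u \<and> (\<forall>g \<in> bt_incident G u. bt_edge_dist G f \<le> bt_edge_dist G g)"


section \<open>Green's walk\<close>

text \<open>
  The state \<open>(u, f)\<close> means: standing at \<open>u\<close>, about to traverse \<open>f\<close>. After arriving at the other
  end \<open>w\<close> of \<open>f\<close>, the walk continues along the edge following \<open>f\<close> counter-clockwise at \<open>w\<close>
  (which is \<open>f\<close> itself if \<open>w\<close> is a leaf).
\<close>

definition bt_other_end :: "'v set \<Rightarrow> 'v \<Rightarrow> 'v" where
  "bt_other_end f u = (THE w. w \<in> f \<and> w \<noteq> u)"

definition green_step :: "'v brauer_tree \<Rightarrow> 'v \<times> 'v set \<Rightarrow> 'v \<times> 'v set" where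
  "green_step G = (\<lambda>(u, f). let w = bt_other_end f u in (w, bt_next G w f))"

definition green_walk :: "'v brauer_tree \<Rightarrow> 'v set \<Rightarrow> nat \<Rightarrow> 'v \<times> 'v set" where
  "green_walk G s n = (green_step G ^^ n) (bt_exc G, s)"

definition green_first :: "'v brauer_tree \<Rightarrow> 'v set \<Rightarrow> 'v set \<Rightarrow> nat" where
  "green_first G s f = (LEAST n. snd (green_walk G s n) = f)"

definition green_number :: "'v brauer_tree \<Rightarrow> 'v set \<Rightarrow> 'v set \<Rightarrow> nat" where
  "green_number G s f = card {g \<in> bt_edges G. green_first G s g \<le> green_first G s f}"

text \<open>\<open>green_edge G s i\<close> is the edge \<open>S\<^sub>i\<close>, for \<open>1 \<le> i \<le> e\<close>.\<close>

definition green_edge :: "'v brauer_tree \<Rightarrow> 'v set \<Rightarrow> nat \<Rightarrow> 'v set" where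
  "green_edge G s i = the_inv_into (bt_edges G) (green_number G s) i"


section \<open>The quiver\<close>

text \<open>
  The arrow \<open>j\<^bsub>s+1\<^esub> \<rightarrow> j\<^sub>s\<close> coming from the vertex \<open>u\<close> is encoded as the pair \<open>(u, j\<^sub>s)\<close>, so
  that its target is the second component. If \<open>u\<close> is a leaf then \<open>bt_next G u\<close> fixes its only
  edge, and \<open>(u, f)\<close> is the loop.
\<close>

type_synonym 'v qarrow = "'v \<times> 'v set"

definition arrows :: "'v brauer_tree \<Rightarrow> 'v qarrow set" where
  "arrows G = {(u, f). u \<in> bt_verts G \<and> f \<in> bt_incident G u \<and>
     (card (bt_incident G u) \<ge> 2 \<or>
      u = bt_exc G \<and> (bt_mult G > 1 \<or> card (bt_edges G) = 1))}"

definition arrow_src :: "'v brauer_tree \<Rightarrow> 'v qarrow \<Rightarrow> 'v set" where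
  "arrow_src G a = bt_next G (fst a) (snd a)"

definition arrow_tgt :: "'v qarrow \<Rightarrow> 'v set" where
  "arrow_tgt a = snd a"

definition cycle_of :: "'v brauer_tree \<Rightarrow> 'v \<Rightarrow> 'v set set" where
  "cycle_of G u = {arrow_tgt a | a. a \<in> arrows G \<and> fst a = u}"

text \<open>A path is a start vertex of the quiver together with a list of arrows, read left to right.\<close>

type_synonym 'v qpath = "'v set \<times> 'v qarrow list"

fun chain_from :: "'v brauer_tree \<Rightarrow> 'v set \<Rightarrow> 'v qarrow list \<Rightarrow> bool" where
  "chain_from G f [] \<longleftrightarrow> f \<in> bt_edges G"
| "chain_from G f (a # as) \<longleftrightarrow> a \<in> arrows G \<and> arrow_src G a = f \<and> chain_from G (arrow_tgt a) as"

definition qpaths :: "'v brauer_tree \<Rightarrow> 'v qpath set" where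
  "qpaths G = {(f, as). chain_from G f as}"

definition path_src :: "'v qpath \<Rightarrow> 'v set" where
  "path_src p = fst p"

definition path_tgt :: "'v qpath \<Rightarrow> 'v set" where
  "path_tgt p = (if snd p = [] then fst p else arrow_tgt (last (snd p)))"

definition path_len :: "'v qpath \<Rightarrow> nat" where
  "path_len p = length (snd p)"

text \<open>Paths of length \<open>n\<close> running along the cycle that comes from the vertex \<open>u\<close>.\<close>

definition paths_along :: "'v brauer_tree \<Rightarrow> 'v \<Rightarrow> nat \<Rightarrow> 'v qpath set" where
  "paths_along G u n = {p \<in> qpaths G. path_len p = n \<and> (\<forall>a \<in> set (snd p). fst a = u)}"

definition arrow_degree :: "'v brauer_tree \<Rightarrow> 'v set \<Rightarrow> 'v qarrow \<Rightarrow> int" where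
  "arrow_degree G s a =
     (let e = int (card (bt_edges G));
          i = int (green_number G s (arrow_src G a));
          j = int (green_number G s (arrow_tgt a))
      in if fst a = bt_exc G
         then (if i > j then i - j else if i < j then e - (j - i) else e)
         else (if bt_closest G (fst a) (arrow_src G a) then int (bt_mult G) * e else 0))"

definition path_degree :: "'v brauer_tree \<Rightarrow> 'v set \<Rightarrow> 'v qpath \<Rightarrow> int" where
  "path_degree G s p = sum_list (map (arrow_degree G s) (snd p))"


section \<open>The Brauer tree algebra\<close>

text \<open>
  The path algebra \<open>kQ\<close>. The element \<open>path_const G c\<close> is \<open>c\<close> times the identity; it gives the
  \<open>k\<close>-algebra structure.
\<close>

definition path_const :: "'v brauer_tree \<Rightarrow> 'k::field \<Rightarrow> 'v qpath \<Rightarrow>\<^sub>0 'k" where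
  "path_const G c = (\<Sum>f \<in> bt_edges G. Poly_Mapping.single (f, []) c)"

definition path_mult :: "('v qpath \<Rightarrow>\<^sub>0 'k::field) \<Rightarrow> ('v qpath \<Rightarrow>\<^sub>0 'k) \<Rightarrow> 'v qpath \<Rightarrow>\<^sub>0 'k" where
  "path_mult x y =
     (\<Sum>a \<in> Poly_Mapping.keys x. \<Sum>b \<in> Poly_Mapping.keys y.
        if path_tgt a = path_src b
        then Poly_Mapping.single (path_src a, snd a @ snd b)
               (Poly_Mapping.lookup x a * Poly_Mapping.lookup y b)
        else 0)"

definition path_algebra :: "'v brauer_tree \<Rightarrow> ('v qpath \<Rightarrow>\<^sub>0 'k::field) ring" where
  "path_algebra G =
     \<lparr>carrier = {x. Poly_Mapping.keys x \<subseteq> qpaths G}, mult = path_mult, one = path_const G 1,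
      zero = 0, add = (+)\<rparr>"

abbreviation path_elem :: "'v qpath \<Rightarrow> 'v qpath \<Rightarrow>\<^sub>0 'k::field" where
  "path_elem p \<equiv> Poly_Mapping.single p 1"

text \<open>
  In the second and third family below, the two paths are full turns (or \<open>m\<close> full turns) along
  two cycles, starting at the same vertex of the quiver.
\<close>

definition brauer_relations :: "'v brauer_tree \<Rightarrow> ('v qpath \<Rightarrow>\<^sub>0 'k::field) set" where
  "brauer_relations G =
     (let x = bt_exc G; m = bt_mult G; r = (\<lambda>u. card (bt_incident G u)) in
      if \<forall>f \<in> bt_edges G. x \<in> f
      then {path_elem p | p. p \<in> qpaths G \<and> path_len p = m * card (bt_edges G) + 1}
      else
        {path_elem (arrow_src G a, [a, b]) | a b.
           a \<in> arrows G \<and> b \<in> arrows G \<and> arrow_tgt a = arrow_src G b \<and> fst a \<noteq> fst b}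
      \<union> {path_elem p - path_elem p' | p p' u u'. u \<noteq> x \<and> u' \<noteq> x \<and>
           p \<in> paths_along G u (r u) \<and> p' \<in> paths_along G u' (r u') \<and> path_src p = path_src p' \<and>
           u \<in> bt_verts G \<and> u' \<in> bt_verts G}
      \<union> {path_elem p - path_elem p' | p p' u. u \<noteq> x \<and> u \<in> bt_verts G \<and>
           p \<in> paths_along G x (m * r x) \<and> p' \<in> paths_along G u (r u) \<and> path_src p = path_src p'}
      \<union> {path_elem p | p u. u \<noteq> x \<and> u \<in> bt_verts G \<and> p \<in> paths_along G u (r u + 1)}
      \<union> {path_elem p | p. p \<in> paths_along G x (m * r x + 1)})"

definition brauer_ideal :: "'v brauer_tree \<Rightarrow> ('v qpath \<Rightarrow>\<^sub>0 'k::field) set" where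
  "brauer_ideal G = Idl\<^bsub>path_algebra G\<^esub> (brauer_relations G)"

definition brauer_algebra :: "'v brauer_tree \<Rightarrow> ('v qpath \<Rightarrow>\<^sub>0 'k::field) set ring" where
  "brauer_algebra G = path_algebra G Quot brauer_ideal G"

definition brauer_class :: "'v brauer_tree \<Rightarrow> ('v qpath \<Rightarrow>\<^sub>0 'k::field) \<Rightarrow> ('v qpath \<Rightarrow>\<^sub>0 'k) set" where
  "brauer_class G x = brauer_ideal G +>\<^bsub>path_algebra G\<^esub> x"

definition brauer_scalar :: "'v brauer_tree \<Rightarrow> 'k::field \<Rightarrow> ('v qpath \<Rightarrow>\<^sub>0 'k) set" where
  "brauer_scalar G c = brauer_class G (path_const G c)"

definition brauer_grading ::
  "'v brauer_tree \<Rightarrow> 'v set \<Rightarrow> int \<Rightarrow> ('v qpath \<Rightarrow>\<^sub>0 'k::field) set set" where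
  "brauer_grading G s n =
     {brauer_class G x | x. x \<in> carrier (path_algebra G) \<and>
        (\<forall>p \<in> Poly_Mapping.keys x. path_degree G s p = n)}"


section \<open>Graded modules and the graded Cartan matrix\<close>

text \<open>
  Left modules over a (non-commutative) ring \<open>A\<close> are represented by the record type \<open>module\<close> of
  HOL-Algebra, whose locale \<open>module\<close> is not used because it assumes commutativity of \<open>A\<close>; the
  fields \<open>mult\<close> and \<open>one\<close> are irrelevant. A grading is the family of homogeneous components.
\<close>

definition grading_shift :: "(int \<Rightarrow> 'b set) \<Rightarrow> int \<Rightarrow> int \<Rightarrow> 'b set" where
  "grading_shift gr l n = gr (l + n)"

definition graded_homs ::
  "('a, 'r) ring_scheme \<Rightarrow> ('a, 'b) module \<Rightarrow> (int \<Rightarrow> 'b set) \<Rightarrow> ('a, 'c) module \<Rightarrow> (int \<Rightarrow> 'c set) \<Rightarrow> ('b \<Rightarrow> 'c) set"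
  where
  "graded_homs A M grM N grN =
     {h \<in> carrier M \<rightarrow>\<^sub>E carrier N.
        (\<forall>x \<in> carrier M. \<forall>y \<in> carrier M. h (x \<oplus>\<^bsub>M\<^esub> y) = h x \<oplus>\<^bsub>N\<^esub> h y) \<and>
        (\<forall>a \<in> carrier A. \<forall>x \<in> carrier M. h (a \<odot>\<^bsub>M\<^esub> x) = a \<odot>\<^bsub>N\<^esub> h x) \<and>
        (\<forall>n. h ` grM n \<subseteq> grN n)}"

text \<open>
  The \<open>k\<close>-vector space of degree-preserving homomorphisms, where \<open>\<iota>\<close> is the structure map
  from \<open>k\<close> to \<open>A\<close>.
\<close>

definition graded_hom_space ::
  "('k \<Rightarrow> 'a) \<Rightarrow> ('a, 'r) ring_scheme \<Rightarrow> ('a, 'b) module \<Rightarrow> (int \<Rightarrow> 'b set) \<Rightarrow>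
   ('a, 'c) module \<Rightarrow> (int \<Rightarrow> 'c set) \<Rightarrow> ('k, 'b \<Rightarrow> 'c) module" where
  "graded_hom_space \<iota> A M grM N grN =
     \<lparr>carrier = graded_homs A M grM N grN, mult = undefined, one = undefined,
      zero = (\<lambda>x \<in> carrier M. \<zero>\<^bsub>N\<^esub>),
      add = (\<lambda>g h. \<lambda>x \<in> carrier M. g x \<oplus>\<^bsub>N\<^esub> h x),
      smult = (\<lambda>c h. \<lambda>x \<in> carrier M. \<iota> c \<odot>\<^bsub>N\<^esub> h x)\<rparr>"

text \<open>
  The projective cover of the simple module at the quiver vertex \<open>f\<close> is the left ideal \<open>A e\<^sub>f\<close>,
  spanned by the paths ending at \<open>f\<close>; its top is in degree \<open>0\<close>.
\<close>

definition brauer_proj :: "'v brauer_tree \<Rightarrow> 'v set \<Rightarrow>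
    (('v qpath \<Rightarrow>\<^sub>0 'k::field) set, ('v qpath \<Rightarrow>\<^sub>0 'k) set) module" where
  "brauer_proj G f =
     (let A = brauer_algebra G; \<epsilon> = brauer_class G (path_elem (f, [])) in
      \<lparr>carrier = {a \<otimes>\<^bsub>A\<^esub> \<epsilon> | a. a \<in> carrier A}, mult = undefined, one = undefined,
       zero = \<zero>\<^bsub>A\<^esub>, add = add A, smult = mult A\<rparr>)"

definition brauer_proj_grading ::
  "'v brauer_tree \<Rightarrow> 'v set \<Rightarrow> 'v set \<Rightarrow> int \<Rightarrow> ('v qpath \<Rightarrow>\<^sub>0 'k::field) set set" where
  "brauer_proj_grading G s f n = carrier (brauer_proj G f) \<inter> brauer_grading G s n"

text \<open>The dimension over \<open>k\<close> of the degree-preserving maps from \<open>P\<^sub>f\<close> to the shift of \<open>P\<^sub>g\<close> by \<open>l\<close>.\<close>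

definition brauer_hom_dim ::
  "'k::field itself \<Rightarrow> 'v brauer_tree \<Rightarrow> 'v set \<Rightarrow> 'v set \<Rightarrow> 'v set \<Rightarrow> int \<Rightarrow> nat" where
  "brauer_hom_dim k G s f g l =
     vectorspace.dim (class_ring :: 'k ring)
       (graded_hom_space (brauer_scalar G) (brauer_algebra G)
          (brauer_proj G f) (brauer_proj_grading G s f)
          (brauer_proj G g) (grading_shift (brauer_proj_grading G s g) l))"

text \<open>
  The type \<open>int \<Rightarrow>\<^sub>0 int\<close> with its convolution product is the ring of Laurent polynomials
  over the integers.
\<close>

type_synonym laurent = "int \<Rightarrow>\<^sub>0 int"

definition qvar :: laurent where
  "qvar = Poly_Mapping.single 1 1"

definition graded_cartan ::
  "'k::field itself \<Rightarrow> 'v brauer_tree \<Rightarrow> 'v set \<Rightarrow> nat \<Rightarrow> nat \<Rightarrow> laurent" where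
  "graded_cartan k G s i j =
     Sum_any (\<lambda>l. Poly_Mapping.single l
       (int (brauer_hom_dim k G s (green_edge G s i) (green_edge G s j) l)))"

end

theory Submission
  imports Defs
begin

text \<open>
  A path is nonzero in the algebra exactly if it winds around a single vertex of the tree and is
  not longer than one full turn (\<open>m\<close> turns at the exceptional vertex), and two different
  nonzero paths become equal only if both are full turns (or \<open>m\<close> full turns) with the same source.
  That no further collapse happens is seen by linear functionals on the path algebra: the elements
  killed by all functionals respecting these two rules form an ideal containing the relations.
  A degree-preserving map from \<open>P\<^sub>f\<close> to a shift of \<open>P\<^sub>g\<close> is right multiplication by an
  element of a graded piece of \<open>e\<^sub>f A e\<^sub>g\<close>, so the entries of the Cartan matrix
  list the degrees of the nonzero paths.

  Green's walk visits the edges at each vertex in cyclic order, beginning with the edge closest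
  to the exceptional vertex (with \<open>s\<close> at the exceptional vertex itself). Hence the degree of a path
  winding around a vertex telescopes to a difference of end point weights plus a constant times
  the number of passages through that first edge.
\<close>

section \<open>Brauer trees\<close>

text \<open>For the common kernel of the functionals to be a two-sided ideal, the functionals must
  be stable under translation by paths. They are, because a full path is closed and cannot be
  prolonged on either side without dying: a nontrivial factor kills both members of a full pair, a
  trivial one changes nothing. The dimensions are 0 or 1 because, up to identification of full
  paths, a surviving path is determined by its end points and its degree. Two obstacles have to be
  overcome: counting turns by degree, which works since every turn has positive degree, and
  comparing paths around different vertices, where two edges of a tree share at most one vertex.
  Arrows run against the cyclic order, so numbers fall along a path and the degree is a weight of
  the source minus a weight of the target. The numbering refers to first visits in the whole walk.
  An induction over subtrees therefore has to carry the information that a subtree has not been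
  entered before.\<close>

lemma cyclic_on_funpow:
  assumes "cyclic_on f S" "b \<in> S"
  shows cyclic_on_funpow_bij: "bij_betw (\<lambda>k. (f ^^ k) b) {..<card S} S"
    and cyclic_on_funpow_card: "(f ^^ card S) b = b"
proof -
  have S: "S = orbit f b" and b: "b \<in> orbit f b"
    using assms by (auto simp: cyclic_on_alldef)
  let ?n = "funpow_dist1 f b b"
  have img: "S = (\<lambda>k. (f ^^ k) b) ` {0..<?n}"
    unfolding S by (rule orbit_conv_funpow_dist1[OF b])
  have inj: "inj_on (\<lambda>k. (f ^^ k) b) {0..<?n}"
    by (rule inj_on_funpow_dist1[OF b])
  have card: "card S = ?n"
    using card_image[OF inj] img by simp
  show "bij_betw (\<lambda>k. (f ^^ k) b) {..<card S} S"
    unfolding card bij_betw_def using img inj by (simp add: atLeast0LessThan)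
  show "(f ^^ card S) b = b"
    unfolding card by (rule funpow_dist1_prop[OF b])
qed

locale btree =
  fixes G :: "'v brauer_tree" and m e :: nat
  assumes bt: "brauer_tree_of_type m e G"
begin

abbreviation "exc \<equiv> bt_exc G"
abbreviation "dep \<equiv> bt_dist G"
abbreviation "nxt \<equiv> bt_next G"
abbreviation "inc \<equiv> bt_incident G"
abbreviation "val u \<equiv> card (inc u)"

lemma finite_verts: "finite (bt_verts G)"
  and edge_verts: "f \<in> bt_edges G \<Longrightarrow> f \<subseteq> bt_verts G"
  and edge_card: "f \<in> bt_edges G \<Longrightarrow> card f = 2"
  and connected: "u \<in> bt_verts G \<Longrightarrow> v \<in> bt_verts G \<Longrightarrow> (u, v) \<in> (bt_adj G)\<^sup>*"
  and no_circuit: "\<not> bt_circuit G vs"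
  and e_def: "e = card (bt_edges G)"
  and e_pos: "e \<ge> 1"
  and root_vert: "exc \<in> bt_verts G"
  and m_def: "m = bt_mult G"
  and m_pos: "m \<ge> 1"
  and cyclic: "u \<in> bt_verts G \<Longrightarrow> cyclic_on (nxt u) (inc u)"
  using bt unfolding brauer_tree_of_type_def bt_connected_def by auto

lemma finite_edges: "finite (bt_edges G)"
  using finite_verts edge_verts by (meson PowI finite_Pow_iff rev_finite_subset subsetI)

lemma finite_inc: "finite (inc u)"
  using finite_edges by (auto simp: bt_incident_def)

lemma inc_nonempty: "u \<in> bt_verts G \<Longrightarrow> inc u \<noteq> {}"
  using cyclic by (auto simp: cyclic_on_def)

lemma val_pos: "u \<in> bt_verts G \<Longrightarrow> val u > 0"
  using inc_nonempty finite_inc by (simp add: card_gt_0_iff)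

lemma adj_sym: "(u, v) \<in> bt_adj G \<longleftrightarrow> (v, u) \<in> bt_adj G"
  by (simp add: bt_adj_def insert_commute)

lemma adj_verts: "(u, v) \<in> bt_adj G \<Longrightarrow> u \<in> bt_verts G \<and> v \<in> bt_verts G \<and> u \<noteq> v"
  using edge_verts[of "{u, v}"] edge_card[of "{u, v}"] by (auto simp: bt_adj_def)

lemma edge_adj:
  assumes "f \<in> bt_edges G"
  obtains u v where "f = {u, v}" "u \<noteq> v" "(u, v) \<in> bt_adj G"
  using edge_card[OF assms] assms by (auto simp: card_2_iff bt_adj_def)

subsection \<open>Distance and parents\<close>

lemma dep_reach: "u \<in> bt_verts G \<Longrightarrow> (exc, u) \<in> bt_adj G ^^ dep u"
  unfolding bt_dist_def using connected[OF root_vert] by (metis (mono_tags, lifting) LeastI rtrancl_imp_relpow)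

lemma dep_le: "(exc, u) \<in> bt_adj G ^^ n \<Longrightarrow> dep u \<le> n"
  unfolding bt_dist_def by (rule Least_le)

lemma dep_root: "dep exc = 0"
  using dep_le[of exc 0] by simp

lemma dep_0: "u \<in> bt_verts G \<Longrightarrow> dep u = 0 \<longleftrightarrow> u = exc"
  using dep_reach[of u] dep_root by auto

lemma dep_adj: "(u, v) \<in> bt_adj G \<Longrightarrow> dep v \<le> Suc (dep u)"
  using dep_reach adj_verts by (meson dep_le relpow_Suc_I)

lemma parent_exists:
  assumes "u \<in> bt_verts G" "u \<noteq> exc"
  shows "\<exists>p. (p, u) \<in> bt_adj G \<and> dep u = Suc (dep p)"
proof -
  obtain n where n: "dep u = Suc n"
    using dep_0[OF assms(1)] assms(2) not0_implies_Suc by blast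
  then obtain p where p: "(exc, p) \<in> bt_adj G ^^ n" "(p, u) \<in> bt_adj G"
    using dep_reach[OF assms(1)] by auto
  then show ?thesis using dep_le[OF p(1)] dep_adj[OF p(2)] n by auto
qed

text \<open>Passing to parents on both sides either meets at once or recurses one level closer to
  the root, where neither \<open>u\<close> nor \<open>v\<close> can lie. Closing such a path by an
  edge \<open>{u, v}\<close> or by a common child of its ends gives a circuit, so adjacent vertices
  differ in depth and parents are unique.\<close>

lemma same_depth_path:
  assumes "u \<in> bt_verts G" "v \<in> bt_verts G" "u \<noteq> v" "dep u = n" "dep v = n"
  shows "\<exists>vs. length vs \<ge> 3 \<and> distinct vs \<and> successively (\<lambda>a b. (a, b) \<in> bt_adj G) vs \<and>
     hd vs = u \<and> last vs = v \<and> (\<forall>w \<in> set vs. dep w \<le> n)"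
  using assms
proof (induction n arbitrary: u v)
  case 0
  then show ?case using dep_0 by metis
next
  case (Suc n)
  have "u \<noteq> exc" "v \<noteq> exc" using Suc.prems dep_root by auto
  then obtain p q where p: "(p, u) \<in> bt_adj G" "dep p = n" and q: "(q, v) \<in> bt_adj G" "dep q = n"
    using parent_exists Suc.prems by (metis old.nat.inject)
  show ?case
  proof (cases "p = q")
    case True
    have "p \<noteq> u" "p \<noteq> v" using p q True Suc.prems by auto
    then show ?thesis using p q True Suc.prems adj_sym
      by (intro exI[of _ "[u, p, v]"]) auto
  next
    case False
    then obtain vs where vs: "length vs \<ge> 3" "distinct vs"
      "successively (\<lambda>a b. (a, b) \<in> bt_adj G) vs" "hd vs = p" "last vs = q" "\<forall>w \<in> set vs. dep w \<le> n"
      using Suc.IH[of p q] p q adj_verts by metis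
    have "u \<notin> set vs" "v \<notin> set vs" using vs(6) Suc.prems by auto
    moreover have "vs \<noteq> []" using vs(1) by auto
    ultimately show ?thesis using vs p q Suc.prems adj_sym[of u p]
      by (intro exI[of _ "u # vs @ [v]"])
        (auto simp: successively_Cons successively_append_iff intro: le_SucI)
  qed
qed

lemma adj_dep_neq:
  assumes "(u, v) \<in> bt_adj G"
  shows "dep u \<noteq> dep v"
proof
  assume "dep u = dep v"
  then obtain vs where "length vs \<ge> 3" "distinct vs"
    "successively (\<lambda>a b. (a, b) \<in> bt_adj G) vs" "hd vs = u" "last vs = v"
    using same_depth_path[of u v "dep u"] adj_verts[OF assms] by metis
  then have "bt_circuit G vs" using assms adj_sym by (auto simp: bt_circuit_def)
  then show False using no_circuit by blast
qed

lemma parent_unique: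
  assumes "(p, u) \<in> bt_adj G" "(q, u) \<in> bt_adj G" "dep u = Suc (dep p)" "dep u = Suc (dep q)"
  shows "p = q"
proof (rule ccontr)
  assume "p \<noteq> q"
  then obtain vs where vs: "length vs \<ge> 3" "distinct vs"
    "successively (\<lambda>a b. (a, b) \<in> bt_adj G) vs" "hd vs = p" "last vs = q" "\<forall>w \<in> set vs. dep w \<le> dep p"
    using same_depth_path[of p q "dep p"] adj_verts[OF assms(1)] adj_verts[OF assms(2)] assms by auto
  have "u \<notin> set vs" using vs(6) assms(3) by auto
  then have "bt_circuit G (u # vs)" using vs assms adj_sym
    by (auto simp: bt_circuit_def successively_Cons)
  then show False using no_circuit by blast
qed

text \<open>The value at \<open>exc\<close> makes the root a fixed point, so that ancestors are
  plain iterates \<open>par ^^ k\<close> without a bound on \<open>k\<close>.\<close>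

definition "par u = (if u = exc then exc else THE p. (p, u) \<in> bt_adj G \<and> dep u = Suc (dep p))"

text \<open>Names an edge by its end farther from the root. This is a bijection from the nonroot
  vertices to the edges, so sets of edges can be described by subtrees.\<close>

definition "pe u = {par u, u}"

abbreviation "nonroot \<equiv> bt_verts G - {exc}"

lemma par_adj: "u \<in> nonroot \<Longrightarrow> (par u, u) \<in> bt_adj G"
  and dep_par: "u \<in> nonroot \<Longrightarrow> dep u = Suc (dep (par u))"
proof -
  assume u: "u \<in> nonroot"
  have "\<exists>!p. (p, u) \<in> bt_adj G \<and> dep u = Suc (dep p)"
    using parent_exists[of u] parent_unique u by blast
  from theI'[OF this] u show "(par u, u) \<in> bt_adj G" "dep u = Suc (dep (par u))"
    by (auto simp: par_def)
qed

lemma par_eq: "(p, u) \<in> bt_adj G \<Longrightarrow> dep u = Suc (dep p) \<Longrightarrow> par u = p"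
  using parent_unique par_adj dep_par adj_verts dep_root by (metis DiffI Zero_not_Suc singletonD)

lemma par_verts: "u \<in> bt_verts G \<Longrightarrow> par u \<in> bt_verts G"
  using par_adj adj_verts root_vert by (cases "u = exc") (auto simp: par_def)

lemma pe_edge: "u \<in> nonroot \<Longrightarrow> pe u \<in> bt_edges G"
  using par_adj by (auto simp: pe_def bt_adj_def)

lemma par_neq: "u \<in> nonroot \<Longrightarrow> par u \<noteq> u"
  using par_adj adj_verts by blast

lemma pe_inj: "inj_on pe nonroot"
proof (rule inj_onI)
  fix u v assume u: "u \<in> nonroot" and v: "v \<in> nonroot" and eq: "pe u = pe v"
  have "par u = par v \<and> u = v \<or> par u = v \<and> u = par v"
    using eq unfolding pe_def doubleton_eq_iff by assumption
  then show "u = v"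
  proof
    assume *: "par u = v \<and> u = par v"
    have "dep u = Suc (dep v)" "dep v = Suc (dep u)"
      using dep_par[OF u] dep_par[OF v] * by metis+
    then show ?thesis by simp
  qed simp
qed

lemma edge_pe:
  assumes "f \<in> bt_edges G"
  obtains w where "w \<in> nonroot" "f = pe w"
proof -
  obtain u v where f: "f = {u, v}" "(u, v) \<in> bt_adj G" using edge_adj[OF assms] by metis
  have vu: "(v, u) \<in> bt_adj G" using f(2) adj_sym by blast
  have uv: "dep u = Suc (dep v) \<or> dep v = Suc (dep u)"
    using dep_adj[OF f(2)] dep_adj[OF vu] adj_dep_neq[OF f(2)] by linarith
  then show thesis
  proof
    assume d: "dep u = Suc (dep v)"
    then have "u \<in> nonroot" using dep_root adj_verts[OF vu] by auto
    then show thesis using that[of u] par_eq[OF vu d] f by (auto simp: pe_def)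
  next
    assume d: "dep v = Suc (dep u)"
    then have "v \<in> nonroot" using dep_root adj_verts[OF vu] by auto
    then show thesis using that[of v] par_eq[OF f(2) d] f by (auto simp: pe_def)
  qed
qed

lemma edges_eq: "bt_edges G = pe ` nonroot"
  using pe_edge edge_pe by (metis image_eqI image_subsetI subsetI subset_antisym)

lemma pe_inc: "w \<in> nonroot \<Longrightarrow> pe w \<in> inc u \<longleftrightarrow> u = w \<or> u = par w"
  using pe_edge by (auto simp: bt_incident_def pe_def)

lemma inc_cases:
  assumes "f \<in> inc u"
  obtains "u \<in> nonroot" "f = pe u" | c where "c \<in> nonroot" "par c = u" "f = pe c"
proof -
  have "f \<in> bt_edges G" using assms by (auto simp: bt_incident_def)
  then obtain w where "w \<in> nonroot" "f = pe w" by (rule edge_pe)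
  then show thesis using assms that pe_inc by metis
qed

lemma edge_dist_pe:
  assumes "w \<in> nonroot"
  shows "bt_edge_dist G (pe w) = dep (par w)"
  using dep_par[OF assms] by (simp add: bt_edge_dist_def pe_def)

text \<open>The edge towards the parent has distance \<open>dep u - 1\<close>; every other edge at
  \<open>u\<close> leads to a child and has distance \<open>dep u\<close>. At the exceptional vertex
  all edges tie.\<close>

lemma closest_iff:
  assumes "u \<in> nonroot"
  shows "bt_closest G u f \<longleftrightarrow> f = pe u"
proof
  assume "bt_closest G u f"
  then have f: "f \<in> inc u" "bt_edge_dist G f \<le> bt_edge_dist G (pe u)"
    using assms pe_inc[OF assms] by (auto simp: bt_closest_def)
  from f(1) show "f = pe u"
  proof (cases rule: inc_cases)
    case (2 c)
    then show ?thesis using f(2) edge_dist_pe[OF 2(1)] edge_dist_pe[OF assms] dep_par[OF assms] by simp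
  qed
next
  assume f: "f = pe u"
  have "bt_edge_dist G (pe u) \<le> bt_edge_dist G g" if "g \<in> inc u" for g
    using that
  proof (cases rule: inc_cases)
    case (2 c)
    then show ?thesis using edge_dist_pe[OF 2(1)] edge_dist_pe[OF assms] dep_par[OF assms] by simp
  qed simp
  then show "bt_closest G u f" using f pe_inc[OF assms] by (auto simp: bt_closest_def)
qed

subsection \<open>Descendants\<close>

definition "desc w = {v \<in> bt_verts G. \<exists>k. (par ^^ k) v = w}"

lemma par_root: "par exc = exc" by (simp add: par_def)

lemma par_funpow_root: "(par ^^ k) exc = exc"
  by (induction k) (simp_all add: par_root)

lemma desc_nonroot: "w \<in> nonroot \<Longrightarrow> desc w \<subseteq> nonroot"
  by (auto simp: desc_def par_funpow_root)

lemma desc_self: "w \<in> bt_verts G \<Longrightarrow> w \<in> desc w"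
  by (auto simp: desc_def intro: exI[of _ 0])

lemma dep_par_funpow: "v \<in> bt_verts G \<Longrightarrow> (par ^^ k) v \<noteq> exc \<Longrightarrow> dep v = dep ((par ^^ k) v) + k"
proof (induction k arbitrary: v)
  case (Suc k)
  have v: "v \<in> nonroot" using Suc.prems par_funpow_root[of "Suc k"] by auto
  show ?case using Suc.IH[of "par v"] Suc.prems par_verts dep_par[OF v]
    by (simp add: funpow_swap1)
qed simp

lemma desc_dep: "v \<in> desc w \<Longrightarrow> w \<noteq> exc \<Longrightarrow> dep w \<le> dep v"
  using dep_par_funpow by (auto simp: desc_def)

lemma desc_par: "desc c \<subseteq> desc (par c)"
proof
  fix v assume "v \<in> desc c"
  then obtain k where "v \<in> bt_verts G" "(par ^^ k) v = c" by (auto simp: desc_def)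
  then have "(par ^^ Suc k) v = par c" "v \<in> bt_verts G" by auto
  then show "v \<in> desc (par c)" unfolding desc_def by blast
qed

lemma desc_child_not_self: "c \<in> nonroot \<Longrightarrow> par c \<notin> desc c"
  using desc_dep dep_par by fastforce

text \<open>Siblings have equal depth, so a common descendant would reach both after the same number
  of steps to the parent.\<close>

lemma desc_disjoint:
  assumes "c \<in> nonroot" "c' \<in> nonroot" "par c = par c'" "c \<noteq> c'"
  shows "desc c \<inter> desc c' = {}"
proof -
  have "c = c'" if v: "v \<in> bt_verts G" "(par ^^ k) v = c" "(par ^^ k') v = c'" for v k k'
  proof -
    have "dep v = dep c + k" "dep v = dep c' + k'"
      using dep_par_funpow[OF v(1)] v(2,3) assms(1,2) by auto
    moreover have "dep c = dep c'" using dep_par assms by metis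
    ultimately show ?thesis using v by auto
  qed
  then show ?thesis using assms(4) unfolding desc_def by auto
qed

lemma desc_cases:
  assumes "v \<in> desc w"
  obtains "v = w" | c where "c \<in> nonroot" "par c = w" "v \<in> desc c"
proof (cases "v = w")
  case False
  define k where "k = (LEAST k. (par ^^ k) v = w)"
  have k: "(par ^^ k) v = w" "v \<in> bt_verts G"
    using assms unfolding k_def desc_def by (auto intro: LeastI)
  then obtain n where n: "k = Suc n" using False by (cases k) auto
  let ?c = "(par ^^ n) v"
  \<comment> \<open>This also shows that \<open>?c\<close> is not the root: there \<open>par\<close>
    would fix it and give \<open>?c = w\<close>, against the minimality of \<open>k\<close>.\<close>
  have "?c \<noteq> w" using n k_def not_less_Least[of n "\<lambda>k. (par ^^ k) v = w"] by auto
  moreover have pc: "par ?c = w" using k n by simp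
  ultimately have "?c \<noteq> exc" using par_root by auto
  moreover have "?c \<in> bt_verts G" using k(2) by (induction n) (auto simp: par_verts)
  ultimately show thesis using that(2)[of ?c] pc k(2) by (auto simp: desc_def)
qed (use that in blast)

lemma desc_root: "desc exc = bt_verts G"
proof -
  have "v \<in> desc exc" if "v \<in> bt_verts G" for v
    using that
  proof (induction "dep v" arbitrary: v)
    case 0
    then show ?case using dep_0 desc_self by metis
  next
    case (Suc n)
    then have v: "v \<in> nonroot" using dep_root by auto
    then have "par v \<in> desc exc" using Suc dep_par[OF v] par_verts by auto
    then obtain k where "(par ^^ k) (par v) = exc" by (auto simp: desc_def)
    then have "(par ^^ Suc k) v = exc" by (simp add: funpow_swap1)
    then show ?case using Suc.prems unfolding desc_def by blast
  qed
  then show ?thesis by (auto simp: desc_def)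
qed


section \<open>Single steps of the walk and the cyclic order at a vertex\<close>

lemma other_end_eq: "u \<noteq> w \<Longrightarrow> bt_other_end {u, w} u = w"
  by (auto simp: bt_other_end_def)

lemma step_down:
  assumes "w \<in> nonroot"
  shows "green_step G (par w, pe w) = (w, nxt w (pe w))"
proof -
  have "bt_other_end (pe w) (par w) = w"
    unfolding pe_def by (rule other_end_eq[OF par_neq[OF assms]])
  then show ?thesis by (simp add: green_step_def Let_def)
qed

lemma step_up:
  assumes "w \<in> nonroot"
  shows "green_step G (w, pe w) = (par w, nxt (par w) (pe w))"
proof -
  have "bt_other_end (pe w) w = par w"
    unfolding pe_def insert_commute[of "par w"] by (rule other_end_eq[OF not_sym[OF par_neq[OF assms]]])
  then show ?thesis by (simp add: green_step_def Let_def)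
qed

lemma next_inc: "u \<in> bt_verts G \<Longrightarrow> f \<in> inc u \<Longrightarrow> nxt u f \<in> inc u"
  using cyclic by (rule cyclic_on_inI)

lemma next_pow_inc: "u \<in> bt_verts G \<Longrightarrow> f \<in> inc u \<Longrightarrow> (nxt u ^^ k) f \<in> inc u"
  using cyclic by (rule cyclic_on_funpow_in)

lemma next_pow_bij: "u \<in> bt_verts G \<Longrightarrow> f \<in> inc u \<Longrightarrow> bij_betw (\<lambda>k. (nxt u ^^ k) f) {..<val u} (inc u)"
  using cyclic by (rule cyclic_on_funpow_bij)

lemma next_pow_val: "u \<in> bt_verts G \<Longrightarrow> f \<in> inc u \<Longrightarrow> (nxt u ^^ val u) f = f"
  using cyclic by (rule cyclic_on_funpow_card)

end

section \<open>The walk\<close>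

locale green = btree G m e
  for G :: "'v brauer_tree" and m e :: nat +
  fixes s :: "'v set"
  assumes s_inc: "s \<in> inc exc"
begin

abbreviation "walk \<equiv> green_walk G s"
abbreviation "trav t \<equiv> snd (walk t)"
abbreviation "first \<equiv> green_first G s"

text \<open>The edge at \<open>u\<close> that the walk meets first: the start edge at the
  exceptional vertex, elsewhere the edge by which \<open>u\<close> is entered. Edges at
  \<open>u\<close> are indexed from it.\<close>

definition "base u = (if u = exc then s else pe u)"

lemma walk_0: "walk 0 = (exc, s)"
  and walk_Suc: "walk (Suc t) = green_step G (walk t)"
  by (simp_all add: green_walk_def)

lemma base_inc: "u \<in> bt_verts G \<Longrightarrow> base u \<in> inc u"
  using s_inc pe_inc[of u u] by (auto simp: base_def)

lemma first_eq: "trav t = f \<Longrightarrow> (\<And>t'. t' < t \<Longrightarrow> trav t' \<noteq> f) \<Longrightarrow> first f = t"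
  unfolding green_first_def by (rule Least_equality) (auto simp: not_less[symmetric])

definition "ordered u \<longleftrightarrow>
  (\<forall>j k. j < k \<and> k < val u \<longrightarrow> first ((nxt u ^^ j) (base u)) < first ((nxt u ^^ k) (base u)))"

text \<open>The inductive statement about a subtree. The entry time \<open>T\<close> is arbitrary,
  and freshness is a premise because \<open>first\<close> refers to the walk from time 0: with it,
  first visits within the excursion are first visits overall. In the end state the walk is about to
  take the next edge at \<open>par w\<close>.\<close>

definition "excursion w \<longleftrightarrow>
  (\<forall>T. walk T = (par w, pe w) \<and> (\<forall>t<T. trav t \<notin> pe ` desc w) \<longrightarrow>
    (\<exists>n. n > 0 \<and> walk (T + n) = (par w, nxt (par w) (pe w)) \<and>
      trav ` {T..<T + n} = pe ` desc w \<and> (\<forall>y \<in> desc w. ordered y)))"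

text \<open>Chains the excursions into \<open>q\<close> cyclically consecutive children. It serves a
  nonroot vertex, with the edges after \<open>pe w\<close>, as well as the root, with all edges from
  \<open>s\<close> on at time 0.\<close>

lemma scan:
  assumes "walk T = (w, c)"
    and "\<And>k. k < q \<Longrightarrow> v k \<in> nonroot \<and> par (v k) = w \<and> (nxt w ^^ k) c = pe (v k) \<and> excursion (v k)"
    and "inj_on v {..<q}"
    and "\<And>k t. k < q \<Longrightarrow> t < T \<Longrightarrow> trav t \<notin> pe ` desc (v k)"
  shows "\<exists>n. walk (T + n) = (w, (nxt w ^^ q) c) \<and> trav ` {T..<T + n} = (\<Union>k<q. pe ` desc (v k)) \<and>
    (\<forall>k<q. T \<le> first (pe (v k)) \<and> first (pe (v k)) < T + n) \<and>
    (\<forall>j k. j < k \<and> k < q \<longrightarrow> first (pe (v j)) < first (pe (v k))) \<and>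
    (\<forall>k<q. \<forall>y \<in> desc (v k). ordered y)"
  using assms(2-)
proof (induction q)
  case 0
  show ?case using assms(1) by (intro exI[of _ 0]) simp
next
  case (Suc q)
  have inj: "inj_on v {..<q}" using Suc.prems(2) by (rule inj_on_subset) auto
  have "\<exists>n. walk (T + n) = (w, (nxt w ^^ q) c) \<and>
    trav ` {T..<T + n} = (\<Union>k<q. pe ` desc (v k)) \<and>
    (\<forall>k<q. T \<le> first (pe (v k)) \<and> first (pe (v k)) < T + n) \<and>
    (\<forall>j k. j < k \<and> k < q \<longrightarrow> first (pe (v j)) < first (pe (v k))) \<and>
    (\<forall>k<q. \<forall>y \<in> desc (v k). ordered y)"
  proof (rule Suc.IH)
    show "inj_on v {..<q}" by (fact inj)
    show "v k \<in> nonroot \<and> par (v k) = w \<and> (nxt w ^^ k) c = pe (v k) \<and> excursion (v k)" if "k < q" for k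
      using Suc.prems(1)[of k, OF less_SucI[OF that]] .
    show "trav t \<notin> pe ` desc (v k)" if "k < q" "t < T" for k t
      using Suc.prems(3)[of k t, OF less_SucI[OF that(1)] that(2)] .
  qed
  then obtain n where n: "walk (T + n) = (w, (nxt w ^^ q) c)"
      "trav ` {T..<T + n} = (\<Union>k<q. pe ` desc (v k))"
      "\<forall>k<q. T \<le> first (pe (v k)) \<and> first (pe (v k)) < T + n"
      "\<forall>j k. j < k \<and> k < q \<longrightarrow> first (pe (v j)) < first (pe (v k))"
      "\<forall>k<q. \<forall>y \<in> desc (v k). ordered y"
    by (elim exE conjE) (rule that)
  have v: "v k \<in> nonroot" "par (v k) = w" "(nxt w ^^ k) c = pe (v k)" "excursion (v k)" if "k < Suc q" for k
    using Suc.prems(1)[OF that] by - (elim conjE, assumption)+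
  \<comment> \<open>Sibling subtrees are disjoint and \<open>pe\<close> is injective, so the earlier
    excursions have used no edge of the next subtree.\<close>
  have fresh: "trav t \<notin> pe ` desc (v q)" if "t < T + n" for t
  proof (cases "t < T")
    case False
    then have "trav t \<in> trav ` {T..<T + n}" using that by auto
    then obtain k where k: "k < q" "trav t \<in> pe ` desc (v k)"
      unfolding n(2) by blast
    have "v k \<noteq> v q" using Suc.prems(2) k(1) by (auto simp: inj_on_def)
    then have disj: "desc (v k) \<inter> desc (v q) = {}"
      using v[of k] v[of q] k(1) by (intro desc_disjoint) auto
    show ?thesis
    proof
      assume "trav t \<in> pe ` desc (v q)"
      then obtain y where y: "y \<in> desc (v q)" "trav t = pe y" by blast
      obtain z where z: "z \<in> desc (v k)" "trav t = pe z" using k(2) by blast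
      have "y \<in> nonroot" "z \<in> nonroot"
        using y z desc_nonroot v(1)[of k] v(1)[of q] k(1) by (meson lessI less_SucI subsetD)+
      then have "y = z" using y(2) z(2) pe_inj by (metis inj_onD)
      then show False using y(1) z(1) disj by blast
    qed
  qed (use Suc.prems(3) in auto)
  have at: "walk (T + n) = (par (v q), pe (v q))" using n(1) v[of q] by simp
  moreover have "\<forall>t<T + n. trav t \<notin> pe ` desc (v q)" using fresh by blast
  ultimately obtain n' where n': "n' > 0"
      "walk (T + n + n') = (w, nxt w (pe (v q)))"
      "trav ` {T + n..<T + n + n'} = pe ` desc (v q)" "\<forall>y \<in> desc (v q). ordered y"
    using v(4)[of q] v(2)[of q] unfolding excursion_def by (metis lessI)
  have "pe (v q) \<in> pe ` desc (v q)" using desc_self v(1)[of q] by auto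
  then have first: "first (pe (v q)) = T + n"
    using at fresh by (intro first_eq) (simp, metis)
  have split: "{T..<T + (n + n')} = {T..<T + n} \<union> {T + n..<T + n + n'}" by auto
  show ?case
  proof (intro exI[of _ "n + n'"] conjI allI impI)
    show "walk (T + (n + n')) = (w, (nxt w ^^ Suc q) c)" using n'(2) v(3)[of q] by (simp add: add.assoc)
    show "trav ` {T..<T + (n + n')} = (\<Union>k<Suc q. pe ` desc (v k))"
      unfolding split image_Un n(2) n'(3) lessThan_Suc by blast
    show "T \<le> first (pe (v k))" if "k < Suc q" for k
      using that n(3) first by (cases "k = q") auto
    show "first (pe (v k)) < T + (n + n')" if "k < Suc q" for k
    proof (cases "k = q")
      case False
      then have "first (pe (v k)) < T + n" using that n(3) by auto
      then show ?thesis by simp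
    qed (use first n'(1) in simp)
    show "first (pe (v j)) < first (pe (v k))" if "j < k \<and> k < Suc q" for j k
      using that n(3,4) first by (cases "k = q") auto
    show "\<forall>y \<in> desc (v k). ordered y" if "k < Suc q" for k
      using that n(5) n'(4) by (cases "k < q") (auto simp: less_Suc_eq)
  qed
qed

text \<open>Strong induction on the size of the subtree. After the step down, the edges taken in
  turn at \<open>w\<close> are its \<open>val w - 1\<close> child edges and then \<open>pe w\<close>
  again, which leads back up. A leaf is the case \<open>r = 0\<close>.\<close>

lemma excursion:
  assumes "w \<in> nonroot"
  shows "excursion w"
  using assms
proof (induction "card (desc w)" arbitrary: w rule: less_induct)
  case less
  note w = less.prems
  have wV: "w \<in> bt_verts G" using w by simp
  define r where "r = val w - 1"
  have r: "val w = Suc r" using val_pos[OF wV] by (simp add: r_def)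
  have pw: "pe w \<in> inc w" using pe_inc[OF w] by simp
  let ?b = "\<lambda>k. (nxt w ^^ k) (pe w)"
  define v where "v k = the_inv_into nonroot pe (?b (Suc k))" for k
  have bij: "bij_betw ?b {..<Suc r} (inc w)" using next_pow_bij[OF wV pw] r by simp
  have binj: "j = k" if "?b j = ?b k" "j < Suc r" "k < Suc r" for j k
    by (rule inj_onD[OF bij_betw_imp_inj_on[OF bij] that(1)]) (simp_all only: lessThan_iff that(2,3))
  have bsurj: "\<exists>k < Suc r. f = ?b k" if "f \<in> inc w" for f
    using that bij unfolding bij_betw_def by blast
  have v: "v k \<in> nonroot \<and> par (v k) = w \<and> ?b (Suc k) = pe (v k)" if k: "k < r" for k
  proof -
    have "?b (Suc k) \<in> inc w" by (rule next_pow_inc[OF wV pw])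
    then show ?thesis
    proof (cases rule: inc_cases)
      case 1
      then have "?b (Suc k) = ?b 0" by simp
      then have "Suc k = 0" by (rule binj) (use k in simp_all)
      then show ?thesis by simp
    next
      case (2 c)
      then have "v k = c" unfolding v_def by (simp only: the_inv_into_f_f[OF pe_inj 2(1)])
      then show ?thesis using 2 by simp
    qed
  qed
  have sub: "desc (v k) \<subset> desc w" if "k < r" for k
    using desc_par[of "v k"] desc_child_not_self[of "v k"] v[OF that] desc_self[OF wV] by auto
  have IH: "excursion (v k)" if k: "k < r" for k
  proof -
    have "finite (desc w)" using finite_verts by (simp add: desc_def)
    then have "card (desc (v k)) < card (desc w)" using sub[OF k] by (rule psubset_card_mono)
    then show ?thesis using less.hyps v[OF k] by blast
  qed
  have inj: "inj_on v {..<r}"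
  proof (rule inj_onI)
    fix j k assume jk: "j \<in> {..<r}" "k \<in> {..<r}" "v j = v k"
    have "?b (Suc j) = ?b (Suc k)" using v[of j] v[of k] jk by (simp only: lessThan_iff)
    then have "Suc j = Suc k" by (rule binj) (use jk in simp_all)
    then show "j = k" by simp
  qed
  have children: "desc w = insert w (\<Union>k<r. desc (v k))"
  proof
    show "insert w (\<Union>k<r. desc (v k)) \<subseteq> desc w" using sub desc_self[OF wV] by auto
    show "desc w \<subseteq> insert w (\<Union>k<r. desc (v k))"
    proof
      fix y assume "y \<in> desc w"
      then show "y \<in> insert w (\<Union>k<r. desc (v k))"
      proof (cases rule: desc_cases)
        case (2 c)
        have "pe c \<in> inc w" using pe_inc 2 by auto
        then obtain k where k: "k < Suc r" "pe c = ?b k" using bsurj by blast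
        have "k \<noteq> 0"
        proof
          assume "k = 0"
          then have "pe c = pe w" using k by simp
          then have "c = w" using pe_inj 2(1) w by (metis inj_onD)
          then show False using par_neq[OF w] 2 by simp
        qed
        then obtain i where i: "k = Suc i" "i < r" using k(1) by (cases k) auto
        have "pe (v i) = pe c" using v[OF i(2)] k(2) i(1) by (simp only:)
        then have "v i = c" using v[OF i(2)] pe_inj 2(1) by (metis inj_onD)
        then show ?thesis using 2(3) i(2) by auto
      qed simp
    qed
  qed
  show ?case unfolding excursion_def
  proof (intro allI impI, elim conjE)
    fix T assume T: "walk T = (par w, pe w)" and fresh: "\<forall>t<T. trav t \<notin> pe ` desc w"
    have T1: "walk (Suc T) = (w, nxt w (pe w))" using T step_down[OF w] by (simp add: walk_Suc)
    have pw_not: "pe w \<notin> pe ` desc (v k)" if k: "k < r" for k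
    proof
      assume "pe w \<in> pe ` desc (v k)"
      then obtain y where "y \<in> desc (v k)" "pe w = pe y" by auto
      then have "w \<in> desc (v k)" using pe_inj w desc_nonroot[of "v k"] v[OF k] by (metis inj_onD subsetD)
      then show False using desc_child_not_self[of "v k"] v[OF k] by simp
    qed
    have "\<exists>n. walk (Suc T + n) = (w, (nxt w ^^ r) (nxt w (pe w))) \<and>
      trav ` {Suc T..<Suc T + n} = (\<Union>k<r. pe ` desc (v k)) \<and>
      (\<forall>k<r. Suc T \<le> first (pe (v k)) \<and> first (pe (v k)) < Suc T + n) \<and>
      (\<forall>j k. j < k \<and> k < r \<longrightarrow> first (pe (v j)) < first (pe (v k))) \<and>
      (\<forall>k<r. \<forall>y \<in> desc (v k). ordered y)"
    proof (rule scan[where w = w and c = "nxt w (pe w)" and T = "Suc T" and v = v and q = r])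
      show "walk (Suc T) = (w, nxt w (pe w))" by (fact T1)
      show "inj_on v {..<r}" by (fact inj)
      show "v k \<in> nonroot \<and> par (v k) = w \<and> (nxt w ^^ k) (nxt w (pe w)) = pe (v k) \<and> excursion (v k)"
        if "k < r" for k
      proof -
        have "(nxt w ^^ k) (nxt w (pe w)) = ?b (Suc k)" by (simp only: funpow_Suc_right o_apply)
        then show ?thesis using v[OF that] IH[OF that] by metis
      qed
      show "trav t \<notin> pe ` desc (v k)" if "k < r" "t < Suc T" for k t
      proof (cases "t = T")
        case True
        then show ?thesis using pw_not[OF that(1)] T by (simp only: snd_conv not_False_eq_True)
      next
        case False
        then have "t < T" using that(2) by simp
        then have "trav t \<notin> pe ` desc w" using fresh by blast
        then show ?thesis using sub[OF that(1)] by blast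
      qed
    qed
    then obtain n where n: "walk (Suc T + n) = (w, (nxt w ^^ r) (nxt w (pe w)))"
      "trav ` {Suc T..<Suc T + n} = (\<Union>k<r. pe ` desc (v k))"
      "\<forall>k<r. Suc T \<le> first (pe (v k)) \<and> first (pe (v k)) < Suc T + n"
      "\<forall>j k. j < k \<and> k < r \<longrightarrow> first (pe (v j)) < first (pe (v k))"
      "\<forall>k<r. \<forall>y \<in> desc (v k). ordered y"
      by (elim exE conjE) (rule that)
    have "(nxt w ^^ r) (nxt w (pe w)) = pe w"
      using next_pow_val[OF wV pw] unfolding r by (simp only: funpow_Suc_right o_apply)
    then have up: "walk (Suc T + n) = (w, pe w)" using n(1) by simp
    \<comment> \<open>\<open>n + 2\<close> counts the step down, the excursions into the children
      and the step up.\<close>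
    then have ret: "walk (T + (n + 2)) = (par w, nxt (par w) (pe w))"
      using step_up[OF w] walk_Suc[of "Suc T + n"] by simp
    have "{T..<T + (n + 2)} = {T} \<union> {Suc T..<Suc T + n} \<union> {Suc T + n}" by auto
    then have tr: "trav ` {T..<T + (n + 2)} = insert (pe w) (\<Union>k<r. pe ` desc (v k))"
      unfolding image_Un n(2)[symmetric] using up T by auto
    have fw: "first (pe w) = T"
      using T fresh desc_self[OF wV] by (intro first_eq) auto
    have "ordered w"
      unfolding ordered_def
    proof (intro allI impI)
      fix j k assume jk: "j < k \<and> k < val w"
      then obtain k' where k': "k = Suc k'" "k' < r" using r by (cases k) auto
      have bw: "base w = pe w" using w by (simp add: base_def)
      show "first ((nxt w ^^ j) (base w)) < first ((nxt w ^^ k) (base w))"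
      proof (cases j)
        case 0
        then show ?thesis using fw n(3) v[OF k'(2)] k' bw by (simp add: Suc_le_eq)
      next
        case (Suc j')
        then show ?thesis using n(4) v[of j'] v[OF k'(2)] k' jk bw by auto
      qed
    qed
    then have "\<forall>y \<in> desc w. ordered y" using n(5) children by auto
    moreover have "trav ` {T..<T + (n + 2)} = pe ` desc w"
      unfolding tr children by auto
    ultimately show "\<exists>n>0. walk (T + n) = (par w, nxt (par w) (pe w)) \<and>
        trav ` {T..<T + n} = pe ` desc w \<and> (\<forall>y \<in> desc w. ordered y)"
      using ret by (intro exI[of _ "n + 2"]) simp
  qed
qed

text \<open>The root has no parent edge, so \<open>scan\<close> is applied to it directly: at time 0
  freshness is void, and the \<open>val exc\<close> edges at the root cover all subtrees below
  it.\<close>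

lemma walk_visits: "f \<in> bt_edges G \<Longrightarrow> \<exists>t. trav t = f"
  and ordered: "u \<in> bt_verts G \<Longrightarrow> ordered u"
proof -
  let ?r = "val exc"
  let ?b = "\<lambda>k. (nxt exc ^^ k) s"
  define v where "v k = the_inv_into nonroot pe (?b k)" for k
  note bij = next_pow_bij[OF root_vert s_inc]
  have v: "v k \<in> nonroot \<and> par (v k) = exc \<and> ?b k = pe (v k) \<and> excursion (v k)" for k
  proof -
    have "?b k \<in> inc exc" by (rule next_pow_inc[OF root_vert s_inc])
    then show ?thesis
    proof (cases rule: inc_cases)
      case (2 c)
      then have "v k = c" unfolding v_def by (simp only: the_inv_into_f_f[OF pe_inj 2(1)])
      then show ?thesis using 2 excursion by simp
    qed simp
  qed
  have inj: "inj_on v {..<?r}"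
  proof (rule inj_onI)
    fix j k assume jk: "j \<in> {..<?r}" "k \<in> {..<?r}" "v j = v k"
    have "?b j = ?b k" using v[of j] v[of k] jk(3) by (simp only:)
    then show "j = k" by (rule inj_onD[OF bij_betw_imp_inj_on[OF bij]]) (use jk in simp_all)
  qed
  have nonroot: "nonroot \<subseteq> (\<Union>k<?r. desc (v k))"
  proof
    fix y assume y: "y \<in> nonroot"
    then have "y \<in> desc exc" using desc_root by simp
    then show "y \<in> (\<Union>k<?r. desc (v k))"
    proof (cases rule: desc_cases)
      case (2 c)
      have "pe c \<in> inc exc" using pe_inc 2 by auto
      then obtain k where k: "k < ?r" "pe c = ?b k"
        using bij unfolding bij_betw_def by blast
      then have "pe (v k) = pe c" using v[of k] by (simp only:)
      then have "v k = c" using v[of k] pe_inj 2(1) by (metis inj_onD)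
      then show ?thesis using 2(3) k(1) by auto
    qed (use y in simp)
  qed
  obtain n where n: "trav ` {0..<n} = (\<Union>k<?r. pe ` desc (v k))"
      "\<forall>j k. j < k \<and> k < ?r \<longrightarrow> first (pe (v j)) < first (pe (v k))"
      "\<forall>k<?r. \<forall>y \<in> desc (v k). ordered y"
    using scan[OF walk_0 _ inj] v by auto
  show "\<exists>t. trav t = f" if "f \<in> bt_edges G"
  proof -
    have "f \<in> (\<Union>k<?r. pe ` desc (v k))" using that nonroot unfolding edges_eq by blast
    then show ?thesis unfolding n(1)[symmetric] by auto
  qed
  show "ordered u" if "u \<in> bt_verts G"
  proof (cases "u = exc")
    case True
    have "base exc = s" by (simp add: base_def)
    then show ?thesis using n(2) v True unfolding ordered_def by simp
  next
    case False
    then show ?thesis using nonroot that n(3) by blast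
  qed
qed

subsection \<open>The numbering\<close>

abbreviation "num \<equiv> green_number G s"

lemma trav_first: "f \<in> bt_edges G \<Longrightarrow> trav (first f) = f"
  unfolding green_first_def using walk_visits by (rule LeastI_ex)

lemma first_inj: "inj_on first (bt_edges G)"
  by (rule inj_on_inverseI[of _ trav]) (rule trav_first)

text \<open>The number of an edge counts the edges first visited no later; a strictly later first
  visit adds at least the later edge itself.\<close>

lemma num_less_iff:
  assumes "f \<in> bt_edges G" "g \<in> bt_edges G"
  shows "num f < num g \<longleftrightarrow> first f < first g"
proof
  assume less: "first f < first g"
  let ?B = "\<lambda>h. {g \<in> bt_edges G. first g \<le> first h}"
  have "g \<in> ?B g" "g \<notin> ?B f" "?B f \<subseteq> ?B g" using less assms by auto
  then have "?B f \<subset> ?B g" by blast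
  then show "num f < num g" unfolding green_number_def using finite_edges
    by (intro psubset_card_mono) auto
next
  assume "num f < num g"
  show "first f < first g"
  proof (rule ccontr)
    assume "\<not> first f < first g"
    then have "num g \<le> num f" unfolding green_number_def using finite_edges
      by (intro card_mono) auto
    then show False using \<open>num f < num g\<close> by simp
  qed
qed

lemma num_bij: "bij_betw num (bt_edges G) {1..e}"
proof -
  have inj: "inj_on num (bt_edges G)"
    using num_less_iff first_inj by (intro inj_onI) (metis inj_onD linorder_neq_iff)
  have "num ` bt_edges G \<subseteq> {1..e}"
  proof
    fix i assume "i \<in> num ` bt_edges G"
    then obtain f where f: "f \<in> bt_edges G" "i = num f" by auto
    have "card {f} \<le> num f" unfolding green_number_def using f finite_edges by (intro card_mono) auto
    moreover have "num f \<le> e" unfolding green_number_def e_def using finite_edges by (intro card_mono) auto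
    ultimately show "i \<in> {1..e}" using f by auto
  qed
  moreover have "card (num ` bt_edges G) = card {1..e}" using card_image[OF inj] e_def by simp
  ultimately have "num ` bt_edges G = {1..e}" by (intro card_subset_eq) auto
  then show ?thesis using inj by (simp add: bij_betw_def)
qed

lemma green_edge:
  assumes "i \<in> {1..e}"
  shows "green_edge G s i \<in> bt_edges G" "num (green_edge G s i) = i"
proof -
  have i: "i \<in> num ` bt_edges G" using num_bij assms by (simp add: bij_betw_def)
  show "green_edge G s i \<in> bt_edges G" unfolding green_edge_def
    using the_inv_into_into[OF bij_betw_imp_inj_on[OF num_bij] i] by auto
  show "num (green_edge G s i) = i" unfolding green_edge_def
    by (rule f_the_inv_into_f[OF bij_betw_imp_inj_on[OF num_bij] i])
qed

lemma num_mono: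
  assumes "u \<in> bt_verts G" "j < k" "k < val u"
  shows "num ((nxt u ^^ j) (base u)) < num ((nxt u ^^ k) (base u))"
  using ordered[OF assms(1)] assms num_less_iff next_pow_inc[OF assms(1) base_inc[OF assms(1)]]
  by (simp add: ordered_def bt_incident_def)

end

section \<open>Graded homomorphisms between left ideals generated by idempotents\<close>

text \<open>\<open>V\<close> is a bare record, so even the vector space axioms are carried over from
  the field along \<open>\<phi>\<close>; the basis is then the single vector
  \<open>\<phi> 1\<close>.\<close>

lemma dim_one_transfer:
  fixes V :: "('k::field, 'b) module" and \<phi> :: "'k \<Rightarrow> 'b"
  assumes bij: "bij_betw \<phi> UNIV (carrier V)"
    and add: "\<And>a b. \<phi> (a + b) = \<phi> a \<oplus>\<^bsub>V\<^esub> \<phi> b"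
    and smult: "\<And>a b. \<phi> (a * b) = a \<odot>\<^bsub>V\<^esub> \<phi> b"
    and zero: "\<phi> 0 = \<zero>\<^bsub>V\<^esub>"
  shows "vectorspace.dim class_ring V = 1"
proof -
  have car: "\<exists>a. x = \<phi> a" if "x \<in> carrier V" for x
    using that bij unfolding bij_betw_def by blast
  have \<phi>: "\<phi> a \<in> carrier V" for a using bij unfolding bij_betw_def by blast
  have inj: "\<phi> a = \<phi> b \<longleftrightarrow> a = b" for a b using bij unfolding bij_betw_def inj_on_def by blast
  have V: "abelian_group V"
  proof (rule abelian_groupI)
    fix x y z assume "x \<in> carrier V" "y \<in> carrier V" "z \<in> carrier V"
    then obtain a b c where "x = \<phi> a" "y = \<phi> b" "z = \<phi> c" using car by meson
    then show "x \<oplus>\<^bsub>V\<^esub> y \<oplus>\<^bsub>V\<^esub> z = x \<oplus>\<^bsub>V\<^esub> (y \<oplus>\<^bsub>V\<^esub> z)" by (simp add: add[symmetric] add.assoc)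
  next
    fix x y assume "x \<in> carrier V" "y \<in> carrier V"
    then obtain a b where "x = \<phi> a" "y = \<phi> b" using car by meson
    then show "x \<oplus>\<^bsub>V\<^esub> y \<in> carrier V" "x \<oplus>\<^bsub>V\<^esub> y = y \<oplus>\<^bsub>V\<^esub> x"
      using \<phi> by (simp_all add: add[symmetric] add.commute)
  next
    show "\<zero>\<^bsub>V\<^esub> \<in> carrier V" using \<phi> zero by metis
  next
    fix x assume "x \<in> carrier V"
    then obtain a where a: "x = \<phi> a" using car by meson
    then show "\<zero>\<^bsub>V\<^esub> \<oplus>\<^bsub>V\<^esub> x = x" by (simp add: add[symmetric] zero[symmetric])
    have "\<phi> (- a) \<oplus>\<^bsub>V\<^esub> x = \<zero>\<^bsub>V\<^esub>" by (simp add: a add[symmetric] zero[symmetric])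
    then show "\<exists>y\<in>carrier V. y \<oplus>\<^bsub>V\<^esub> x = \<zero>\<^bsub>V\<^esub>" using \<phi> by blast
  qed
  have "cring (class_ring :: 'k ring)" by (rule domain.axioms(1)[OF field.axioms(1)[OF class_field]])
  then have "module (class_ring :: 'k ring) V"
  proof (rule moduleI[OF _ V])
    fix a :: 'k and x assume "x \<in> carrier V"
    then obtain b where b: "x = \<phi> b" using car by meson
    show "a \<odot>\<^bsub>V\<^esub> x \<in> carrier V" using \<phi> by (simp add: b smult[symmetric])
    show "\<one>\<^bsub>class_ring :: 'k ring\<^esub> \<odot>\<^bsub>V\<^esub> x = x" by (simp add: b smult[symmetric])
  next
    fix a b :: 'k and x assume "x \<in> carrier V"
    then obtain c where c: "x = \<phi> c" using car by meson
    show "(a \<oplus>\<^bsub>class_ring\<^esub> b) \<odot>\<^bsub>V\<^esub> x = a \<odot>\<^bsub>V\<^esub> x \<oplus>\<^bsub>V\<^esub> b \<odot>\<^bsub>V\<^esub> x"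
      by (simp add: c smult[symmetric] add[symmetric] distrib_right)
    show "a \<otimes>\<^bsub>class_ring\<^esub> b \<odot>\<^bsub>V\<^esub> x = a \<odot>\<^bsub>V\<^esub> (b \<odot>\<^bsub>V\<^esub> x)"
      by (simp add: c smult[symmetric] mult.assoc)
  next
    fix a :: 'k and x y assume "x \<in> carrier V" "y \<in> carrier V"
    then obtain b c where bc: "x = \<phi> b" "y = \<phi> c" using car by meson
    show "a \<odot>\<^bsub>V\<^esub> (x \<oplus>\<^bsub>V\<^esub> y) = a \<odot>\<^bsub>V\<^esub> x \<oplus>\<^bsub>V\<^esub> a \<odot>\<^bsub>V\<^esub> y"
      by (simp add: bc smult[symmetric] add[symmetric] distrib_left)
  qed
  then interpret vectorspace "class_ring :: 'k ring" V
    using class_field by (intro vectorspace.intro)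
  have lin: "lincomb a {\<phi> 1} = \<phi> (a (\<phi> 1))" for a
    using \<phi> M.finsum_insert[of "{}" "\<phi> 1" "\<lambda>v. a v \<odot>\<^bsub>V\<^esub> v"]
    by (simp add: lincomb_def smult[symmetric])
  have "basis {\<phi> 1}"
  proof (subst basis_criterion)
    show "\<forall>v. v \<in> carrier V \<longrightarrow> (\<exists>!a. a \<in> {\<phi> 1} \<rightarrow>\<^sub>E carrier class_ring \<and> lincomb a {\<phi> 1} = v)"
    proof (intro allI impI)
      fix v assume "v \<in> carrier V"
      then obtain c where c: "v = \<phi> c" using car by meson
      show "\<exists>!a. a \<in> {\<phi> 1} \<rightarrow>\<^sub>E carrier class_ring \<and> lincomb a {\<phi> 1} = v"
        unfolding lin c inj
        by (rule ex1I[of _ "\<lambda>x \<in> {\<phi> 1}. c"]) (auto simp: PiE_def extensional_def fun_eq_iff)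
    qed
  qed (use \<phi> in auto)
  from dim_basis[OF _ this] show ?thesis by simp
qed

lemma dim_zero_transfer:
  fixes V :: "('k::field, 'b) module"
  assumes car: "carrier V = {\<zero>\<^bsub>V\<^esub>}"
    and add: "\<zero>\<^bsub>V\<^esub> \<oplus>\<^bsub>V\<^esub> \<zero>\<^bsub>V\<^esub> = \<zero>\<^bsub>V\<^esub>"
    and smult: "\<And>a. a \<odot>\<^bsub>V\<^esub> \<zero>\<^bsub>V\<^esub> = \<zero>\<^bsub>V\<^esub>"
  shows "vectorspace.dim (class_ring :: 'k ring) V = 0"
proof -
  have "abelian_group V"
    by (rule abelian_groupI) (auto simp: car add)
  moreover have "cring (class_ring :: 'k ring)" by (rule domain.axioms(1)[OF field.axioms(1)[OF class_field]])
  ultimately have "module (class_ring :: 'k ring) V"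
    by (intro moduleI) (auto simp: car add smult)
  then interpret vectorspace "class_ring :: 'k ring" V
    using class_field by (intro vectorspace.intro)
  have "span {\<zero>\<^bsub>V\<^esub>} = carrier V"
    using in_own_span[of "{\<zero>\<^bsub>V\<^esub>}"] span_is_subset2[of "{\<zero>\<^bsub>V\<^esub>}"] car by auto
  then show ?thesis by (rule dim0I)
qed

section \<open>Degree-preserving maps between left ideals of idempotents\<close>

definition left_ideal_module :: "('a, 'r) ring_scheme \<Rightarrow> 'a \<Rightarrow> ('a, 'a) module" where
  "left_ideal_module A \<epsilon> =
     \<lparr>carrier = {a \<otimes>\<^bsub>A\<^esub> \<epsilon> | a. a \<in> carrier A}, mult = undefined, one = undefined,
      zero = \<zero>\<^bsub>A\<^esub>, add = add A, smult = mult A\<rparr>"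

locale graded_corner = ring A for A (structure) +
  fixes gr :: "int \<Rightarrow> 'a set" and \<epsilon> \<eta> :: 'a
  assumes eps: "\<epsilon> \<in> carrier A" "\<epsilon> \<otimes> \<epsilon> = \<epsilon>" "\<epsilon> \<in> gr 0"
    and eta: "\<eta> \<in> carrier A" "\<eta> \<otimes> \<eta> = \<eta>"
    and gr_carrier: "gr n \<subseteq> carrier A"
    and gr_mult: "x \<in> gr n \<Longrightarrow> y \<in> gr l \<Longrightarrow> x \<otimes> y \<in> gr (l + n)"
begin

abbreviation "M \<equiv> left_ideal_module A \<epsilon>"
abbreviation "N \<equiv> left_ideal_module A \<eta>"
abbreviation "right_mult y \<equiv> (\<lambda>x \<in> carrier M. x \<otimes> y)"
abbreviation "homs l \<equiv> graded_homs A M (\<lambda>n. carrier M \<inter> gr n) N (grading_shift (\<lambda>n. carrier N \<inter> gr n) l)"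

definition "corner l = {y \<in> gr l. \<epsilon> \<otimes> y = y \<and> y \<otimes> \<eta> = y}"

lemma M_iff: "x \<in> carrier M \<longleftrightarrow> x \<in> carrier A \<and> x \<otimes> \<epsilon> = x"
  using eps by (auto simp: left_ideal_module_def m_assoc) metis

lemma N_iff: "x \<in> carrier N \<longleftrightarrow> x \<in> carrier A \<and> x \<otimes> \<eta> = x"
  using eta by (auto simp: left_ideal_module_def m_assoc) metis

lemma corner_carrier: "y \<in> corner l \<Longrightarrow> y \<in> carrier A"
  using gr_carrier by (auto simp: corner_def)

text \<open>A map out of \<open>M\<close> is determined by the image of \<open>\<epsilon>\<close>,
  since \<open>x \<otimes> \<epsilon> = x\<close> there. As \<open>\<epsilon>\<close> has degree 0,
  preserving degrees into the shift by \<open>l\<close> puts that image in \<open>gr l\<close>;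
  conversely, right multiplication by an element of degree \<open>l\<close> raises degrees by
  \<open>l\<close>.\<close>

lemma graded_homs_eq: "homs l = (\<lambda>y. right_mult y) ` corner l"
proof (intro equalityI subsetI)
  fix h assume h: "h \<in> homs l"
  have eM: "\<epsilon> \<in> carrier M" using eps by (simp add: M_iff)
  have lin: "h (a \<otimes> x) = a \<otimes> h x" if "a \<in> carrier A" "x \<in> carrier M" for a x
    using h that by (auto simp: graded_homs_def left_ideal_module_def)
  have "h ` (carrier M \<inter> gr 0) \<subseteq> carrier N \<inter> gr (l + 0)"
    using h unfolding graded_homs_def grading_shift_def by blast
  then have y: "h \<epsilon> \<in> carrier N" "h \<epsilon> \<in> gr l" using eM eps(3) by auto
  have "\<epsilon> \<otimes> h \<epsilon> = h \<epsilon>" using lin[OF eps(1) eM] eps by simp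
  then have "h \<epsilon> \<in> corner l" using y by (simp add: corner_def N_iff)
  moreover have "h = right_mult (h \<epsilon>)"
  proof
    fix x
    show "h x = right_mult (h \<epsilon>) x"
    proof (cases "x \<in> carrier M")
      case True
      then show ?thesis using lin[of x \<epsilon>] eM by (simp add: M_iff)
    next
      case False
      then show ?thesis using h by (auto simp: graded_homs_def PiE_def extensional_def)
    qed
  qed
  ultimately show "h \<in> (\<lambda>y. right_mult y) ` corner l" by (rule rev_image_eqI)
next
  fix h assume "h \<in> (\<lambda>y. right_mult y) ` corner l"
  then obtain y where y: "y \<in> corner l" and h: "h = right_mult y" by blast
  note yA = corner_carrier[OF y]
  have yn: "y \<otimes> \<eta> = y" "y \<in> gr l" using y by (auto simp: corner_def)
  have N: "x \<otimes> y \<in> carrier N" if "x \<in> carrier M" for x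
    using that yA yn eta by (simp add: M_iff N_iff m_assoc)
  have ops: "add M = add A" "add N = add A" "smult M = mult A" "smult N = mult A"
    by (simp_all add: left_ideal_module_def)
  show "h \<in> homs l"
    unfolding graded_homs_def grading_shift_def ops mem_Collect_eq h
  proof (intro conjI ballI allI)
    show "right_mult y \<in> carrier M \<rightarrow>\<^sub>E carrier N" using N by auto
    show "right_mult y (a \<oplus> b) = right_mult y a \<oplus> right_mult y b"
      if "a \<in> carrier M" "b \<in> carrier M" for a b
      using that yA eps by (simp add: M_iff l_distr)
    show "right_mult y (a \<otimes> x) = a \<otimes> right_mult y x"
      if "a \<in> carrier A" "x \<in> carrier M" for a x
      using that yA eps by (simp add: M_iff m_assoc)
    show "right_mult y ` (carrier M \<inter> gr n) \<subseteq> carrier N \<inter> gr (l + n)" for n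
      using N gr_mult yn(2) by auto
  qed
qed

lemma hom_dim_zero:
  fixes \<iota> :: "'k::field \<Rightarrow> 'a"
  assumes "corner l = {\<zero>}" and "\<And>c. \<iota> c \<in> carrier A"
  shows "vectorspace.dim (class_ring :: 'k ring)
    (graded_hom_space \<iota> A M (\<lambda>n. carrier M \<inter> gr n) N (grading_shift (\<lambda>n. carrier N \<inter> gr n) l)) = 0"
proof (rule dim_zero_transfer)
  let ?V = "graded_hom_space \<iota> A M (\<lambda>n. carrier M \<inter> gr n) N (grading_shift (\<lambda>n. carrier N \<inter> gr n) l)"
  have V: "carrier ?V = homs l" "\<zero>\<^bsub>?V\<^esub> = (\<lambda>x \<in> carrier M. \<zero>)"
    by (simp_all add: graded_hom_space_def left_ideal_module_def)
  have "right_mult \<zero> = (\<lambda>x \<in> carrier M. \<zero>)" by (rule restrict_ext) (simp add: M_iff)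
  then show "carrier ?V = {\<zero>\<^bsub>?V\<^esub>}" unfolding V graded_homs_eq assms(1) by simp
  show "\<zero>\<^bsub>?V\<^esub> \<oplus>\<^bsub>?V\<^esub> \<zero>\<^bsub>?V\<^esub> = \<zero>\<^bsub>?V\<^esub>"
    by (auto simp: graded_hom_space_def left_ideal_module_def fun_eq_iff)
  show "a \<odot>\<^bsub>?V\<^esub> \<zero>\<^bsub>?V\<^esub> = \<zero>\<^bsub>?V\<^esub>" for a
    using assms(2)[of a] by (auto simp: graded_hom_space_def left_ideal_module_def fun_eq_iff)
qed

lemma hom_dim_one:
  fixes \<iota> :: "'k::field \<Rightarrow> 'a"
  assumes "corner l = range (\<lambda>c. \<iota> c \<otimes> y)" and y: "y \<in> carrier A"
    and \<iota>: "\<And>c. \<iota> c \<in> carrier A" "\<And>a b. \<iota> (a + b) = \<iota> a \<oplus> \<iota> b" "\<And>a b. \<iota> (a * b) = \<iota> a \<otimes> \<iota> b" "\<iota> 0 = \<zero>"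
    and central: "\<And>c x. x \<in> carrier A \<Longrightarrow> \<iota> c \<otimes> x = x \<otimes> \<iota> c"
    and nonzero: "\<And>c. \<iota> c \<otimes> y = \<zero> \<Longrightarrow> c = 0"
  shows "vectorspace.dim (class_ring :: 'k ring)
    (graded_hom_space \<iota> A M (\<lambda>n. carrier M \<inter> gr n) N (grading_shift (\<lambda>n. carrier N \<inter> gr n) l)) = 1"
proof (rule dim_one_transfer[where \<phi> = "\<lambda>c. right_mult (\<iota> c \<otimes> y)"])
  let ?V = "graded_hom_space \<iota> A M (\<lambda>n. carrier M \<inter> gr n) N (grading_shift (\<lambda>n. carrier N \<inter> gr n) l)"
  have V: "carrier ?V = homs l" "\<zero>\<^bsub>?V\<^esub> = (\<lambda>x \<in> carrier M. \<zero>)"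
    by (simp_all add: graded_hom_space_def left_ideal_module_def)
  have inj: "a = b" if eq: "right_mult (\<iota> a \<otimes> y) = right_mult (\<iota> b \<otimes> y)" for a b
  proof -
    have eM: "\<epsilon> \<in> carrier M" using eps by (simp add: M_iff)
    \<comment> \<open>Evaluation at \<open>\<epsilon>\<close> recovers the multiplier, because the
      multiplier lies in the corner.\<close>
    have "\<epsilon> \<otimes> (\<iota> c \<otimes> y) = \<iota> c \<otimes> y" for c
      using assms(1) by (auto simp: corner_def)
    then have eq': "\<iota> a \<otimes> y = \<iota> b \<otimes> y"
      using fun_cong[OF eq, of \<epsilon>] eM by (simp only: restrict_apply' )
    have "\<iota> a = \<iota> (a - b) \<oplus> \<iota> b" using \<iota>(2)[of "a - b" b] by simp
    then have "\<iota> a \<otimes> y = \<iota> (a - b) \<otimes> y \<oplus> \<iota> b \<otimes> y" using \<iota>(1) y by (simp add: l_distr)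
    then have "\<iota> (a - b) \<otimes> y = \<zero>"
      using add.r_cancel_one'[of "\<iota> b \<otimes> y" "\<iota> (a - b) \<otimes> y"] \<iota>(1) y unfolding eq' by simp
    then show "a = b" using nonzero[of "a - b"] by simp
  qed
  show "bij_betw (\<lambda>c. right_mult (\<iota> c \<otimes> y)) UNIV (carrier ?V)"
    unfolding bij_betw_def
  proof
    show "inj (\<lambda>c. right_mult (\<iota> c \<otimes> y))" using inj by (rule injI)
    show "range (\<lambda>c. right_mult (\<iota> c \<otimes> y)) = carrier ?V"
      unfolding V graded_homs_eq assms(1) image_image ..
  qed
  show "right_mult (\<iota> (a + b) \<otimes> y) = right_mult (\<iota> a \<otimes> y) \<oplus>\<^bsub>?V\<^esub> right_mult (\<iota> b \<otimes> y)" for a b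
    using \<iota>(1) y eps(1) by (auto simp: graded_hom_space_def left_ideal_module_def fun_eq_iff \<iota>(2) l_distr r_distr)
  show "right_mult (\<iota> (a * b) \<otimes> y) = a \<odot>\<^bsub>?V\<^esub> right_mult (\<iota> b \<otimes> y)" for a b
  proof
    fix x
    \<comment> \<open>Scalars act to the left of the value, while the multiplier stands to the right
      of \<open>x\<close>; centrality moves the scalar across.\<close>
    have "x \<otimes> (\<iota> (a * b) \<otimes> y) = \<iota> a \<otimes> (x \<otimes> (\<iota> b \<otimes> y))" if "x \<in> carrier A"
    proof -
      have "x \<otimes> (\<iota> (a * b) \<otimes> y) = (x \<otimes> \<iota> a) \<otimes> (\<iota> b \<otimes> y)"
        using that \<iota>(1) y by (simp add: \<iota>(3) m_assoc)
      also have "\<dots> = (\<iota> a \<otimes> x) \<otimes> (\<iota> b \<otimes> y)" using central[OF that] by simp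
      finally show ?thesis using that \<iota>(1) y by (simp add: m_assoc)
    qed
    then show "right_mult (\<iota> (a * b) \<otimes> y) x = (a \<odot>\<^bsub>?V\<^esub> right_mult (\<iota> b \<otimes> y)) x"
      using M_iff by (simp add: graded_hom_space_def left_ideal_module_def[of A \<eta>])
  qed
  have "right_mult (\<iota> 0 \<otimes> y) = right_mult \<zero>" using y by (simp add: \<iota>(4))
  also have "\<dots> = (\<lambda>x \<in> carrier M. \<zero>)" by (rule restrict_ext) (simp add: M_iff)
  finally show "right_mult (\<iota> 0 \<otimes> y) = \<zero>\<^bsub>?V\<^esub>" unfolding V .
qed

end

section \<open>The path algebra\<close>

definition path_cat :: "'v qpath \<Rightarrow> 'v qpath \<Rightarrow> 'v qpath" where
  "path_cat a b = (path_src a, snd a @ snd b)"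

lemma path_cat_simps [simp]:
  "path_src (path_cat a b) = path_src a"
  "snd (path_cat a b) = snd a @ snd b"
  "path_len (path_cat a b) = path_len a + path_len b"
  by (simp_all add: path_cat_def path_src_def path_len_def)

lemma path_tgt_cat [simp]: "path_tgt a = path_src b \<Longrightarrow> path_tgt (path_cat a b) = path_tgt b"
  by (auto simp: path_cat_def path_tgt_def path_src_def split: if_splits)

lemma path_cat_assoc: "path_cat (path_cat a b) c = path_cat a (path_cat b c)"
  by (simp add: path_cat_def path_src_def)

lemma path_cat_Nil_left: "f = path_src p \<Longrightarrow> path_cat (f, []) p = p"
  by (simp add: path_cat_def path_src_def)

lemma path_cat_Nil_right: "path_cat p (f, []) = p"
  by (simp add: path_cat_def path_src_def)

lemma path_src_Nil [simp]: "path_src (f, as) = f"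
  and path_tgt_Nil [simp]: "path_tgt (f, []) = f"
  by (simp_all add: path_src_def path_tgt_def)


section \<open>Linear functionals on formal sums of paths\<close>

definition lin :: "('a \<Rightarrow> 'k) \<Rightarrow> ('a \<Rightarrow>\<^sub>0 'k::field) \<Rightarrow> 'k" where
  "lin F x = (\<Sum>p \<in> Poly_Mapping.keys x. Poly_Mapping.lookup x p * F p)"

lemma lin_superset:
  "finite B \<Longrightarrow> Poly_Mapping.keys x \<subseteq> B \<Longrightarrow> lin F x = (\<Sum>p \<in> B. Poly_Mapping.lookup x p * F p)"
  unfolding lin_def by (rule sum.mono_neutral_left) (auto simp: in_keys_iff)

lemma lin_zero [simp]: "lin F 0 = 0"
  by (simp add: lin_def)

lemma lin_single [simp]: "lin F (Poly_Mapping.single p c) = c * F p"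
  by (simp add: lin_def)

lemma lin_add: "lin F (x + y) = lin F x + lin F y"
proof -
  let ?B = "Poly_Mapping.keys x \<union> Poly_Mapping.keys y"
  have "lin F z = (\<Sum>p \<in> ?B. Poly_Mapping.lookup z p * F p)" if "Poly_Mapping.keys z \<subseteq> ?B" for z
    using that by (intro lin_superset) auto
  then show ?thesis using Poly_Mapping.keys_add[of x y]
    by (simp add: lookup_add distrib_right sum.distrib)
qed

lemma lin_uminus: "lin F (- x) = - lin F x"
  using lin_add[of F x "- x"] by (simp add: eq_neg_iff_add_eq_0 add.commute)

lemma lin_diff: "lin F (x - y) = lin F x - lin F y"
  using lin_add[of F x "- y"] by (simp add: lin_uminus)

lemma poly_mapping_sum_singles:
  "(\<Sum>k \<in> Poly_Mapping.keys x. Poly_Mapping.single k (Poly_Mapping.lookup x k)) = x"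
  by (rule poly_mapping_eqI)
    (simp add: lookup_sum lookup_single when_def in_keys_iff)

text \<open>Reduces linear statements to single basis elements while keeping the support inside
  \<open>S\<close>, so that what is known of the paths in \<open>S\<close> is available for each of
  them.\<close>

lemma poly_mapping_span_induct [consumes 1, case_names zero single add]:
  fixes x :: "'a \<Rightarrow>\<^sub>0 'b::comm_monoid_add"
  assumes "Poly_Mapping.keys x \<subseteq> S" "P 0" "\<And>k c. k \<in> S \<Longrightarrow> P (Poly_Mapping.single k c)"
    "\<And>f g. P f \<Longrightarrow> P g \<Longrightarrow> P (f + g)"
  shows "P x"
proof -
  have "P (\<Sum>k \<in> K. Poly_Mapping.single k (Poly_Mapping.lookup x k))"
    if "finite K" "K \<subseteq> Poly_Mapping.keys x" for K
    using that
  proof (induction K rule: finite_induct)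
    case (insert k K)
    then have "P (Poly_Mapping.single k (Poly_Mapping.lookup x k))" using assms(1,3) by auto
    then show ?case using insert assms(4) by auto
  qed (simp add: assms(2))
  from this[of "Poly_Mapping.keys x"] show ?thesis by (simp add: poly_mapping_sum_singles)
qed

lemma poly_mapping_span_induct_UNIV [case_names zero single add]:
  fixes x :: "'a \<Rightarrow>\<^sub>0 'b::comm_monoid_add"
  assumes "P 0" "\<And>k c. P (Poly_Mapping.single k c)" "\<And>f g. P f \<Longrightarrow> P g \<Longrightarrow> P (f + g)"
  shows "P x"
  by (rule poly_mapping_span_induct[where S = UNIV]) (use assms in auto)

text \<open>The support of a sum may be smaller than the union of the supports. Summing over a
  common larger range makes additivity in each factor a termwise matter.\<close>

lemma path_mult_superset:
  assumes "finite A" "finite B" "Poly_Mapping.keys x \<subseteq> A" "Poly_Mapping.keys y \<subseteq> B"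
  shows "path_mult x y =
     (\<Sum>a \<in> A. \<Sum>b \<in> B. if path_tgt a = path_src b
        then Poly_Mapping.single (path_src a, snd a @ snd b)
               (Poly_Mapping.lookup x a * Poly_Mapping.lookup y b) else 0)"
proof -
  let ?t = "\<lambda>a b. if path_tgt a = path_src b
        then Poly_Mapping.single (path_src a, snd a @ snd b)
               (Poly_Mapping.lookup x a * Poly_Mapping.lookup y b) else 0"
  have "(\<Sum>b \<in> Poly_Mapping.keys y. ?t a b) = (\<Sum>b \<in> B. ?t a b)" for a
    using assms by (intro sum.mono_neutral_left) (auto simp: in_keys_iff)
  moreover have "(\<Sum>a \<in> Poly_Mapping.keys x. \<Sum>b \<in> B. ?t a b) = (\<Sum>a \<in> A. \<Sum>b \<in> B. ?t a b)"
    using assms by (intro sum.mono_neutral_left) (auto simp: in_keys_iff intro!: sum.neutral)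
  ultimately show ?thesis by (simp add: path_mult_def)
qed

lemma path_mult_add_left: "path_mult (x + y) z = path_mult x z + path_mult y z"
proof -
  let ?A = "Poly_Mapping.keys x \<union> Poly_Mapping.keys y"
  note sup = path_mult_superset[of ?A "Poly_Mapping.keys z" _ z]
  have s: "path_mult x z = (\<Sum>a \<in> ?A. \<Sum>b \<in> Poly_Mapping.keys z. if path_tgt a = path_src b
        then Poly_Mapping.single (path_src a, snd a @ snd b)
               (Poly_Mapping.lookup x a * Poly_Mapping.lookup z b) else 0)"
    "path_mult y z = (\<Sum>a \<in> ?A. \<Sum>b \<in> Poly_Mapping.keys z. if path_tgt a = path_src b
        then Poly_Mapping.single (path_src a, snd a @ snd b)
               (Poly_Mapping.lookup y a * Poly_Mapping.lookup z b) else 0)"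
    "path_mult (x + y) z = (\<Sum>a \<in> ?A. \<Sum>b \<in> Poly_Mapping.keys z. if path_tgt a = path_src b
        then Poly_Mapping.single (path_src a, snd a @ snd b)
               (Poly_Mapping.lookup (x + y) a * Poly_Mapping.lookup z b) else 0)"
    using Poly_Mapping.keys_add[of x y] by (auto intro!: sup)
  show ?thesis unfolding s sum.distrib[symmetric]
    by (intro sum.cong refl) (simp add: lookup_add distrib_right single_add)
qed

lemma path_mult_add_right: "path_mult z (x + y) = path_mult z x + path_mult z y"
proof -
  let ?A = "Poly_Mapping.keys x \<union> Poly_Mapping.keys y"
  note sup = path_mult_superset[of "Poly_Mapping.keys z" ?A z]
  have s: "path_mult z x = (\<Sum>a \<in> Poly_Mapping.keys z. \<Sum>b \<in> ?A. if path_tgt a = path_src b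
        then Poly_Mapping.single (path_src a, snd a @ snd b)
               (Poly_Mapping.lookup z a * Poly_Mapping.lookup x b) else 0)"
    "path_mult z y = (\<Sum>a \<in> Poly_Mapping.keys z. \<Sum>b \<in> ?A. if path_tgt a = path_src b
        then Poly_Mapping.single (path_src a, snd a @ snd b)
               (Poly_Mapping.lookup z a * Poly_Mapping.lookup y b) else 0)"
    "path_mult z (x + y) = (\<Sum>a \<in> Poly_Mapping.keys z. \<Sum>b \<in> ?A. if path_tgt a = path_src b
        then Poly_Mapping.single (path_src a, snd a @ snd b)
               (Poly_Mapping.lookup z a * Poly_Mapping.lookup (x + y) b) else 0)"
    using Poly_Mapping.keys_add[of x y] by (auto intro!: sup)
  show ?thesis unfolding s sum.distrib[symmetric]
    by (intro sum.cong refl) (simp add: lookup_add distrib_left single_add)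
qed

lemma path_mult_zero [simp]: "path_mult 0 x = 0" "path_mult x 0 = 0"
  by (simp_all add: path_mult_def)

lemma path_mult_single:
  "path_mult (Poly_Mapping.single a c) (Poly_Mapping.single b d) =
     (if path_tgt a = path_src b then Poly_Mapping.single (path_cat a b) (c * d) else 0)"
  by (simp add: path_mult_def path_cat_def)

lemma path_mult_assoc: "path_mult (path_mult x y) z = path_mult x (path_mult y z)"
proof (induction x rule: poly_mapping_span_induct_UNIV)
  case (single a c)
  show ?case
  proof (induction y rule: poly_mapping_span_induct_UNIV)
    case (single b d)
    show ?case
    proof (induction z rule: poly_mapping_span_induct_UNIV)
      case (single p r)
      then show ?case by (simp add: path_mult_single path_cat_assoc mult.assoc)
    qed (simp_all add: path_mult_add_right)
  qed (simp_all add: path_mult_add_left path_mult_add_right)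
qed (simp_all add: path_mult_add_left)

text \<open>One rule for the closure properties of products: the three sets can express being a path
  of the quiver, having a given degree or having given end points.\<close>

lemma keys_path_mult:
  assumes "Poly_Mapping.keys x \<subseteq> S" "Poly_Mapping.keys y \<subseteq> T"
    and "\<And>a b. a \<in> S \<Longrightarrow> b \<in> T \<Longrightarrow> path_tgt a = path_src b \<Longrightarrow> path_cat a b \<in> U"
  shows "Poly_Mapping.keys (path_mult x y) \<subseteq> U"
  using assms(1)
proof (induction x rule: poly_mapping_span_induct)
  case (single a c)
  note a = single
  show ?case using assms(2)
  proof (induction y rule: poly_mapping_span_induct)
    case (single b d)
    then show ?case using assms(3) a by (simp add: path_mult_single)
  next
    case (add f g)
    then show ?case using Poly_Mapping.keys_add[of "path_mult (Poly_Mapping.single a c) f" "path_mult (Poly_Mapping.single a c) g"]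
      by (auto simp: path_mult_add_right)
  qed simp
next
  case (add f g)
  then show ?case using Poly_Mapping.keys_add[of "path_mult f y" "path_mult g y"]
    by (auto simp: path_mult_add_left)
qed simp

lemma keys_uminus [simp]: "Poly_Mapping.keys (- x) = Poly_Mapping.keys (x :: 'a \<Rightarrow>\<^sub>0 'b::ab_group_add)"
  by (auto simp: in_keys_iff)

lemma lookup_map_mult:
  fixes c :: "'k::field"
  shows "Poly_Mapping.lookup (Poly_Mapping.map ((*) c) x) p = c * Poly_Mapping.lookup x p"
  by (simp add: map.rep_eq when_def)

lemma map_mult_add:
  fixes c :: "'k::field"
  shows "Poly_Mapping.map ((*) c) (x + y) = Poly_Mapping.map ((*) c) x + Poly_Mapping.map ((*) c) y"
  by (rule poly_mapping_eqI) (simp add: lookup_map_mult lookup_add distrib_left)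

lemma map_mult_zero:
  fixes c :: "'k::field"
  shows "Poly_Mapping.map ((*) c) 0 = 0"
  by (rule poly_mapping_eqI) (simp add: lookup_map_mult)

lemma path_degree_cat: "path_degree G s (path_cat a b) = path_degree G s a + path_degree G s b"
  by (simp add: path_degree_def)

lemma carrier_path_algebra: "x \<in> carrier (path_algebra G) \<longleftrightarrow> Poly_Mapping.keys x \<subseteq> qpaths G"
  and mult_path_algebra: "mult (path_algebra G) = path_mult"
  and one_path_algebra: "\<one>\<^bsub>path_algebra G\<^esub> = path_const G 1"
  and zero_path_algebra: "\<zero>\<^bsub>path_algebra G\<^esub> = 0"
  and add_path_algebra: "add (path_algebra G) = (+)"
  by (simp_all add: path_algebra_def)

lemmas path_algebra_simps =
  carrier_path_algebra mult_path_algebra one_path_algebra zero_path_algebra add_path_algebra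

context btree begin

lemma arrow_edge: "a \<in> arrows G \<Longrightarrow> arrow_tgt a \<in> bt_edges G"
  by (auto simp: arrows_def arrow_tgt_def bt_incident_def)

lemma arrow_src_edge: "a \<in> arrows G \<Longrightarrow> arrow_src G a \<in> bt_edges G"
  using next_inc by (auto simp: arrows_def arrow_src_def bt_incident_def)

lemma chain_from_edge: "chain_from G f as \<Longrightarrow> f \<in> bt_edges G"
  using arrow_src_edge by (cases as) auto

lemma chain_from_append:
  "chain_from G f (as @ bs) \<longleftrightarrow> chain_from G f as \<and> chain_from G (path_tgt (f, as)) bs"
proof (induction as arbitrary: f)
  case Nil
  show ?case using chain_from_edge by auto
qed (auto simp: path_tgt_def)

lemma chain_from_tgt: "chain_from G f as \<Longrightarrow> path_tgt (f, as) \<in> bt_edges G"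
  using chain_from_append[of f as "[]"] by simp

lemma qpaths_src: "p \<in> qpaths G \<Longrightarrow> path_src p \<in> bt_edges G"
  using chain_from_edge by (auto simp: qpaths_def)

lemma qpaths_tgt: "p \<in> qpaths G \<Longrightarrow> path_tgt p \<in> bt_edges G"
  using chain_from_tgt by (auto simp: qpaths_def)

lemma path_cat_qpaths:
  "path_tgt a = path_src b \<Longrightarrow> path_cat a b \<in> qpaths G \<longleftrightarrow> a \<in> qpaths G \<and> b \<in> qpaths G"
  by (cases a; cases b) (auto simp: qpaths_def path_cat_def chain_from_append)

lemma Nil_qpaths: "f \<in> bt_edges G \<Longrightarrow> (f, []) \<in> qpaths G"
  by (simp add: qpaths_def)

lemma path_mult_const_left:
  assumes "Poly_Mapping.keys x \<subseteq> qpaths G"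
  shows "path_mult (path_const G c) x = Poly_Mapping.map ((*) c) x"
  using assms
proof (induction x rule: poly_mapping_span_induct)
  case (single p d)
  have "path_mult (\<Sum>f \<in> F. Poly_Mapping.single (f, []) c) (Poly_Mapping.single p d)
      = (\<Sum>f \<in> F. path_mult (Poly_Mapping.single (f, []) c) (Poly_Mapping.single p d))" if "finite F" for F
    using that by (induction F rule: finite_induct) (simp_all add: path_mult_add_left)
  \<comment> \<open>Of the trivial paths summed in \<open>path_const\<close>, only the one at the
    source of \<open>p\<close> survives.\<close>
  then have "path_mult (path_const G c) (Poly_Mapping.single p d)
      = (\<Sum>f \<in> bt_edges G. if f = path_src p then Poly_Mapping.single p (c * d) else 0)"
    using finite_edges unfolding path_const_def
    by (auto simp: path_mult_single path_cat_Nil_left intro!: sum.cong)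
  also have "\<dots> = Poly_Mapping.single p (c * d)" using qpaths_src[OF single] finite_edges by simp
  finally show ?case by (simp add: map_single)
next
  case (add f g)
  then show ?case by (simp add: path_mult_add_right map_mult_add)
qed (simp add: map_mult_zero)

lemma path_mult_const_right:
  assumes "Poly_Mapping.keys x \<subseteq> qpaths G"
  shows "path_mult x (path_const G c) = Poly_Mapping.map ((*) c) x"
  using assms
proof (induction x rule: poly_mapping_span_induct)
  case (single p d)
  have "path_mult (Poly_Mapping.single p d) (\<Sum>f \<in> F. Poly_Mapping.single (f, []) c)
      = (\<Sum>f \<in> F. path_mult (Poly_Mapping.single p d) (Poly_Mapping.single (f, []) c))" if "finite F" for F
    using that by (induction F rule: finite_induct) (simp_all add: path_mult_add_right)
  then have "path_mult (Poly_Mapping.single p d) (path_const G c)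
      = (\<Sum>f \<in> bt_edges G. if f = path_tgt p then Poly_Mapping.single p (c * d) else 0)"
    using finite_edges unfolding path_const_def
    by (auto simp: path_mult_single path_cat_Nil_right mult.commute intro!: sum.cong)
  also have "\<dots> = Poly_Mapping.single p (c * d)" using qpaths_tgt[OF single] finite_edges by simp
  finally show ?case by (simp add: map_single)
next
  case (add f g)
  then show ?case by (simp add: path_mult_add_left map_mult_add)
qed (simp add: map_mult_zero)

lemma keys_path_const: "Poly_Mapping.keys (path_const G c) \<subseteq> qpaths G"
proof -
  have "Poly_Mapping.keys (\<Sum>f \<in> F. Poly_Mapping.single (f, []) c) \<subseteq> qpaths G" if "finite F" "F \<subseteq> bt_edges G" for F
    using that
  proof (induction F rule: finite_induct)
    case (insert f F)
    then show ?case
      using Poly_Mapping.keys_add[of "Poly_Mapping.single (f, []) c" "\<Sum>f \<in> F. Poly_Mapping.single (f, []) c"]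
      by (auto simp: Nil_qpaths split: if_splits)
  qed simp
  then show ?thesis using finite_edges unfolding path_const_def by blast
qed

lemma ring_path_algebra: "ring (path_algebra G :: ('v qpath \<Rightarrow>\<^sub>0 'k::field) ring)"
proof (rule ringI)
  show "abelian_group (path_algebra G :: ('v qpath \<Rightarrow>\<^sub>0 'k) ring)"
  proof (rule abelian_groupI; unfold path_algebra_simps)
    fix x y :: "'v qpath \<Rightarrow>\<^sub>0 'k" assume "Poly_Mapping.keys x \<subseteq> qpaths G" "Poly_Mapping.keys y \<subseteq> qpaths G"
    then show "Poly_Mapping.keys (x + y) \<subseteq> qpaths G" using Poly_Mapping.keys_add[of x y] by auto
  next
    fix x :: "'v qpath \<Rightarrow>\<^sub>0 'k" assume "Poly_Mapping.keys x \<subseteq> qpaths G"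
    then show "\<exists>y\<in>carrier (path_algebra G). y + x = 0"
      by (intro bexI[of _ "- x"]) (simp_all add: carrier_path_algebra)
  qed (simp_all add: add.assoc add.commute)
  show "Group.monoid (path_algebra G :: ('v qpath \<Rightarrow>\<^sub>0 'k) ring)"
  proof (rule monoidI; unfold path_algebra_simps)
    fix x y :: "'v qpath \<Rightarrow>\<^sub>0 'k" assume "Poly_Mapping.keys x \<subseteq> qpaths G" "Poly_Mapping.keys y \<subseteq> qpaths G"
    then show "Poly_Mapping.keys (path_mult x y) \<subseteq> qpaths G"
      by (rule keys_path_mult) (simp add: path_cat_qpaths)
  next
    have [simp]: "Poly_Mapping.map ((*) 1) x = x" for x :: "'v qpath \<Rightarrow>\<^sub>0 'k"
      by (rule poly_mapping_eqI) (simp add: lookup_map_mult)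
    fix x :: "'v qpath \<Rightarrow>\<^sub>0 'k" assume "Poly_Mapping.keys x \<subseteq> qpaths G"
    then show "path_mult (path_const G 1) x = x" "path_mult x (path_const G 1) = x"
      by (simp_all add: path_mult_const_left path_mult_const_right)
  qed (simp_all add: path_mult_assoc keys_path_const)
qed (simp_all add: path_algebra_simps path_mult_add_left path_mult_add_right)

end

section \<open>The Brauer relations\<close>

context btree begin

definition full_len :: "'v \<Rightarrow> nat" where
  "full_len u = (if u = exc then m else 1) * val u"

definition along :: "'v \<Rightarrow> 'v qpath \<Rightarrow> bool" where
  "along u p \<longleftrightarrow> (\<forall>a \<in> set (snd p). fst a = u)"

definition alive :: "'v qpath \<Rightarrow> bool" where
  "alive p \<longleftrightarrow> snd p = [] \<or> (\<exists>u. along u p \<and> path_len p \<le> full_len u)"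

text \<open>The condition on \<open>snd p\<close> keeps trivial paths out: \<open>u\<close> ranges
  over the whole type, and a \<open>u\<close> outside the tree has
  \<open>full_len u = 0\<close>.\<close>

definition full :: "'v qpath \<Rightarrow> bool" where
  "full p \<longleftrightarrow> snd p \<noteq> [] \<and> (\<exists>u. along u p \<and> path_len p = full_len u)"

lemma full_alive: "full p \<Longrightarrow> alive p"
  by (auto simp: full_def alive_def)

lemma along_cat: "along u (path_cat p q) \<longleftrightarrow> along u p \<and> along u q"
  by (auto simp: along_def)

lemma along_unique: "along u p \<Longrightarrow> along v p \<Longrightarrow> snd p \<noteq> [] \<Longrightarrow> u = v"
  unfolding along_def using hd_in_set by metis

lemma path_len_pos: "snd p \<noteq> [] \<Longrightarrow> 0 < path_len p"
  by (simp add: path_len_def)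

lemma arrowsD: "(u, f) \<in> arrows G \<Longrightarrow> u \<in> bt_verts G \<and> f \<in> inc u"
  by (auto simp: arrows_def)

text \<open>The source of an arrow is the cyclic successor of its target, so the way back from the
  target of a path around \<open>u\<close> to its source iterates \<open>nxt u\<close>.\<close>

lemma along_tgt_src:
  assumes "chain_from G f as" "\<forall>a \<in> set as. fst a = u"
  shows "(nxt u ^^ length as) (path_tgt (f, as)) = f"
  using assms
proof (induction as arbitrary: f)
  case (Cons a as)
  have "(nxt u ^^ length as) (path_tgt (arrow_tgt a, as)) = arrow_tgt a"
    using Cons by auto
  moreover have "path_tgt (f, a # as) = path_tgt (arrow_tgt a, as)" by (simp add: path_tgt_def)
  moreover have "nxt u (arrow_tgt a) = f" using Cons.prems by (auto simp: arrow_src_def arrow_tgt_def)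
  ultimately show ?case by simp
qed simp

lemma next_inj: "u \<in> bt_verts G \<Longrightarrow> inj_on (nxt u) (inc u)"
proof -
  assume u: "u \<in> bt_verts G"
  have "inc u \<subseteq> nxt u ` inc u"
  proof
    fix f assume f: "f \<in> inc u"
    obtain k where k: "val u = Suc k" using val_pos[OF u] by (cases "val u") auto
    have "nxt u ((nxt u ^^ k) f) = f" using next_pow_val[OF u f] by (simp add: k)
    then show "f \<in> nxt u ` inc u" using next_pow_inc[OF u f] by (metis imageI)
  qed
  then show ?thesis using finite_inc by (rule finite_surj_inj[rotated])
qed

text \<open>\<open>nxt u\<close> is injective on the edges at \<open>u\<close>, so an arrow around
  \<open>u\<close> is determined by its source.\<close>

lemma along_path_unique:
  assumes "chain_from G f as" "chain_from G f bs" "\<forall>a \<in> set as. fst a = u" "\<forall>a \<in> set bs. fst a = u"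
    "length as = length bs"
  shows "as = bs"
  using assms
proof (induction as arbitrary: f bs)
  case (Cons a as)
  then obtain b bs' where bs: "bs = b # bs'" by (cases bs) auto
  have a: "a = (u, snd a)" "b = (u, snd b)" using Cons.prems bs by (auto simp: prod_eq_iff)
  have "(u, snd a) \<in> arrows G" "(u, snd b) \<in> arrows G" using Cons.prems bs a by auto
  then have "u \<in> bt_verts G" "snd a \<in> inc u" "snd b \<in> inc u" using arrowsD by blast+
  moreover have "nxt u (snd a) = nxt u (snd b)" using Cons.prems bs by (auto simp: arrow_src_def)
  ultimately have "snd a = snd b" using next_inj by (metis inj_onD)
  then have ab: "a = b" using a by metis
  have "as = bs'"
    using Cons.prems bs ab by (intro Cons.IH[of "arrow_tgt b"]) auto
  then show ?case using ab bs by simp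
qed simp

lemma full_tgt:
  assumes "p \<in> qpaths G" "full p"
  shows "path_tgt p = path_src p"
proof -
  obtain f as where p: "p = (f, as)" by (cases p)
  obtain u where u: "along u p" "path_len p = full_len u" and ne: "as \<noteq> []"
    using assms(2) p by (auto simp: full_def)
  have c: "chain_from G f as" "\<forall>a \<in> set as. fst a = u" using assms(1) u p by (auto simp: qpaths_def along_def)
  have la: "last as \<in> arrows G"
    using chain_from_append[of f "butlast as" "[last as]"] c(1) ne by (simp add: append_butlast_last_id)
  have lu: "last as = (u, path_tgt p)" using c(2) ne p last_in_set[OF ne] by (auto simp: path_tgt_def arrow_tgt_def prod_eq_iff)
  have uv: "u \<in> bt_verts G" and t: "path_tgt p \<in> inc u" using arrowsD la lu by auto
  \<comment> \<open>The full length is a multiple of \<open>val u\<close>, and \<open>val u\<close>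
    steps of \<open>nxt u\<close> lead back to the start.\<close>
  have *: "(nxt u ^^ (k * val u)) (path_tgt p) = path_tgt p" for k
    by (induction k) (simp_all add: funpow_add next_pow_val[OF uv t])
  have "(nxt u ^^ length as) (path_tgt p) = f" using along_tgt_src[OF c] p by simp
  moreover have "length as = (if u = exc then m else 1) * val u"
    using u(2) p by (simp add: full_len_def path_len_def)
  ultimately show ?thesis using * p by (simp add: path_src_def)
qed

text \<open>
  The functionals that will turn out to be those factoring through the algebra; \<open>p\<close> and \<open>q\<close> may wind
  around different vertices.
\<close>

definition compatible :: "('v qpath \<Rightarrow> 'k::field) \<Rightarrow> bool" where
  "compatible F \<longleftrightarrow> (\<forall>p \<in> qpaths G. \<not> alive p \<longrightarrow> F p = 0) \<and>
     (\<forall>p \<in> qpaths G. \<forall>q \<in> qpaths G. full p \<longrightarrow> full q \<longrightarrow> path_src p = path_src q \<longrightarrow> F p = F q)"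

section \<open>Compatible functionals and their common kernel\<close>

lemma alive_catD:
  assumes "alive (path_cat a q)"
  shows "alive a" "alive q"
proof -
  have "snd a = [] \<and> snd q = [] \<or> (\<exists>u. along u a \<and> along u q \<and> path_len a + path_len q \<le> full_len u)"
    using assms by (auto simp: alive_def along_cat)
  then show "alive a" "alive q" unfolding alive_def by (auto intro: le_trans)
qed

text \<open>A living product winds around one vertex, which must be that of its full factor; the
  other factor then makes it too long.\<close>

lemma full_cat_not_alive:
  assumes "snd a \<noteq> []" "snd q \<noteq> []" "full a \<or> full q"
  shows "\<not> alive (path_cat a q)"
proof
  assume "alive (path_cat a q)"
  then obtain u where u: "along u a" "along u q" "path_len a + path_len q \<le> full_len u"
    using assms(1) by (auto simp: alive_def along_cat)
  from assms(3) have "path_len a = full_len u \<or> path_len q = full_len u"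
    using u(1,2) along_unique unfolding full_def by metis
  then show False using u(3) path_len_pos[OF assms(1)] path_len_pos[OF assms(2)] by auto
qed

text \<open>The new functional is \<open>F\<close> after left multiplication by \<open>a\<close>, so
  this stability makes the common kernel closed under multiplication from the left.\<close>

lemma compatible_left:
  assumes "compatible F" "a \<in> qpaths G"
  shows "compatible (\<lambda>q. if path_tgt a = path_src q then F (path_cat a q) else 0)"
  unfolding compatible_def
proof (intro conjI ballI impI)
  fix q assume "q \<in> qpaths G" "\<not> alive q"
  then have "\<not> alive (path_cat a q)" "path_tgt a = path_src q \<Longrightarrow> path_cat a q \<in> qpaths G"
    using assms(2) alive_catD(2)[of a q] path_cat_qpaths[of a q] by blast+
  then show "(if path_tgt a = path_src q then F (path_cat a q) else 0) = 0"
    using assms(1) by (simp add: compatible_def)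
next
  fix p q assume p: "p \<in> qpaths G" "full p" and q: "q \<in> qpaths G" "full q" and src: "path_src p = path_src q"
  show "(if path_tgt a = path_src p then F (path_cat a p) else 0) =
        (if path_tgt a = path_src q then F (path_cat a q) else 0)"
  proof (cases "path_tgt a = path_src p")
    case True
    show ?thesis
    proof (cases "snd a = []")
      case nil: True
      obtain f where a: "a = (f, [])" using nil by (cases a) auto
      have "path_cat a p = p" "path_cat a q = q" using True src unfolding a by (simp_all add: path_cat_Nil_left)
      moreover have "F p = F q" using assms(1) p q src unfolding compatible_def by blast
      ultimately show ?thesis using src by simp
    next
      case False
      have "\<not> alive (path_cat a p)" "\<not> alive (path_cat a q)"
        using full_cat_not_alive False p q by (auto simp: full_def)
      moreover have "path_cat a p \<in> qpaths G" "path_cat a q \<in> qpaths G"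
        using path_cat_qpaths True src p q assms(2) by metis+
      ultimately show ?thesis using assms(1) by (simp add: compatible_def)
    qed
  qed (simp add: src)
qed

text \<open>Here composability depends on the targets of \<open>p\<close> and \<open>q\<close>; full
  paths are closed, so equal sources give equal targets.\<close>

lemma compatible_right:
  assumes "compatible F" "a \<in> qpaths G"
  shows "compatible (\<lambda>q. if path_tgt q = path_src a then F (path_cat q a) else 0)"
  unfolding compatible_def
proof (intro conjI ballI impI)
  fix q assume "q \<in> qpaths G" "\<not> alive q"
  then have "\<not> alive (path_cat q a)" "path_tgt q = path_src a \<Longrightarrow> path_cat q a \<in> qpaths G"
    using assms(2) alive_catD(1)[of q a] path_cat_qpaths[of q a] by blast+
  then show "(if path_tgt q = path_src a then F (path_cat q a) else 0) = 0"
    using assms(1) by (simp add: compatible_def)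
next
  fix p q assume p: "p \<in> qpaths G" "full p" and q: "q \<in> qpaths G" "full q" and src: "path_src p = path_src q"
  have tgt: "path_tgt p = path_tgt q" using full_tgt p q src by metis
  show "(if path_tgt p = path_src a then F (path_cat p a) else 0) =
        (if path_tgt q = path_src a then F (path_cat q a) else 0)"
  proof (cases "path_tgt p = path_src a")
    case True
    show ?thesis
    proof (cases "snd a = []")
      case nil: True
      have "path_cat p a = p" "path_cat q a = q" using nil by (simp_all add: path_cat_def path_src_def)
      moreover have "F p = F q" using assms(1) p q src unfolding compatible_def by blast
      ultimately show ?thesis using tgt by simp
    next
      case False
      have "\<not> alive (path_cat p a)" "\<not> alive (path_cat q a)"
        using full_cat_not_alive False p q by (auto simp: full_def)
      moreover have "path_cat p a \<in> qpaths G" "path_cat q a \<in> qpaths G"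
        using path_cat_qpaths True tgt p q assms(2) by metis+
      ultimately show ?thesis using assms(1) by (simp add: compatible_def)
    qed
  qed (simp add: tgt)
qed

lemma lin_mult_left:
  "lin F (path_mult (Poly_Mapping.single a c) x) =
     c * lin (\<lambda>q. if path_tgt a = path_src q then F (path_cat a q) else 0) x"
  by (induction x rule: poly_mapping_span_induct_UNIV)
    (simp_all add: path_mult_add_right lin_add distrib_left path_mult_single)

lemma lin_mult_right:
  "lin F (path_mult x (Poly_Mapping.single a c)) =
     c * lin (\<lambda>q. if path_tgt q = path_src a then F (path_cat q a) else 0) x"
  by (induction x rule: poly_mapping_span_induct_UNIV)
    (simp_all add: path_mult_add_left lin_add distrib_left path_mult_single)

definition annihilated :: "('v qpath \<Rightarrow>\<^sub>0 'k::field) set" where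
  "annihilated = {x \<in> carrier (path_algebra G). \<forall>F. compatible F \<longrightarrow> lin F x = 0}"

lemma annihilated_ideal: "ideal (annihilated :: ('v qpath \<Rightarrow>\<^sub>0 'k::field) set) (path_algebra G)"
proof -
  interpret R: ring "path_algebra G :: ('v qpath \<Rightarrow>\<^sub>0 'k) ring" by (rule ring_path_algebra)
  have inv: "a_inv (path_algebra G) x = - x" if "x \<in> carrier (path_algebra G)" for x :: "'v qpath \<Rightarrow>\<^sub>0 'k"
    using that by (intro R.minus_equality) (simp_all add: path_algebra_simps)
  show ?thesis
  proof (rule idealI)
    show "ring (path_algebra G :: ('v qpath \<Rightarrow>\<^sub>0 'k) ring)" by (rule ring_path_algebra)
    show "subgroup annihilated (add_monoid (path_algebra G :: ('v qpath \<Rightarrow>\<^sub>0 'k) ring))"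
    proof (rule R.add.subgroupI)
      show "annihilated \<subseteq> carrier (path_algebra G)" by (auto simp: annihilated_def)
      have "0 \<in> annihilated" by (simp add: annihilated_def carrier_path_algebra)
      then show "annihilated \<noteq> {}" by blast
      fix x y :: "'v qpath \<Rightarrow>\<^sub>0 'k" assume x: "x \<in> annihilated"
      then show "a_inv (path_algebra G) x \<in> annihilated"
        by (simp add: annihilated_def inv carrier_path_algebra lin_uminus)
      assume y: "y \<in> annihilated"
      show "x \<oplus>\<^bsub>path_algebra G\<^esub> y \<in> annihilated"
        using x y R.a_closed[of x y] by (simp add: annihilated_def add_path_algebra lin_add)
    qed
  next
    fix a x :: "'v qpath \<Rightarrow>\<^sub>0 'k" assume a: "a \<in> annihilated" and x: "x \<in> carrier (path_algebra G)"
    have aR: "a \<in> carrier (path_algebra G)" using a by (simp add: annihilated_def)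
    have xk: "Poly_Mapping.keys x \<subseteq> qpaths G" using x by (simp add: carrier_path_algebra)
    have "lin F (path_mult x a) = 0" if F: "compatible F" for F
      using xk
    proof (induction x rule: poly_mapping_span_induct)
      case (single p c)
      then show ?case using compatible_left[OF F single] a by (simp add: annihilated_def lin_mult_left)
    qed (simp_all add: path_mult_add_left lin_add)
    then show "x \<otimes>\<^bsub>path_algebra G\<^esub> a \<in> annihilated"
      using R.m_closed[OF x aR] by (simp add: annihilated_def mult_path_algebra)
    have "lin F (path_mult a x) = 0" if F: "compatible F" for F
      using xk
    proof (induction x rule: poly_mapping_span_induct)
      case (single p c)
      then show ?case using compatible_right[OF F single] a by (simp add: annihilated_def lin_mult_right)
    qed (simp_all add: path_mult_add_right lin_add)
    then show "a \<otimes>\<^bsub>path_algebra G\<^esub> x \<in> annihilated"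
      using R.m_closed[OF aR x] by (simp add: annihilated_def mult_path_algebra)
  qed
qed

lemma annihilated_dead:
  "p \<in> qpaths G \<Longrightarrow> \<not> alive p \<Longrightarrow> path_elem p \<in> annihilated"
  by (simp add: annihilated_def carrier_path_algebra compatible_def)

lemma annihilated_full:
  assumes "p \<in> qpaths G" "q \<in> qpaths G" "full p" "full q" "path_src p = path_src q"
  shows "path_elem p - path_elem q \<in> (annihilated :: ('v qpath \<Rightarrow>\<^sub>0 'k::field) set)"
proof -
  have "Poly_Mapping.keys (path_elem p + - path_elem q :: 'v qpath \<Rightarrow>\<^sub>0 'k) \<subseteq> qpaths G"
    using Poly_Mapping.keys_add[of "path_elem p" "- path_elem q :: 'v qpath \<Rightarrow>\<^sub>0 'k"] assms(1,2)
    by (auto split: if_splits)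
  moreover have "lin F (path_elem p - path_elem q) = 0" if "compatible F" for F :: "'v qpath \<Rightarrow> 'k"
  proof -
    have "F p = F q" using that assms unfolding compatible_def by blast
    then show ?thesis by (simp add: lin_diff)
  qed
  ultimately show ?thesis by (simp add: annihilated_def carrier_path_algebra)
qed

text \<open>In a star every edge at \<open>u \<noteq> exc\<close> is \<open>{exc, u}\<close>, so
  such a \<open>u\<close> has at most one edge and contributes no arrow. All paths then wind around
  the exceptional vertex, and the length bound in the relations of a star is
  \<open>full_len exc + 1\<close>.\<close>

lemma star_arrows:
  assumes "\<forall>f \<in> bt_edges G. exc \<in> f" "a \<in> arrows G"
  shows "fst a = exc"
proof (rule ccontr)
  assume ne: "fst a \<noteq> exc"
  obtain u f where a: "a = (u, f)" by (cases a)
  have two: "card (inc u) \<ge> 2" using assms(2) ne by (simp add: arrows_def a)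
  have "g = {exc, u}" if "g \<in> inc u" for g
  proof -
    have g: "g \<in> bt_edges G" "u \<in> g" "exc \<in> g" using that assms(1) by (auto simp: bt_incident_def)
    then obtain y z where "g = {y, z}" using edge_adj by metis
    then show ?thesis using g ne a by auto
  qed
  then have "inc u \<subseteq> {{exc, u}}" by blast
  then have "card (inc u) \<le> 1" using card_mono[of "{{exc, u}}" "inc u"] by simp
  then show False using two by simp
qed

lemma star_val: "\<forall>f \<in> bt_edges G. exc \<in> f \<Longrightarrow> inc exc = bt_edges G"
  by (auto simp: bt_incident_def)

lemma chain_from_arrows: "chain_from G f as \<Longrightarrow> set as \<subseteq> arrows G"
  by (induction as arbitrary: f) auto

lemma star_along:
  assumes "\<forall>f \<in> bt_edges G. exc \<in> f" "p \<in> qpaths G"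
  shows "along exc p"
proof -
  have "chain_from G (fst p) (snd p)" using assms(2) by (auto simp: qpaths_def)
  then have "set (snd p) \<subseteq> arrows G" by (rule chain_from_arrows)
  then show ?thesis unfolding along_def using star_arrows[OF assms(1)] by blast
qed

lemma paths_along_iff: "p \<in> paths_along G u n \<longleftrightarrow> p \<in> qpaths G \<and> path_len p = n \<and> along u p"
  by (auto simp: paths_along_def along_def)

lemma full_paths_along:
  assumes "p \<in> paths_along G u (full_len u)" "u \<in> bt_verts G"
  shows "full p"
proof -
  have "full_len u > 0" using val_pos[OF assms(2)] m_pos by (simp add: full_len_def)
  then show ?thesis using assms by (auto simp: paths_along_iff full_def path_len_def)
qed

lemma dead_paths_along:
  assumes "p \<in> paths_along G u (Suc (full_len u))"
  shows "\<not> alive p"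
proof
  assume "alive p"
  moreover have ne: "snd p \<noteq> []" using assms by (auto simp: paths_along_iff path_len_def)
  ultimately obtain v where "along v p" "path_len p \<le> full_len v" by (auto simp: alive_def)
  then show False using along_unique[of u p v] assms ne by (auto simp: paths_along_iff)
qed

lemma full_len_exc: "full_len exc = bt_mult G * val exc"
  and full_len_other: "u \<noteq> exc \<Longrightarrow> full_len u = val u"
  by (simp_all add: full_len_def m_def[symmetric])

lemma mixed_dead:
  assumes "fst a \<noteq> fst b"
  shows "\<not> alive (f, [a, b])"
  using assms by (auto simp: alive_def along_def)

text \<open>Every generator is a dead path or the difference of two full paths with the same
  source.\<close>

lemma relations_annihilated: "brauer_relations G \<subseteq> (annihilated :: ('v qpath \<Rightarrow>\<^sub>0 'k::field) set)"
proof
  fix x :: "'v qpath \<Rightarrow>\<^sub>0 'k" assume x: "x \<in> brauer_relations G"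
  show "x \<in> annihilated"
  proof (cases "\<forall>f \<in> bt_edges G. exc \<in> f")
    case True
    then obtain p where p: "x = path_elem p" "p \<in> qpaths G" "path_len p = bt_mult G * card (bt_edges G) + 1"
      using x by (auto simp: brauer_relations_def)
    then have "p \<in> paths_along G exc (Suc (full_len exc))"
      using star_along[OF True] star_val[OF True] by (simp add: paths_along_iff full_len_exc)
    then show ?thesis using p annihilated_dead dead_paths_along by blast
  next
    case False
    then consider
      (mixed) a b where "x = path_elem (arrow_src G a, [a, b])" "a \<in> arrows G" "b \<in> arrows G"
        "arrow_tgt a = arrow_src G b" "fst a \<noteq> fst b"
    | (turns) p p' u u' where "x = path_elem p - path_elem p'" "u \<noteq> exc" "u' \<noteq> exc"
        "p \<in> paths_along G u (val u)" "p' \<in> paths_along G u' (val u')" "path_src p = path_src p'"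
        "u \<in> bt_verts G" "u' \<in> bt_verts G"
    | (exc_turns) p p' u where "x = path_elem p - path_elem p'" "u \<noteq> exc" "u \<in> bt_verts G"
        "p \<in> paths_along G exc (bt_mult G * val exc)" "p' \<in> paths_along G u (val u)" "path_src p = path_src p'"
    | (long) p u where "x = path_elem p" "u \<noteq> exc" "p \<in> paths_along G u (val u + 1)"
    | (exc_long) p where "x = path_elem p" "p \<in> paths_along G exc (bt_mult G * val exc + 1)"
      using x unfolding brauer_relations_def Let_def if_not_P[OF False] Un_iff mem_Collect_eq
      by (elim disjE exE conjE) (rule mixed turns exc_turns long exc_long; assumption)+
    then show ?thesis
    proof cases
      case mixed
      then show ?thesis using mixed_dead arrow_edge by (simp add: annihilated_dead qpaths_def)
    next
      case turns
      then have "full p" "full p'" using full_paths_along full_len_other by metis+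
      then show ?thesis using turns annihilated_full[of p p'] unfolding paths_along_iff by blast
    next
      case exc_turns
      then have "full p" "full p'" using full_paths_along full_len_other full_len_exc root_vert by metis+
      then show ?thesis using exc_turns annihilated_full[of p p'] unfolding paths_along_iff by blast
    next
      case long
      then have "\<not> alive p" using dead_paths_along full_len_other by (metis Suc_eq_plus1)
      then show ?thesis using long annihilated_dead[of p] unfolding paths_along_iff by blast
    next
      case exc_long
      then have "\<not> alive p" using dead_paths_along full_len_exc by (metis Suc_eq_plus1)
      then show ?thesis using exc_long annihilated_dead[of p] unfolding paths_along_iff by blast
    qed
  qed
qed

lemma relations_carrier: "brauer_relations G \<subseteq> carrier (path_algebra G :: ('v qpath \<Rightarrow>\<^sub>0 'k::field) ring)"
  using relations_annihilated by (auto simp: annihilated_def)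

lemma brauer_ideal: "ideal (brauer_ideal G :: ('v qpath \<Rightarrow>\<^sub>0 'k::field) set) (path_algebra G)"
  unfolding brauer_ideal_def by (rule ring.genideal_ideal[OF ring_path_algebra relations_carrier])

lemma brauer_ideal_annihilated: "brauer_ideal G \<subseteq> (annihilated :: ('v qpath \<Rightarrow>\<^sub>0 'k::field) set)"
  unfolding brauer_ideal_def
  by (rule ring.genideal_minimal[OF ring_path_algebra annihilated_ideal relations_annihilated])

lemma relation_in_ideal: "x \<in> brauer_relations G \<Longrightarrow> x \<in> (brauer_ideal G :: ('v qpath \<Rightarrow>\<^sub>0 'k::field) set)"
  unfolding brauer_ideal_def using ring.genideal_self[OF ring_path_algebra relations_carrier] by blast

lemma ideal_uminus:
  fixes x :: "'v qpath \<Rightarrow>\<^sub>0 'k::field"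
  assumes "x \<in> brauer_ideal G"
  shows "- x \<in> brauer_ideal G"
proof -
  interpret ideal "brauer_ideal G :: ('v qpath \<Rightarrow>\<^sub>0 'k) set" "path_algebra G" by (rule brauer_ideal)
  have "x \<in> carrier (path_algebra G)" using assms by (rule Icarr)
  then have "a_inv (path_algebra G) x = - x"
    by (intro minus_equality) (simp_all add: path_algebra_simps)
  then show ?thesis using additive_subgroup.a_inv_closed[OF is_additive_subgroup assms] by simp
qed

section \<open>The ideal contains the dead paths and the differences of full paths\<close>

lemma path_in_ideal_cat:
  assumes "path_cat a (path_cat b c) \<in> qpaths G" "path_tgt a = path_src b" "path_tgt b = path_src c"
    "path_elem b \<in> (brauer_ideal G :: ('v qpath \<Rightarrow>\<^sub>0 'k::field) set)"
  shows "path_elem (path_cat a (path_cat b c)) \<in> (brauer_ideal G :: ('v qpath \<Rightarrow>\<^sub>0 'k) set)"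
proof -
  interpret ideal "brauer_ideal G :: ('v qpath \<Rightarrow>\<^sub>0 'k) set" "path_algebra G" by (rule brauer_ideal)
  have q: "a \<in> qpaths G" "c \<in> qpaths G" using assms by (auto simp: path_cat_qpaths)
  have car: "path_elem p \<in> carrier (path_algebra G :: ('v qpath \<Rightarrow>\<^sub>0 'k) ring)" if "p \<in> qpaths G" for p
    using that by (simp add: carrier_path_algebra)
  have "path_mult (path_elem b) (path_elem c) \<in> (brauer_ideal G :: ('v qpath \<Rightarrow>\<^sub>0 'k) set)"
    using I_r_closed[OF assms(4) car[OF q(2)]] by (simp add: mult_path_algebra)
  then have "path_mult (path_elem a) (path_mult (path_elem b) (path_elem c)) \<in> (brauer_ideal G :: ('v qpath \<Rightarrow>\<^sub>0 'k) set)"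
    using I_l_closed[OF _ car[OF q(1)]] by (simp add: mult_path_algebra)
  then show ?thesis using assms by (simp add: path_mult_single)
qed

lemma list_constant_or_change:
  "(\<exists>u. \<forall>a \<in> set as. fst a = u) \<or> (\<exists>l a b r. as = l @ [a, b] @ r \<and> fst a \<noteq> fst b)"
proof (induction as)
  case (Cons a as)
  show ?case
  proof (cases as)
    case (Cons b bs)
    show ?thesis
    proof (cases "fst a = fst b")
      case True
      from \<open>(\<exists>u. \<forall>a \<in> set as. fst a = u) \<or> (\<exists>l a b r. as = l @ [a, b] @ r \<and> fst a \<noteq> fst b)\<close>
      show ?thesis
      proof
        assume "\<exists>u. \<forall>a \<in> set as. fst a = u"
        then show ?thesis using True Cons by auto
      next
        assume "\<exists>l a b r. as = l @ [a, b] @ r \<and> fst a \<noteq> fst b"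
        then obtain l c d r where "as = l @ [c, d] @ r" "fst c \<noteq> fst d" by blast
        then have "a # as = (a # l) @ [c, d] @ r \<and> fst c \<noteq> fst d" by simp
        then show ?thesis by blast
      qed
    next
      case False
      then have "a # as = [] @ [a, b] @ bs \<and> fst a \<noteq> fst b" using Cons by simp
      then show ?thesis by blast
    qed
  qed auto
qed simp

text \<open>A dead path has a generator as a factor: two consecutive arrows around different
  vertices or, if it winds around a single vertex, an initial piece one longer than the full
  length.\<close>

lemma dead_in_ideal:
  assumes p: "p \<in> qpaths G" and dead: "\<not> alive p"
  shows "path_elem p \<in> (brauer_ideal G :: ('v qpath \<Rightarrow>\<^sub>0 'k::field) set)"
proof -
  obtain f as where fas: "p = (f, as)" by (cases p)
  have c: "chain_from G f as" using p fas by (simp add: qpaths_def)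
  have ne: "as \<noteq> []" using dead fas by (auto simp: alive_def)
  have long: ?thesis if u: "along u p" for u
  proof -
    define n where "n = Suc (full_len u)"
    have len: "length as \<ge> n"
      using dead u ne fas by (auto simp: alive_def path_len_def n_def not_le)
    let ?b = "(f, take n as)" and ?c = "(path_tgt (f, take n as), drop n as)"
    have pe: "path_cat (f, []) (path_cat ?b ?c) = p" by (simp add: path_cat_def path_src_def fas)
    have "chain_from G f (take n as)" using c chain_from_append[of f "take n as" "drop n as"] by simp
    then have b: "?b \<in> paths_along G u n"
      using u len fas by (auto simp: paths_along_iff qpaths_def path_len_def along_def dest: in_set_takeD)
    have "hd as \<in> arrows G" using chain_from_arrows[OF c] ne hd_in_set by blast
    moreover have "fst (hd as) = u" using u ne fas by (auto simp: along_def)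
    ultimately have uV: "u \<in> bt_verts G" by (auto simp: arrows_def)
    have "path_elem ?b \<in> (brauer_relations G :: ('v qpath \<Rightarrow>\<^sub>0 'k) set)"
    proof (cases "\<forall>f \<in> bt_edges G. exc \<in> f")
      case True
      have "u = exc" using star_along[OF True p] along_unique[OF u] ne fas by auto
      then have "path_len ?b = bt_mult G * card (bt_edges G) + 1"
        using b star_val[OF True] by (simp add: paths_along_iff n_def full_len_exc)
      then show ?thesis using True b by (auto simp: brauer_relations_def paths_along_iff)
    next
      case False
      show ?thesis
      proof (cases "u = exc")
        case True
        then have "?b \<in> paths_along G exc (bt_mult G * val exc + 1)" using b by (simp add: n_def full_len_exc)
        then show ?thesis unfolding brauer_relations_def Let_def if_not_P[OF False] by blast
      next
        case ne: False
        then have "?b \<in> paths_along G u (val u + 1)" using b by (simp add: n_def full_len_other)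
        then show ?thesis using ne uV unfolding brauer_relations_def Let_def if_not_P[OF False] by blast
      qed
    qed
    then have "path_elem ?b \<in> (brauer_ideal G :: ('v qpath \<Rightarrow>\<^sub>0 'k) set)" by (rule relation_in_ideal)
    then show ?thesis using path_in_ideal_cat[of "(f, [])" ?b ?c] p unfolding pe by simp
  qed
  from list_constant_or_change[of as] show ?thesis
  proof
    assume "\<exists>u. \<forall>a \<in> set as. fst a = u"
    then obtain u where "along u p" using fas by (auto simp: along_def)
    then show ?thesis by (rule long)
  next
    assume "\<exists>l a b r. as = l @ [a, b] @ r \<and> fst a \<noteq> fst b"
    then obtain l a b r where as: "as = l @ [a, b] @ r" and ab: "fst a \<noteq> fst b" by blast
    have ch: "chain_from G (path_tgt (f, l)) ([a, b] @ r)"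
      using c unfolding as chain_from_append[of f l] by simp
    then have arr: "a \<in> arrows G" "b \<in> arrows G" "arrow_src G a = path_tgt (f, l)" "arrow_tgt a = arrow_src G b"
      by auto
    let ?b = "(arrow_src G a, [a, b])" and ?c = "(arrow_tgt b, r)"
    have pe: "path_cat (f, l) (path_cat ?b ?c) = p" by (simp add: path_cat_def path_src_def fas as)
    \<comment> \<open>All arrows of a star belong to the exceptional vertex, so the relations are
      those of the other case.\<close>
    have star: "\<not> (\<forall>f \<in> bt_edges G. exc \<in> f)" using star_arrows arr ab by metis
    have "path_elem ?b \<in> (brauer_relations G :: ('v qpath \<Rightarrow>\<^sub>0 'k) set)"
      using arr ab unfolding brauer_relations_def Let_def if_not_P[OF star] by blast
    then have "path_elem ?b \<in> (brauer_ideal G :: ('v qpath \<Rightarrow>\<^sub>0 'k) set)" by (rule relation_in_ideal)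
    moreover have "path_tgt ?b = path_src ?c" by (simp add: path_tgt_def)
    ultimately show ?thesis using path_in_ideal_cat[of "(f, l)" ?b ?c] p arr(3) unfolding pe by simp
  qed
qed

text \<open>Around the same vertex the two paths coincide. Around different vertices the tree is not
  a star and at most one of the vertices is exceptional, so the difference is a generator up to
  sign.\<close>

lemma full_diff_in_ideal:
  assumes p: "p \<in> qpaths G" "full p" and q: "q \<in> qpaths G" "full q" and src: "path_src p = path_src q"
  shows "path_elem p - path_elem q \<in> (brauer_ideal G :: ('v qpath \<Rightarrow>\<^sub>0 'k::field) set)"
proof -
  interpret ideal "brauer_ideal G :: ('v qpath \<Rightarrow>\<^sub>0 'k) set" "path_algebra G" by (rule brauer_ideal)
  obtain u where u: "along u p" "path_len p = full_len u" using p by (auto simp: full_def)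
  obtain v where v: "along v q" "path_len q = full_len v" using q by (auto simp: full_def)
  have verts: "w \<in> bt_verts G" if "along w r" "r \<in> qpaths G" "full r" for w r
  proof -
    have "chain_from G (fst r) (snd r)" "snd r \<noteq> []" using that by (auto simp: full_def qpaths_def)
    then have "hd (snd r) \<in> arrows G" "hd (snd r) \<in> set (snd r)"
      using chain_from_arrows hd_in_set by blast+
    moreover from this(2) that(1) have "fst (hd (snd r)) = w" by (simp add: along_def)
    ultimately have "hd (snd r) \<in> arrows G" "fst (hd (snd r)) = w" by blast+
    then show ?thesis by (auto simp: arrows_def)
  qed
  have uv: "u \<in> bt_verts G" "v \<in> bt_verts G" using verts p q u v by auto
  show ?thesis
  proof (cases "u = v")
    case True
    have "snd p = snd q"
      using along_path_unique[of "path_src p" "snd p" "snd q" u] p q u v True src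
      by (auto simp: qpaths_def along_def path_len_def path_src_def)
    then have "p = q" using src by (simp add: path_src_def prod_eq_iff)
    then show ?thesis
      using additive_subgroup.zero_closed[OF is_additive_subgroup] by (simp add: zero_path_algebra)
  next
    case ne: False
    have star: "\<not> (\<forall>f \<in> bt_edges G. exc \<in> f)"
      using star_along p q u v ne along_unique by (metis full_def)
    have main: "path_elem p' - path_elem q' \<in> (brauer_ideal G :: ('v qpath \<Rightarrow>\<^sub>0 'k) set)"
      if "p' \<in> paths_along G u' (full_len u')" "q' \<in> paths_along G v' (full_len v')"
        "path_src p' = path_src q'" "v' \<noteq> exc" "u' \<in> bt_verts G" "v' \<in> bt_verts G" for p' q' u' v'
    proof (rule relation_in_ideal, cases "u' = exc")
      case True
      then have "p' \<in> paths_along G exc (bt_mult G * val exc)" "q' \<in> paths_along G v' (val v')"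
        using that by (simp_all add: full_len_exc full_len_other)
      then show "path_elem p' - path_elem q' \<in> (brauer_relations G :: ('v qpath \<Rightarrow>\<^sub>0 'k) set)"
        using that(3,4,6) unfolding brauer_relations_def Let_def if_not_P[OF star] by blast
    next
      case False
      then have "p' \<in> paths_along G u' (val u')" "q' \<in> paths_along G v' (val v')"
        using that by (simp_all add: full_len_other)
      then show "path_elem p' - path_elem q' \<in> (brauer_relations G :: ('v qpath \<Rightarrow>\<^sub>0 'k) set)"
        using False that(3-6) unfolding brauer_relations_def Let_def if_not_P[OF star] by blast
    qed
    have pa: "p \<in> paths_along G u (full_len u)" "q \<in> paths_along G v (full_len v)"
      using p q u v by (auto simp: paths_along_iff)
    show ?thesis
    proof (cases "v = exc")
      case False
      then show ?thesis using main[OF pa src] uv by blast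
    next
      case True
      then have "u \<noteq> exc" using ne by simp
      \<comment> \<open>The generators subtract the non-exceptional turn from the exceptional ones,
        so with \<open>v = exc\<close> the negative is obtained.\<close>
      then have "path_elem q - path_elem p \<in> (brauer_ideal G :: ('v qpath \<Rightarrow>\<^sub>0 'k) set)"
        using main[OF pa(2) pa(1)] src uv by simp
      from ideal_uminus[OF this] show ?thesis by simp
    qed
  qed
qed

end

section \<open>Homomorphisms between the projective modules\<close>

context green begin

lemma brauer_class_hom:
  "ring_hom_ring (path_algebra G) (brauer_algebra G) (brauer_class G :: ('v qpath \<Rightarrow>\<^sub>0 'k::field) \<Rightarrow> _)"
proof -
  interpret ideal "brauer_ideal G :: ('v qpath \<Rightarrow>\<^sub>0 'k) set" "path_algebra G" by (rule brauer_ideal)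
  have "brauer_class G = (\<lambda>x :: 'v qpath \<Rightarrow>\<^sub>0 'k. brauer_ideal G +>\<^bsub>path_algebra G\<^esub> x)"
    by (rule ext) (simp add: brauer_class_def)
  then show ?thesis using rcos_ring_hom_ring unfolding brauer_algebra_def by simp
qed

lemma ring_brauer_algebra: "ring (brauer_algebra G :: ('v qpath \<Rightarrow>\<^sub>0 'k::field) set ring)"
  using brauer_class_hom by (rule ring_hom_ring.axioms(2))

lemma class_closed:
  "Poly_Mapping.keys x \<subseteq> qpaths G \<Longrightarrow> brauer_class G (x :: 'v qpath \<Rightarrow>\<^sub>0 'k::field) \<in> carrier (brauer_algebra G)"
  using ring_hom_closed[OF ring_hom_ring.homh[OF brauer_class_hom]] by (auto simp: carrier_path_algebra)

lemma class_add:
  "Poly_Mapping.keys x \<subseteq> qpaths G \<Longrightarrow> Poly_Mapping.keys y \<subseteq> qpaths G \<Longrightarrow>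
    brauer_class G (x :: 'v qpath \<Rightarrow>\<^sub>0 'k::field) \<oplus>\<^bsub>brauer_algebra G\<^esub> brauer_class G y = brauer_class G (x + y)"
  using ring_hom_add[OF ring_hom_ring.homh[OF brauer_class_hom], of x y] by (simp add: path_algebra_simps)

lemma class_mult:
  "Poly_Mapping.keys x \<subseteq> qpaths G \<Longrightarrow> Poly_Mapping.keys y \<subseteq> qpaths G \<Longrightarrow>
    brauer_class G (x :: 'v qpath \<Rightarrow>\<^sub>0 'k::field) \<otimes>\<^bsub>brauer_algebra G\<^esub> brauer_class G y = brauer_class G (path_mult x y)"
  using ring_hom_mult[OF ring_hom_ring.homh[OF brauer_class_hom], of x y] by (simp add: path_algebra_simps)

lemma class_zero: "brauer_class G (0 :: 'v qpath \<Rightarrow>\<^sub>0 'k::field) = \<zero>\<^bsub>brauer_algebra G\<^esub>"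
  using ring_hom_zero[OF ring_hom_ring.homh[OF brauer_class_hom] ring_path_algebra ring_brauer_algebra]
  by (simp add: zero_path_algebra)

lemma class_surj:
  assumes "y \<in> carrier (brauer_algebra G :: ('v qpath \<Rightarrow>\<^sub>0 'k::field) set ring)"
  obtains x where "Poly_Mapping.keys x \<subseteq> qpaths G" "y = brauer_class G x"
  using assms by (auto simp: brauer_algebra_def FactRing_def A_RCOSETS_def' brauer_class_def carrier_path_algebra)

lemma class_eq_iff:
  fixes x y :: "'v qpath \<Rightarrow>\<^sub>0 'k::field"
  assumes "Poly_Mapping.keys x \<subseteq> qpaths G" "Poly_Mapping.keys y \<subseteq> qpaths G"
  shows "brauer_class G x = brauer_class G y \<longleftrightarrow> x - y \<in> brauer_ideal G"
proof -
  interpret R: ring "path_algebra G :: ('v qpath \<Rightarrow>\<^sub>0 'k) ring" by (rule ring_path_algebra)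
  have car: "x \<in> carrier (path_algebra G)" "y \<in> carrier (path_algebra G)"
    using assms by (simp_all add: carrier_path_algebra)
  have "a_inv (path_algebra G) y = - y"
    using car by (intro R.minus_equality) (simp_all add: path_algebra_simps)
  then have "x \<ominus>\<^bsub>path_algebra G\<^esub> y = x - y" by (simp add: a_minus_def add_path_algebra)
  then show ?thesis using R.quotient_eq_iff_same_a_r_cos[OF brauer_ideal car] by (simp add: brauer_class_def)
qed

lemma class_eq_zero_iff:
  fixes x :: "'v qpath \<Rightarrow>\<^sub>0 'k::field"
  assumes "Poly_Mapping.keys x \<subseteq> qpaths G"
  shows "brauer_class G x = \<zero>\<^bsub>brauer_algebra G\<^esub> \<longleftrightarrow> x \<in> brauer_ideal G"
  using class_eq_iff[OF assms, of 0] by (simp add: class_zero)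

lemma scalar_closed: "brauer_scalar G (c :: 'k::field) \<in> carrier (brauer_algebra G)"
  unfolding brauer_scalar_def using keys_path_const by (rule class_closed)

lemma scalar_mult:
  assumes "Poly_Mapping.keys x \<subseteq> qpaths G"
  shows "brauer_scalar G c \<otimes>\<^bsub>brauer_algebra G\<^esub> brauer_class G x = brauer_class G (Poly_Mapping.map ((*) (c :: 'k::field)) x)"
    and "brauer_class G x \<otimes>\<^bsub>brauer_algebra G\<^esub> brauer_scalar G c = brauer_class G (Poly_Mapping.map ((*) (c :: 'k::field)) x)"
  unfolding brauer_scalar_def
  by (simp_all add: class_mult assms keys_path_const path_mult_const_left path_mult_const_right)

lemma scalar_central:
  "x \<in> carrier (brauer_algebra G) \<Longrightarrow>
    brauer_scalar G (c :: 'k::field) \<otimes>\<^bsub>brauer_algebra G\<^esub> x = x \<otimes>\<^bsub>brauer_algebra G\<^esub> brauer_scalar G c"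
  by (erule class_surj) (simp add: scalar_mult)

lemma path_const_add: "path_const G (a + b :: 'k::field) = path_const G a + path_const G b"
  by (simp add: path_const_def single_add sum.distrib)

lemma path_const_mult: "path_const G (a * b :: 'k::field) = path_mult (path_const G a) (path_const G b)"
proof -
  have "Poly_Mapping.map ((*) a) (\<Sum>f \<in> F. Poly_Mapping.single (f, []) b) =
      (\<Sum>f \<in> F. Poly_Mapping.single (f, [] :: 'v qarrow list) (a * b))"
    if "finite F" for F :: "'v set set"
    using that by (induction F rule: finite_induct) (simp_all add: map_mult_zero map_mult_add map_single)
  then show ?thesis
    using finite_edges unfolding path_mult_const_left[OF keys_path_const] by (simp add: path_const_def)
qed

lemma scalar_add: "brauer_scalar G (a + b :: 'k::field) = brauer_scalar G a \<oplus>\<^bsub>brauer_algebra G\<^esub> brauer_scalar G b"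
  unfolding brauer_scalar_def by (simp add: class_add keys_path_const path_const_add)

lemma scalar_times: "brauer_scalar G (a * b :: 'k::field) = brauer_scalar G a \<otimes>\<^bsub>brauer_algebra G\<^esub> brauer_scalar G b"
  unfolding brauer_scalar_def by (simp add: class_mult keys_path_const path_const_mult)

lemma scalar_zero: "brauer_scalar G (0 :: 'k::field) = \<zero>\<^bsub>brauer_algebra G\<^esub>"
  unfolding brauer_scalar_def class_zero[symmetric] by (simp add: path_const_def)

abbreviation "deg \<equiv> path_degree G s"
abbreviation "idem f \<equiv> brauer_class G (path_elem (f, []))"

lemma grading_iff:
  "y \<in> brauer_grading G s n \<longleftrightarrow>
    (\<exists>x :: 'v qpath \<Rightarrow>\<^sub>0 'k::field. y = brauer_class G x \<and> Poly_Mapping.keys x \<subseteq> {p \<in> qpaths G. deg p = n})"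
  by (auto simp: brauer_grading_def carrier_path_algebra)

lemma corner_locale:
  assumes f: "f \<in> bt_edges G" and g: "g \<in> bt_edges G"
  shows "graded_corner (brauer_algebra G :: ('v qpath \<Rightarrow>\<^sub>0 'k::field) set ring) (brauer_grading G s) (idem f) (idem g)"
proof -
  have k: "Poly_Mapping.keys (path_elem (h, []) :: 'v qpath \<Rightarrow>\<^sub>0 'k) \<subseteq> qpaths G" if "h \<in> bt_edges G" for h
    using Nil_qpaths[OF that] by simp
  have idem: "idem h \<otimes>\<^bsub>brauer_algebra G\<^esub> idem h = (idem h :: ('v qpath \<Rightarrow>\<^sub>0 'k) set)" if "h \<in> bt_edges G" for h
    by (simp add: class_mult[OF k[OF that] k[OF that]] path_mult_single path_cat_def path_src_def)
  show ?thesis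
  proof (intro graded_corner.intro graded_corner_axioms.intro ring_brauer_algebra)
    show "idem f \<in> brauer_grading G s 0"
      using k[OF f] unfolding grading_iff
      by (intro exI[of _ "path_elem (f, [])"]) (auto simp: path_degree_def)
    show "brauer_grading G s n \<subseteq> carrier (brauer_algebra G :: ('v qpath \<Rightarrow>\<^sub>0 'k) set ring)" for n
      by (auto simp: grading_iff intro!: class_closed)
    fix x y :: "('v qpath \<Rightarrow>\<^sub>0 'k) set" and n l
    assume "x \<in> brauer_grading G s n" "y \<in> brauer_grading G s l"
    then obtain x' y' where x: "x = brauer_class G x'" "Poly_Mapping.keys x' \<subseteq> {p \<in> qpaths G. deg p = n}"
      and y: "y = brauer_class G y'" "Poly_Mapping.keys y' \<subseteq> {p \<in> qpaths G. deg p = l}"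
      unfolding grading_iff by blast
    have "Poly_Mapping.keys (path_mult x' y') \<subseteq> {p \<in> qpaths G. deg p = l + n}"
      using x(2) y(2) by (rule keys_path_mult) (auto simp: path_cat_qpaths path_degree_cat)
    moreover have "x \<otimes>\<^bsub>brauer_algebra G\<^esub> y = brauer_class G (path_mult x' y')"
      unfolding x(1) y(1) using x(2) y(2) by (intro class_mult) auto
    ultimately show "x \<otimes>\<^bsub>brauer_algebra G\<^esub> y \<in> brauer_grading G s (l + n)"
      unfolding grading_iff by blast
  qed (auto intro!: idem class_closed k f g simp del: Poly_Mapping.keys_single)
qed

section \<open>Dimensions of the graded corners\<close>

definition "spanning f g l = {p \<in> qpaths G. path_src p = f \<and> path_tgt p = g \<and> deg p = l}"

text \<open>Multiplying a homogeneous representative by the two trivial paths removes every path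
  with other end points and does not change the class of an element of the corner.\<close>

lemma corner_eq:
  assumes f: "f \<in> bt_edges G" and g: "g \<in> bt_edges G"
  shows "graded_corner.corner (brauer_algebra G) (brauer_grading G s) (idem f) (idem g) l =
    brauer_class G ` {x :: 'v qpath \<Rightarrow>\<^sub>0 'k::field. Poly_Mapping.keys x \<subseteq> spanning f g l}"
proof -
  interpret graded_corner "brauer_algebra G :: ('v qpath \<Rightarrow>\<^sub>0 'k) set ring" "brauer_grading G s" "idem f" "idem g"
    by (rule corner_locale[OF f g])
  have k: "Poly_Mapping.keys (path_elem (h, []) :: 'v qpath \<Rightarrow>\<^sub>0 'k) \<subseteq> qpaths G" if "h \<in> bt_edges G" for h
    using Nil_qpaths[OF that] by simp
  show ?thesis
  proof (intro equalityI subsetI)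
    fix y assume "y \<in> corner l"
    then have y: "y \<in> brauer_grading G s l" "idem f \<otimes>\<^bsub>brauer_algebra G\<^esub> y = y" "y \<otimes>\<^bsub>brauer_algebra G\<^esub> idem g = y"
      by (auto simp: corner_def)
    from y(1) obtain x where x: "y = brauer_class G x" "Poly_Mapping.keys x \<subseteq> {p \<in> qpaths G. deg p = l}"
      unfolding grading_iff by blast
    have xq: "Poly_Mapping.keys x \<subseteq> qpaths G" using x(2) by blast
    let ?x = "path_mult (path_mult (path_elem (f, [])) x) (path_elem (g, []))"
    have 1: "Poly_Mapping.keys (path_mult (path_elem (f, [])) x) \<subseteq> {p \<in> qpaths G. deg p = l \<and> path_src p = f}"
      by (rule keys_path_mult[OF _ x(2), where S = "{(f, [])}"]) (auto simp: path_cat_Nil_left)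
    have 2: "Poly_Mapping.keys ?x \<subseteq> spanning f g l"
      by (rule keys_path_mult[OF 1, where T = "{(g, [])}"]) (auto simp: path_cat_Nil_right spanning_def)
    have "y = idem f \<otimes>\<^bsub>brauer_algebra G\<^esub> y \<otimes>\<^bsub>brauer_algebra G\<^esub> idem g" using y(2,3) by simp
    also have "\<dots> = brauer_class G (path_mult (path_elem (f, [])) x) \<otimes>\<^bsub>brauer_algebra G\<^esub> idem g"
      unfolding x(1) by (simp only: class_mult[OF k[OF f] xq])
    also have "\<dots> = brauer_class G ?x" using 1 by (intro class_mult k[OF g]) blast
    finally show "y \<in> brauer_class G ` {x. Poly_Mapping.keys x \<subseteq> spanning f g l}" using 2 by blast
  next
    fix y :: "('v qpath \<Rightarrow>\<^sub>0 'k) set"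
    assume "y \<in> brauer_class G ` {x. Poly_Mapping.keys x \<subseteq> spanning f g l}"
    then obtain x where x: "y = brauer_class G x" "Poly_Mapping.keys x \<subseteq> spanning f g l" by blast
    have xq: "Poly_Mapping.keys x \<subseteq> qpaths G" using x(2) by (auto simp: spanning_def)
    have "path_mult (path_elem (f, [])) x = x" "path_mult x (path_elem (g, [])) = x"
      using x(2) by (induction x rule: poly_mapping_span_induct)
        (auto simp: path_mult_single path_cat_Nil_left path_cat_Nil_right spanning_def
          path_mult_add_left path_mult_add_right)
    then have "idem f \<otimes>\<^bsub>brauer_algebra G\<^esub> y = y" "y \<otimes>\<^bsub>brauer_algebra G\<^esub> idem g = y"
      unfolding x(1) class_mult[OF k[OF f] xq] class_mult[OF xq k[OF g]] by simp_all
    moreover have "y \<in> brauer_grading G s l"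
      unfolding grading_iff using x by (auto simp: spanning_def)
    ultimately show "y \<in> corner l" by (simp add: corner_def)
  qed
qed

lemma class_single:
  "p \<in> qpaths G \<Longrightarrow>
    brauer_class G (Poly_Mapping.single p c) = brauer_scalar G (c :: 'k::field) \<otimes>\<^bsub>brauer_algebra G\<^esub> brauer_class G (path_elem p)"
  by (simp add: scalar_mult map_single)

lemma hom_dim_unfold:
  "brauer_hom_dim TYPE('k::field) G s f g l =
     vectorspace.dim (class_ring :: 'k ring)
       (graded_hom_space (brauer_scalar G) (brauer_algebra G)
          (left_ideal_module (brauer_algebra G) (idem f))
          (\<lambda>n. carrier (left_ideal_module (brauer_algebra G) (idem f)) \<inter> brauer_grading G s n)
          (left_ideal_module (brauer_algebra G) (idem g))
          (grading_shift (\<lambda>n. carrier (left_ideal_module (brauer_algebra G) (idem g)) \<inter> brauer_grading G s n) l))"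
proof -
  have P: "brauer_proj G h = left_ideal_module (brauer_algebra G :: ('v qpath \<Rightarrow>\<^sub>0 'k) set ring) (idem h)" for h
    by (simp add: brauer_proj_def left_ideal_module_def Let_def)
  have gr: "brauer_proj_grading G s h =
      (\<lambda>n. carrier (left_ideal_module (brauer_algebra G :: ('v qpath \<Rightarrow>\<^sub>0 'k) set ring) (idem h)) \<inter> brauer_grading G s n)" for h
    by (rule ext) (simp add: brauer_proj_grading_def P)
  show ?thesis unfolding brauer_hom_dim_def P gr ..
qed

lemma hom_dim_0:
  assumes f: "f \<in> bt_edges G" and g: "g \<in> bt_edges G"
    and dead: "\<And>p. p \<in> spanning f g l \<Longrightarrow> \<not> alive p"
  shows "brauer_hom_dim TYPE('k::field) G s f g l = 0"
proof -
  interpret graded_corner "brauer_algebra G :: ('v qpath \<Rightarrow>\<^sub>0 'k) set ring" "brauer_grading G s" "idem f" "idem g"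
    by (rule corner_locale[OF f g])
  have "brauer_class G x = \<zero>\<^bsub>brauer_algebra G\<^esub> \<and> Poly_Mapping.keys x \<subseteq> qpaths G"
    if "Poly_Mapping.keys x \<subseteq> spanning f g l" for x :: "'v qpath \<Rightarrow>\<^sub>0 'k"
    using that
  proof (induction x rule: poly_mapping_span_induct)
    case (single p c)
    have p: "p \<in> qpaths G" using single by (simp add: spanning_def)
    have "brauer_class G (path_elem p :: 'v qpath \<Rightarrow>\<^sub>0 'k) = \<zero>\<^bsub>brauer_algebra G\<^esub>"
      using dead_in_ideal[OF p dead[OF single]] p by (subst class_eq_zero_iff) auto
    then have "brauer_class G (Poly_Mapping.single p c) = \<zero>\<^bsub>brauer_algebra G\<^esub>"
      unfolding class_single[OF p, of c] using scalar_closed[of c] by simp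
    then show ?case using p by simp
  next
    case (add x y)
    then have "Poly_Mapping.keys (x + y) \<subseteq> qpaths G" using Poly_Mapping.keys_add[of x y] by blast
    then show ?case using class_add[of x y] add by simp
  qed (simp add: class_zero)
  moreover have "Poly_Mapping.keys (0 :: 'v qpath \<Rightarrow>\<^sub>0 'k) \<subseteq> spanning f g l" by simp
  ultimately have "corner l = {\<zero>\<^bsub>brauer_algebra G\<^esub>}"
    unfolding corner_eq[OF f g] by (auto simp: image_iff intro!: exI[of _ 0] simp: class_zero)
  then show ?thesis unfolding hom_dim_unfold using scalar_closed by (rule hom_dim_zero)
qed

lemma alive_not_in_ideal:
  fixes c :: "'k::field"
  assumes p: "p \<in> qpaths G" "alive p" and c: "Poly_Mapping.single p c \<in> brauer_ideal G"
  shows "c = 0"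
proof -
  \<comment> \<open>The indicator of the paths that have to agree with \<open>p\<close>:
    \<open>p\<close> alone or, if \<open>p\<close> is full, all full paths with its source.\<close>
  define F :: "'v qpath \<Rightarrow> 'k" where
    "F q = (if q = p \<or> full p \<and> full q \<and> path_src q = path_src p then 1 else 0)" for q
  have "compatible F" using p full_alive unfolding compatible_def F_def by auto
  moreover have "Poly_Mapping.single p c \<in> annihilated" using c brauer_ideal_annihilated by blast
  ultimately have "lin F (Poly_Mapping.single p c) = 0" by (simp add: annihilated_def)
  then show ?thesis by (simp add: F_def)
qed

text \<open>Every path from \<open>f\<close> to \<open>g\<close> of degree \<open>l\<close> is
  either zero in the algebra or equal to \<open>p\<close>, since full paths with the same source are
  identified there. The graded corner is thus the line through the class of \<open>p\<close>, which
  is nonzero as \<open>p\<close> is alive.\<close>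

lemma hom_dim_1:
  assumes p: "p \<in> spanning f g l" "alive p"
    and unique: "\<And>q. q \<in> spanning f g l \<Longrightarrow> alive q \<Longrightarrow> q = p \<or> full p \<and> full q"
  shows "brauer_hom_dim TYPE('k::field) G s f g l = 1"
proof -
  have pq: "p \<in> qpaths G" "path_src p = f" "path_tgt p = g" using p by (auto simp: spanning_def)
  have f: "f \<in> bt_edges G" and g: "g \<in> bt_edges G" using pq qpaths_src qpaths_tgt by blast+
  interpret graded_corner "brauer_algebra G :: ('v qpath \<Rightarrow>\<^sub>0 'k) set ring" "brauer_grading G s" "idem f" "idem g"
    by (rule corner_locale[OF f g])
  let ?y = "brauer_class G (path_elem p :: 'v qpath \<Rightarrow>\<^sub>0 'k)"
  have y: "?y \<in> carrier (brauer_algebra G)" using pq by (intro class_closed) auto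
  have "(\<exists>c. brauer_class G x = brauer_scalar G c \<otimes>\<^bsub>brauer_algebra G\<^esub> ?y) \<and> Poly_Mapping.keys x \<subseteq> qpaths G"
    if "Poly_Mapping.keys x \<subseteq> spanning f g l" for x :: "'v qpath \<Rightarrow>\<^sub>0 'k"
    using that
  proof (induction x rule: poly_mapping_span_induct)
    case zero
    have "brauer_scalar G (0 :: 'k) \<otimes>\<^bsub>brauer_algebra G\<^esub> ?y = \<zero>\<^bsub>brauer_algebra G\<^esub>" using y by (simp add: scalar_zero)
    then show ?case unfolding class_zero by (intro conjI exI[of _ 0]) simp_all
  next
    case (single q c)
    have q: "q \<in> qpaths G" using single by (simp add: spanning_def)
    have cl: "brauer_class G (Poly_Mapping.single q c) = brauer_scalar G c \<otimes>\<^bsub>brauer_algebra G\<^esub> brauer_class G (path_elem q)"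
      by (rule class_single[OF q])
    have "\<exists>c. brauer_class G (Poly_Mapping.single q c') = brauer_scalar G c \<otimes>\<^bsub>brauer_algebra G\<^esub> ?y" if "c' = c" for c'
    proof (cases "alive q")
      case True
      have "brauer_class G (path_elem q :: 'v qpath \<Rightarrow>\<^sub>0 'k) = ?y"
        using unique[OF single True]
      proof
        assume "full p \<and> full q"
        then have "path_elem q - path_elem p \<in> (brauer_ideal G :: ('v qpath \<Rightarrow>\<^sub>0 'k) set)"
          using full_diff_in_ideal[of q p] q pq single by (simp add: spanning_def)
        then show ?thesis using q pq by (subst class_eq_iff) auto
      qed simp
      then show ?thesis using cl that by (intro exI[of _ c]) simp
    next
      case False
      have "brauer_class G (path_elem q :: 'v qpath \<Rightarrow>\<^sub>0 'k) = \<zero>\<^bsub>brauer_algebra G\<^esub>"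
        using dead_in_ideal[OF q False] q by (subst class_eq_zero_iff) auto
      then show ?thesis using cl that y scalar_closed[of c] by (intro exI[of _ 0]) (simp add: scalar_zero)
    qed
    then show ?case using q by auto
  next
    case (add x x')
    then obtain c c' where c: "brauer_class G x = brauer_scalar G c \<otimes>\<^bsub>brauer_algebra G\<^esub> ?y"
      "brauer_class G x' = brauer_scalar G c' \<otimes>\<^bsub>brauer_algebra G\<^esub> ?y" by blast
    have "brauer_class G (x + x') = brauer_class G x \<oplus>\<^bsub>brauer_algebra G\<^esub> brauer_class G x'"
      using add by (simp add: class_add)
    also have "\<dots> = brauer_scalar G (c + c') \<otimes>\<^bsub>brauer_algebra G\<^esub> ?y"
      unfolding c scalar_add using y scalar_closed[of c] scalar_closed[of c'] by (simp add: l_distr)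
    finally show ?case using add Poly_Mapping.keys_add[of x x'] by blast
  qed
  then have "corner l \<subseteq> range (\<lambda>c. brauer_scalar G c \<otimes>\<^bsub>brauer_algebra G\<^esub> ?y)"
    unfolding corner_eq[OF f g] by blast
  moreover have "range (\<lambda>c. brauer_scalar G c \<otimes>\<^bsub>brauer_algebra G\<^esub> ?y) \<subseteq> corner l"
    unfolding corner_eq[OF f g] using p(1) by (auto simp: class_single[OF pq(1), symmetric])
  ultimately have "corner l = range (\<lambda>c. brauer_scalar G c \<otimes>\<^bsub>brauer_algebra G\<^esub> ?y)" by blast
  then show ?thesis unfolding hom_dim_unfold
  proof (rule hom_dim_one[OF _ y scalar_closed scalar_add scalar_times scalar_zero scalar_central])
    fix c :: 'k assume "brauer_scalar G c \<otimes>\<^bsub>brauer_algebra G\<^esub> ?y = \<zero>\<^bsub>brauer_algebra G\<^esub>"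
    then have "Poly_Mapping.single p c \<in> brauer_ideal G"
      using class_eq_zero_iff[of "Poly_Mapping.single p c"] pq unfolding class_single[OF pq(1), of c]
      by simp
    then show "c = 0" using alive_not_in_ideal pq p by blast
  qed
qed

end

section \<open>Degrees of paths\<close>

context green begin

definition turns :: "'v \<Rightarrow> nat" where
  "turns u = (if u = exc then m else 1)"

text \<open>The degree of one turn around \<open>u\<close>. At the exceptional vertex the
  differences of numbers cancel and the wrap-around leaves \<open>e\<close>; elsewhere only the
  arrow with source \<open>base u\<close> counts.\<close>

definition turn_degree :: "'v \<Rightarrow> int" where
  "turn_degree u = (if u = exc then int e else int m * int e)"

text \<open>A potential: except at the wrap-around, an arrow has as degree the weight of its source
  minus that of its target.\<close>

definition weight :: "'v \<Rightarrow> 'v set \<Rightarrow> int" where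
  "weight u f = (if u = exc then int (num f) else 0)"

abbreviation "spoke u k \<equiv> (nxt u ^^ k) (base u)"

lemma full_len_turns: "full_len u = turns u * val u"
  by (simp add: full_len_def turns_def)

lemma turn_degree_pos: "turn_degree u > 0"
  using e_pos m_pos by (simp add: turn_degree_def)

text \<open>Full paths have degree \<open>m * e\<close> around every vertex; this is what makes the
  identification of full paths a homogeneous relation.\<close>

lemma turn_degree_turns: "turn_degree u * int (turns u) = int m * int e"
  by (simp add: turn_degree_def turns_def)

lemma turns_pos: "turns u \<ge> 1"
  using m_pos by (simp add: turns_def)

lemma spoke_inc: "u \<in> bt_verts G \<Longrightarrow> spoke u k \<in> inc u"
  by (rule next_pow_inc[OF _ base_inc])

lemma spoke_inj:
  "u \<in> bt_verts G \<Longrightarrow> j < val u \<Longrightarrow> k < val u \<Longrightarrow> spoke u j = spoke u k \<longleftrightarrow> j = k"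
  using bij_betw_imp_inj_on[OF next_pow_bij[OF _ base_inc]] by (auto dest: inj_onD)

lemma spoke_surj:
  assumes "u \<in> bt_verts G" "f \<in> inc u"
  obtains k where "k < val u" "f = spoke u k"
  using bij_betw_imp_surj_on[OF next_pow_bij[OF assms(1) base_inc[OF assms(1)]]] assms(2) that by blast

lemma spoke_val: "u \<in> bt_verts G \<Longrightarrow> spoke u (val u) = base u"
  by (rule next_pow_val[OF _ base_inc])

lemma spoke_num_less:
  assumes "u \<in> bt_verts G" "j < val u" "k < val u"
  shows "num (spoke u j) < num (spoke u k) \<longleftrightarrow> j < k"
  using num_mono[OF assms(1), of j k] num_mono[OF assms(1), of k j] assms
  by (metis less_asym linorder_neqE_nat)

text \<open>At the exceptional vertex the numbers increase from \<open>base u\<close> on, so the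
  source of an arrow has the larger number unless it is \<open>base u\<close> itself, where
  \<open>e\<close> is added. With a single edge this arrow is the loop of degree \<open>e\<close>.
  At other vertices \<open>base u\<close> is the edge closest to the exceptional vertex.\<close>

lemma arrow_degree_spoke:
  assumes u: "u \<in> bt_verts G" and k: "k < val u"
  shows "arrow_degree G s (u, spoke u k) =
    weight u (spoke u (Suc k)) - weight u (spoke u k) + (if Suc k = val u then turn_degree u else 0)"
proof -
  have src: "arrow_src G (u, spoke u k) = spoke u (Suc k)" by (simp add: arrow_src_def)
  have wrap: "spoke u (Suc k) = base u \<longleftrightarrow> Suc k = val u"
  proof
    assume eq: "spoke u (Suc k) = base u"
    show "Suc k = val u"
    proof (rule ccontr)
      assume "Suc k \<noteq> val u"
      then have "Suc k < val u" using k by simp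
      then show False using spoke_inj[OF u, of "Suc k" 0] eq by simp
    qed
  qed (use spoke_val[OF u] in simp)
  show ?thesis
  proof (cases "u = exc")
    case False
    have "bt_closest G u (arrow_src G (u, spoke u k)) \<longleftrightarrow> spoke u (Suc k) = base u"
      unfolding src using closest_iff[of u] u False by (simp add: base_def)
    then show ?thesis
      using False wrap by (simp add: arrow_degree_def weight_def turn_degree_def m_def[symmetric] e_def[symmetric])
  next
    case exc: True
    show ?thesis
    proof (cases "Suc k = val u")
      case False
      then have "num (spoke u k) < num (spoke u (Suc k))" using k by (intro num_mono[OF u]) auto
      then show ?thesis using exc False unfolding arrow_degree_def Let_def src
        by (simp add: arrow_tgt_def weight_def del: funpow.simps)
    next
      case True
      have eq: "spoke u (Suc k) = spoke u 0" using wrap True by simp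
      have "k = 0 \<or> num (spoke u 0) < num (spoke u k)" using num_mono[OF u, of 0 k] k by auto
      then show ?thesis using exc True unfolding arrow_degree_def Let_def src eq
        by (auto simp: arrow_tgt_def weight_def turn_degree_def e_def[symmetric])
    qed
  qed
qed

text \<open>Here \<open>t\<close> counts the passages of the path through the edge \<open>base u\<close> as a source.\<close>

lemma along_degree:
  assumes u: "u \<in> bt_verts G" and "a < val u" "chain_from G (spoke u a) as" "\<forall>x \<in> set as. fst x = u"
  shows "\<exists>c t. c < val u \<and> path_tgt (spoke u a, as) = spoke u c \<and> a + t * val u = c + length as \<and>
    deg (spoke u a, as) = weight u (spoke u a) - weight u (spoke u c) + turn_degree u * int t"
  using assms(2-)
proof (induction as arbitrary: a)
  case Nil
  then show ?case by (intro exI[of _ a] exI[of _ 0]) (simp add: path_degree_def)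
next
  case (Cons x as)
  obtain f where x: "x = (u, f)" using Cons.prems by (cases x) auto
  have arr: "(u, f) \<in> arrows G" "nxt u f = spoke u a" "chain_from G f as"
    using Cons.prems x by (auto simp: arrow_src_def arrow_tgt_def)
  \<comment> \<open>The index of the target of the first arrow: one less than \<open>a\<close>, read
    cyclically.\<close>
  define b where "b = (if a = 0 then val u - 1 else a - 1)"
  have b: "b < val u" using Cons.prems val_pos[OF u] by (auto simp: b_def)
  have fi: "f \<in> inc u" using arrowsD arr by blast
  have sb: "spoke u (Suc b) = spoke u a"
  proof (cases "a = 0")
    case True
    then have "Suc b = val u" using val_pos[OF u] by (simp add: b_def)
    then have "spoke u (Suc b) = base u" using spoke_val[OF u] by (simp only:)
    then show ?thesis using True by simp
  next
    case False
    then have "Suc b = a" by (simp add: b_def)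
    then show ?thesis by (simp only:)
  qed
  then have "nxt u f = nxt u (spoke u b)" using arr by simp
  then have f: "f = spoke u b" using next_inj[OF u] fi spoke_inc[OF u] by (auto dest: inj_onD)
  obtain c t where ct: "c < val u" "path_tgt (f, as) = spoke u c" "b + t * val u = c + length as"
    "deg (f, as) = weight u f - weight u (spoke u c) + turn_degree u * int t"
    using Cons.IH[OF b] arr(3) Cons.prems unfolding f by auto
  \<comment> \<open>Only an arrow from index 0 to index \<open>val u - 1\<close> raises the count
    \<open>t\<close>.\<close>
  have wrap: "Suc b = val u \<longleftrightarrow> a = 0" using Cons.prems val_pos[OF u] by (auto simp: b_def)
  have tgt: "path_tgt (spoke u a, x # as) = spoke u c" using ct(2) by (auto simp: path_tgt_def x arrow_tgt_def split: if_splits)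
  have "deg (spoke u a, x # as) = arrow_degree G s x + deg (f, as)" by (simp add: path_degree_def)
  also have "arrow_degree G s x = weight u (spoke u a) - weight u f + (if a = 0 then turn_degree u else 0)"
    unfolding x f arrow_degree_spoke[OF u b] sb wrap ..
  finally have deg: "deg (spoke u a, x # as) =
      weight u (spoke u a) - weight u (spoke u c) + turn_degree u * int (if a = 0 then Suc t else t)"
    using ct(4) by (simp add: algebra_simps)
  have "a + (if a = 0 then Suc t else t) * val u = c + length (x # as)"
    using ct(3) Cons.prems val_pos[OF u] by (auto simp: b_def split: if_splits)
  then show ?case using ct(1) tgt deg by blast
qed

section \<open>The nonzero paths and the sets of their degrees\<close>

lemma cycle_of_iff: "f \<in> cycle_of G u \<longleftrightarrow> (u, f) \<in> arrows G"
  by (auto simp: cycle_of_def arrow_tgt_def)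

lemma arrows_transfer: "(u, f) \<in> arrows G \<Longrightarrow> g \<in> inc u \<Longrightarrow> (u, g) \<in> arrows G"
  by (auto simp: arrows_def)

lemma along_cases:
  assumes p: "p \<in> qpaths G" "along u p" "snd p \<noteq> []"
  obtains a c t where "u \<in> bt_verts G" "(u, path_src p) \<in> arrows G" "(u, path_tgt p) \<in> arrows G"
    "a < val u" "c < val u" "path_src p = spoke u a" "path_tgt p = spoke u c"
    "a + t * val u = c + path_len p"
    "deg p = weight u (spoke u a) - weight u (spoke u c) + turn_degree u * int t"
proof -
  obtain f as where fas: "p = (f, as)" by (cases p)
  have ch: "chain_from G f as" "\<forall>x \<in> set as. fst x = u" "as \<noteq> []"
    using p fas by (auto simp: qpaths_def along_def)
  then obtain x xs where x: "as = x # xs" by (cases as) auto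
  have xa: "x \<in> arrows G" "fst x = u" "arrow_src G x = f" using ch x by auto
  have u: "u \<in> bt_verts G" using xa by (auto simp: arrows_def)
  have fi: "f \<in> inc u" using xa next_inc[OF u] arrowsD by (auto simp: arrow_src_def)
  then obtain a where a: "a < val u" "f = spoke u a" using spoke_surj[OF u] by blast
  from along_degree[OF u a(1)] ch a(2) obtain c t where ct: "c < val u" "path_tgt p = spoke u c"
    "a + t * val u = c + length as" "deg p = weight u (spoke u a) - weight u (spoke u c) + turn_degree u * int t"
    unfolding fas by blast
  have "(u, snd x) \<in> arrows G" using xa by (metis prod.collapse)
  then have "(u, f) \<in> arrows G" "(u, path_tgt p) \<in> arrows G"
    using arrows_transfer fi spoke_inc[OF u] ct(2) by metis+
  then show thesis using that[of a c t] u a ct fas by (simp add: path_len_def)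
qed

lemma along_exists:
  assumes "(u, f) \<in> arrows G"
  shows "\<exists>p \<in> qpaths G. along u p \<and> path_src p = f \<and> path_len p = n"
proof -
  have u: "u \<in> bt_verts G" using arrowsD assms by blast
  have "\<exists>as. chain_from G f as \<and> (\<forall>x \<in> set as. fst x = u) \<and> length as = n" if "f \<in> inc u" for f
    using that
  proof (induction n arbitrary: f)
    case 0
    then show ?case by (intro exI[of _ "[]"]) (simp add: bt_incident_def)
  next
    case (Suc n)
    obtain r where r: "val u = Suc r" using val_pos[OF u] by (cases "val u") auto
    \<comment> \<open>The cyclic predecessor of \<open>f\<close>, which is the target of the arrow
      around \<open>u\<close> that starts at \<open>f\<close>.\<close>
    define g where "g = (nxt u ^^ r) f"
    have g: "g \<in> inc u" "nxt u g = f"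
      using next_pow_inc[OF u Suc.prems] next_pow_val[OF u Suc.prems] by (simp_all add: g_def r)
    obtain as where as: "chain_from G g as" "\<forall>x \<in> set as. fst x = u" "length as = n" using Suc.IH[OF g(1)] by blast
    have "(u, g) \<in> arrows G" using assms g(1) by (rule arrows_transfer)
    then show ?case using as g(2)
      by (intro exI[of _ "(u, g) # as"]) (simp add: arrow_src_def arrow_tgt_def)
  qed
  then obtain as where "chain_from G f as" "\<forall>x \<in> set as. fst x = u" "length as = n"
    using arrowsD assms by blast
  then show ?thesis by (intro bexI[of _ "(f, as)"]) (auto simp: along_def path_len_def qpaths_def)
qed

lemma common_vertex_unique:
  assumes "f \<in> inc u" "g \<in> inc u" "f \<in> inc v" "g \<in> inc v" "f \<noteq> g"
  shows "u = v"
proof (rule ccontr)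
  assume ne: "u \<noteq> v"
  have "h = {u, v}" if "h \<in> bt_edges G" "u \<in> h" "v \<in> h" for h
    using edge_adj[OF that(1)] that(2,3) ne by (metis doubleton_eq_iff insertE singletonD)
  then show False using assms by (auto simp: bt_incident_def)
qed

text \<open>Around one vertex the end points fix the indices and the degree fixes the number of
  turns, hence the length and the path. Around two different vertices \<open>f = g\<close>, and one
  of the vertices is not exceptional, so its path is a single turn of degree \<open>m * e\<close>;
  the other path has this degree only if it is full as well.\<close>

lemma alive_unique:
  assumes p: "p \<in> spanning f g l" "alive p" and q: "q \<in> spanning f g l" "alive q"
  shows "q = p \<or> full p \<and> full q"
proof -
  have pq: "p \<in> qpaths G" "path_src p = f" "path_tgt p = g" "deg p = l"
    "q \<in> qpaths G" "path_src q = f" "path_tgt q = g" "deg q = l"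
    using p q by (auto simp: spanning_def)
  \<comment> \<open>A nontrivial closed path that is alive has positive degree, so it cannot share
    degree 0 with the trivial path.\<close>
  have triv: "snd q' = []" if pq': "snd p' = []" "path_src p' = f" "path_tgt p' = g" "deg p' = l"
    "q' \<in> qpaths G" "path_src q' = f" "path_tgt q' = g" "deg q' = l" "alive q'" for p' q'
  proof (rule ccontr)
    assume ne: "snd q' \<noteq> []"
    then obtain u where "along u q'" using pq'(9) by (auto simp: alive_def)
    then obtain a c t where *: "u \<in> bt_verts G" "a < val u" "c < val u" "path_src q' = spoke u a" "path_tgt q' = spoke u c"
      "a + t * val u = c + path_len q'" "deg q' = weight u (spoke u a) - weight u (spoke u c) + turn_degree u * int t"
      using along_cases pq'(5) ne by metis
    have "f = g" "l = 0" using pq'(1-4) by (auto simp: path_src_def path_tgt_def path_degree_def)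
    then have "a = c" using * pq' spoke_inj by metis
    then have "turn_degree u * int t = 0" using * pq' \<open>l = 0\<close> by simp
    then have "t = 0" using turn_degree_pos[of u] by simp
    then show False using *(6) \<open>a = c\<close> path_len_pos[OF ne] by simp
  qed
  show ?thesis
  proof (cases "snd p = [] \<or> snd q = []")
    case True
    then have "snd p = []" "snd q = []" using triv[of p q] triv[of q p] pq p q by blast+
    then show ?thesis using pq by (auto simp: path_src_def prod_eq_iff)
  next
    case False
    then have ne: "snd p \<noteq> []" "snd q \<noteq> []" by auto
    obtain u where u: "along u p" "path_len p \<le> full_len u" using p ne by (auto simp: alive_def)
    obtain v where v: "along v q" "path_len q \<le> full_len v" using q ne by (auto simp: alive_def)
    obtain a c t where P: "u \<in> bt_verts G" "(u, f) \<in> arrows G" "(u, g) \<in> arrows G" "a < val u" "c < val u"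
      "f = spoke u a" "g = spoke u c" "a + t * val u = c + path_len p"
      "l = weight u (spoke u a) - weight u (spoke u c) + turn_degree u * int t"
      using along_cases[OF pq(1) u(1) ne(1)] pq by metis
    obtain a' c' t' where Q: "v \<in> bt_verts G" "(v, f) \<in> arrows G" "(v, g) \<in> arrows G" "a' < val v" "c' < val v"
      "f = spoke v a'" "g = spoke v c'" "a' + t' * val v = c' + path_len q"
      "l = weight v (spoke v a') - weight v (spoke v c') + turn_degree v * int t'"
      using along_cases[OF pq(5) v(1) ne(2)] pq by metis
    show ?thesis
    proof (cases "u = v")
      case True
      have "a' = a" "c' = c" using P Q True spoke_inj by metis+
      then have "turn_degree u * int t = turn_degree u * int t'" using P(9) Q(9) unfolding True \<open>a' = a\<close> \<open>c' = c\<close> by linarith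
      then have "t = t'" using turn_degree_pos[of u] turn_degree_pos[of v] by simp
      then have "path_len p = path_len q" using P(8) Q(8) True \<open>a' = a\<close> \<open>c' = c\<close> by simp
      then have "snd p = snd q"
        using along_path_unique[of f "snd p" "snd q" u] pq u v True
        by (auto simp: qpaths_def along_def path_len_def path_src_def)
      then show ?thesis using pq by (auto simp: path_src_def prod_eq_iff)
    next
      case uv: False
      have "f = g" using common_vertex_unique[of f u g v] P Q uv arrowsD by blast
      then have ac: "a = c" "a' = c'" using P Q spoke_inj by metis+
      have lens: "path_len p = t * val u" "path_len q = t' * val v" using P(8) Q(8) ac by auto
      have l: "l = turn_degree u * int t" "l = turn_degree v * int t'" using P(9) Q(9) ac by auto
      have t: "1 \<le> t" "t \<le> turns u" "1 \<le> t'" "t' \<le> turns v"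
        using lens path_len_pos[OF ne(1)] path_len_pos[OF ne(2)] u(2) v(2) val_pos[OF P(1)] val_pos[OF Q(1)]
        by (simp_all add: full_len_turns Suc_le_eq)
      have max: "t = turns u \<and> t' = turns v"
      proof (cases "v = exc")
        case False
        then have t': "t' = turns v" using t by (simp add: turns_def)
        then have "turn_degree u * int t = turn_degree u * int (turns u)"
          using l turn_degree_turns[of v] turn_degree_turns[of u] by metis
        then show ?thesis using t' turn_degree_pos[of u] turn_degree_pos[of v] by auto
      next
        case True
        then have t': "t = turns u" using t uv by (simp add: turns_def)
        then have "turn_degree v * int t' = turn_degree v * int (turns v)"
          using l turn_degree_turns[of v] turn_degree_turns[of u] by metis
        then show ?thesis using t' turn_degree_pos[of u] turn_degree_pos[of v] by auto
      qed
      then have "full p \<and> full q" using u(1) v(1) ne lens by (auto simp: full_def full_len_turns)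
      then show ?thesis by blast
    qed
  qed
qed

lemma hom_dim:
  assumes "f \<in> bt_edges G" "g \<in> bt_edges G"
  shows "brauer_hom_dim TYPE('k::field) G s f g l = (if \<exists>p \<in> spanning f g l. alive p then 1 else 0)"
proof (cases "\<exists>p \<in> spanning f g l. alive p")
  case True
  then obtain p where p: "p \<in> spanning f g l" "alive p" by blast
  have "brauer_hom_dim TYPE('k) G s f g l = 1" by (rule hom_dim_1[OF p alive_unique[OF p]])
  then show ?thesis using True by simp
next
  case False
  then have "brauer_hom_dim TYPE('k) G s f g l = 0" using assms by (intro hom_dim_0) auto
  then show ?thesis using False by simp
qed

definition "degrees f g = {l. \<exists>p \<in> spanning f g l. alive p}"

lemma degrees_disjoint:
  assumes "f \<noteq> g" "\<nexists>u. f \<in> cycle_of G u \<and> g \<in> cycle_of G u"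
  shows "degrees f g = {}"
proof -
  have False if p: "p \<in> spanning f g l" "alive p" for p l
  proof -
    have pq: "p \<in> qpaths G" "path_src p = f" "path_tgt p = g" using p by (auto simp: spanning_def)
    have ne: "snd p \<noteq> []" using pq assms(1) by (auto simp: path_src_def path_tgt_def)
    then obtain u where "along u p" using p by (auto simp: alive_def)
    then have "(u, f) \<in> arrows G" "(u, g) \<in> arrows G" using along_cases[OF pq(1) _ ne] pq by metis+
    then show False using assms(2) cycle_of_iff by blast
  qed
  then show ?thesis by (auto simp: degrees_def)
qed

text \<open>If \<open>f\<close> comes after \<open>g\<close> in the order from
  \<open>base u\<close>, a path from \<open>f\<close> to \<open>g\<close> can avoid the base edge as
  a source: \<open>t\<close> starts at 0, and \<open>t = turns u\<close> would already be too long.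
  Otherwise it must leave the base edge at least once, and \<open>t\<close> runs from 1 to
  \<open>turns u\<close>.\<close>

lemma degrees_distinct:
  assumes f: "f \<in> cycle_of G u" and g: "g \<in> cycle_of G u" and ne: "f \<noteq> g"
  shows "degrees f g = (\<lambda>t. weight u f - weight u g + turn_degree u * int t) `
    (if num g < num f then {..<turns u} else {1..turns u})" (is "_ = ?d ` ?T")
proof -
  have arr: "(u, f) \<in> arrows G" "(u, g) \<in> arrows G" using f g cycle_of_iff by auto
  have u: "u \<in> bt_verts G" and inc: "f \<in> inc u" "g \<in> inc u" using arr arrowsD by blast+
  obtain a where a: "a < val u" "f = spoke u a" using spoke_surj[OF u inc(1)] .
  obtain c where c: "c < val u" "g = spoke u c" using spoke_surj[OF u inc(2)] .
  have ac: "a \<noteq> c" using a c ne by auto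
  have less: "num g < num f \<longleftrightarrow> c < a" unfolding a(2) c(2) by (rule spoke_num_less[OF u c(1) a(1)])
  \<comment> \<open>Given \<open>t\<close>, the equation determines the length \<open>n\<close>; the
    bounds say that a path of this length is nontrivial and alive.\<close>
  have T: "t \<in> ?T \<longleftrightarrow> (\<exists>n. a + t * val u = c + n \<and> 1 \<le> n \<and> n \<le> full_len u)" for t
  proof (cases "c < a")
    case True
    have "t < turns u \<longleftrightarrow> (a - c) + t * val u \<le> turns u * val u"
    proof
      assume "t < turns u"
      then have "Suc t * val u \<le> turns u * val u" by (intro mult_le_mono1) simp
      then show "(a - c) + t * val u \<le> turns u * val u" using a by simp
    next
      assume "(a - c) + t * val u \<le> turns u * val u"
      then have "t * val u < turns u * val u" using True by linarith
      then show "t < turns u" by simp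
    qed
    moreover have "(\<exists>n. a + t * val u = c + n \<and> 1 \<le> n \<and> n \<le> full_len u) \<longleftrightarrow>
        (a - c) + t * val u \<le> turns u * val u"
    proof -
      have "a + t * val u = c + n \<longleftrightarrow> n = (a - c) + t * val u" for n using True by linarith
      moreover have "1 \<le> (a - c) + t * val u" using True by linarith
      ultimately show ?thesis unfolding full_len_turns by metis
    qed
    ultimately show ?thesis using True less by simp
  next
    case False
    then have lt: "a < c" using ac by simp
    show ?thesis
    proof
      assume "t \<in> ?T"
      then have t: "1 \<le> t" "t \<le> turns u" using False less by auto
      have "val u \<le> t * val u" "t * val u \<le> turns u * val u"
        using mult_le_mono1[OF t(1), of "val u"] mult_le_mono1[OF t(2), of "val u"] by simp_all
      with c(1) lt show "\<exists>n. a + t * val u = c + n \<and> 1 \<le> n \<and> n \<le> full_len u"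
        unfolding full_len_turns by (intro exI[of _ "a + t * val u - c"] conjI) linarith+
    next
      assume "\<exists>n. a + t * val u = c + n \<and> 1 \<le> n \<and> n \<le> full_len u"
      then obtain n where n: "a + t * val u = c + n" "1 \<le> n" "n \<le> turns u * val u"
        unfolding full_len_turns by blast
      have "t \<noteq> 0" by (rule notI) (use n(1) lt in simp)
      moreover have "t * val u < Suc (turns u) * val u" using n c by simp
      then have "t < Suc (turns u)" by (simp only: mult_less_cancel2)
      ultimately show "t \<in> ?T" using False less by auto
    qed
  qed
  show ?thesis
  proof (intro equalityI subsetI)
    fix l assume "l \<in> degrees f g"
    then obtain p where p: "p \<in> qpaths G" "path_src p = f" "path_tgt p = g" "deg p = l" "alive p"
      by (auto simp: degrees_def spanning_def)
    have pne: "snd p \<noteq> []" using p ne by (auto simp: path_src_def path_tgt_def)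
    then obtain v where v: "along v p" "path_len p \<le> full_len v" using p by (auto simp: alive_def)
    obtain a' c' t where P: "(v, f) \<in> arrows G" "(v, g) \<in> arrows G" "a' < val v" "c' < val v"
      "f = spoke v a'" "g = spoke v c'" "a' + t * val v = c' + path_len p"
      "l = weight v (spoke v a') - weight v (spoke v c') + turn_degree v * int t"
      using along_cases[OF p(1) v(1) pne] p by metis
    have vu: "v = u" using common_vertex_unique[of f v g u] P(1,2) inc ne arrowsD by blast
    then have "a' = a" "c' = c" using P a c spoke_inj[OF u] by metis+
    then have "t \<in> ?T" using T P(7) v(2) path_len_pos[OF pne] vu by (auto simp: Suc_le_eq)
    moreover have "l = ?d t" using P vu by simp
    ultimately show "l \<in> ?d ` ?T" by blast
  next
    fix l assume "l \<in> ?d ` ?T"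
    then obtain t where t: "t \<in> ?T" "l = ?d t" by blast
    then obtain n where n: "a + t * val u = c + n" "1 \<le> n" "n \<le> full_len u" using T by blast
    obtain p where p: "p \<in> qpaths G" "along u p" "path_src p = f" "path_len p = n" using along_exists[OF arr(1)] by blast
    have pne: "snd p \<noteq> []" using p n by (auto simp: path_len_def)
    obtain a' c' t' where P: "a' < val u" "c' < val u" "f = spoke u a'" "path_tgt p = spoke u c'"
      "a' + t' * val u = c' + path_len p"
      "deg p = weight u (spoke u a') - weight u (spoke u c') + turn_degree u * int t'"
      using along_cases[OF p(1,2) pne] p by metis
    have aa: "a' = a" using P a spoke_inj[OF u] by metis
    \<comment> \<open>Both equations describe the same length, so \<open>c\<close> and
      \<open>c'\<close> differ by a multiple of \<open>val u\<close>; as both are below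
      \<open>val u\<close>, they agree, and so do \<open>t\<close> and \<open>t'\<close>.\<close>
    have "int c' - int c = (int t' - int t) * int (val u)"
      using arg_cong[OF n(1), of int] arg_cong[OF P(5), of int] aa p(4) by (simp add: algebra_simps)
    then have "(int t' - int t) * int (val u) = int c' - int c" by simp
    moreover have "\<bar>int c' - int c\<bar> < int (val u)" using P(2) c(1) by linarith
    ultimately have "\<bar>int t' - int t\<bar> * int (val u) < 1 * int (val u)" by (metis abs_mult abs_of_nat mult_1)
    then have tt: "t' = t" by (subst (asm) mult_less_cancel_right) auto
    then have cc: "c' = c" using P(5) n(1) aa p(4) by simp
    have "deg p = l" using P(6) t(2) aa cc tt a c by simp
    then have "p \<in> spanning f g l" using p P(4) cc c by (simp add: spanning_def)
    moreover have "alive p" using p n by (auto simp: alive_def)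
    ultimately show "l \<in> degrees f g" by (auto simp: degrees_def)
  qed
qed

text \<open>An edge with a second edge at one end lies on the cycle of that end. Otherwise the edge
  is the whole tree and carries the loop that the quiver has for \<open>e = 1\<close> whatever
  \<open>m\<close> is.\<close>

lemma edge_in_cycle:
  assumes "f \<in> bt_edges G"
  shows "\<exists>u. f \<in> cycle_of G u"
proof -
  obtain w where w: "w \<in> nonroot" "f = pe w" using edge_pe[OF assms] .
  have inc: "f \<in> inc w" "f \<in> inc (par w)" using w pe_inc by auto
  have V: "w \<in> bt_verts G" "par w \<in> bt_verts G" using w par_verts by auto
  show ?thesis
  proof (cases "val w \<ge> 2 \<or> val (par w) \<ge> 2")
    case True
    then have "(w, f) \<in> arrows G \<or> (par w, f) \<in> arrows G" using inc V by (auto simp: arrows_def)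
    then show ?thesis using cycle_of_iff by blast
  next
    case False
    then have "val w = 1" "val (par w) = 1" using val_pos[OF V(1)] val_pos[OF V(2)] by auto
    then have single: "inc w = {f}" "inc (par w) = {f}" using inc by (auto simp: card_1_singleton_iff)
    \<comment> \<open>If the upper end were not the root, its own parent edge would be a second edge
      there.\<close>
    have px: "par w = exc"
    proof (rule ccontr)
      assume "par w \<noteq> exc"
      then have pn: "par w \<in> nonroot" using V by simp
      then have "pe (par w) \<in> inc (par w)" using pe_inc by blast
      then have "pe (par w) = pe w" using single w by simp
      then have "par w = w" using pe_inj pn w(1) by (metis inj_onD)
      then show False using par_neq[OF w(1)] by simp
    qed
    have child: "c = w" if "c \<in> nonroot" "pe c = f" for c
      using pe_inj that w by (metis inj_onD)
    \<comment> \<open>Every vertex descends from the root, and the first steps down can only use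
      \<open>f\<close>, which is the only edge at either end.\<close>
    have "g = f" if g: "g \<in> bt_edges G" for g
    proof -
      obtain y where y: "y \<in> nonroot" "g = pe y" using edge_pe[OF g] .
      then have "y \<in> desc exc" using desc_root by simp
      then have "y \<in> desc w"
      proof (cases rule: desc_cases)
        case (2 c)
        have "pe c \<in> inc exc" using pe_inc[OF 2(1), of exc] 2(2) by metis
        then have "pe c = f" using single(2) px by simp
        then have "c = w" by (rule child[OF 2(1)])
        then show ?thesis using 2 by simp
      qed (use y in simp)
      then have "y = w"
      proof (cases rule: desc_cases)
        case (2 c)
        have "pe c \<in> inc w" using pe_inc[OF 2(1), of w] 2(2) by blast
        then have "pe c = f" using single(1) by simp
        then have "c = w" by (rule child[OF 2(1)])
        then show ?thesis using 2 par_neq[OF w(1)] by simp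
      qed simp
      then show ?thesis using y w by simp
    qed
    then have "bt_edges G = {f}" using assms by blast
    then have "(exc, f) \<in> arrows G" using inc px V by (simp add: arrows_def)
    then show ?thesis using cycle_of_iff by blast
  qed
qed

text \<open>An edge may lie on two cycles. A non-exceptional one contributes only its single turn,
  of degree \<open>m * e\<close>; this is also the top degree of the exceptional cycle, so no new
  degree arises.\<close>

lemma degrees_same:
  assumes f: "f \<in> bt_edges G"
  shows "degrees f f = (if f \<in> cycle_of G exc then (\<lambda>t. int (t * e)) ` {0..m} else {0, int (m * e)})"
proof -
  have loop: "turn_degree u * int t \<in> degrees f f"
    if u: "f \<in> cycle_of G u" and t: "1 \<le> t" "t \<le> turns u" for u t
  proof -
    have arr: "(u, f) \<in> arrows G" using u cycle_of_iff by auto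
    obtain p where p: "p \<in> qpaths G" "along u p" "path_src p = f" "path_len p = t * val u"
      using along_exists[OF arr] by blast
    have uV: "u \<in> bt_verts G" using arr arrowsD by blast
    have pne: "snd p \<noteq> []" using p t val_pos[OF uV] by (auto simp: path_len_def)
    obtain a c t' where P: "a < val u" "c < val u" "f = spoke u a" "path_tgt p = spoke u c"
      "a + t' * val u = c + path_len p"
      "deg p = weight u (spoke u a) - weight u (spoke u c) + turn_degree u * int t'"
      using along_cases[OF p(1,2) pne] p by metis
    \<comment> \<open>Reducing lengths modulo \<open>val u\<close> shows that the path is
      closed.\<close>
    have "(a + t' * val u) mod val u = (c + t * val u) mod val u" using P p by simp
    then have ac: "a = c" using P(1,2) by simp
    then have "t' = t" using P p val_pos[OF uV] by simp
    then have "p \<in> spanning f f (turn_degree u * int t)" using P p ac by (simp add: spanning_def)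
    moreover have "alive p" using p t by (auto simp: alive_def full_len_turns)
    ultimately show ?thesis by (auto simp: degrees_def)
  qed
  have zero: "0 \<in> degrees f f"
  proof -
    have "(f, []) \<in> spanning f f 0" using Nil_qpaths[OF f] by (simp add: spanning_def path_degree_def)
    moreover have "alive (f, [])" by (simp add: alive_def)
    ultimately show ?thesis unfolding degrees_def by blast
  qed
  have cases: "l = 0 \<or> (\<exists>u t. f \<in> cycle_of G u \<and> 1 \<le> t \<and> t \<le> turns u \<and> l = turn_degree u * int t)"
    if l: "l \<in> degrees f f" for l
  proof -
    obtain p where p: "p \<in> qpaths G" "path_src p = f" "path_tgt p = f" "deg p = l" "alive p"
      using l unfolding degrees_def spanning_def by blast
    show ?thesis
    proof (cases "snd p = []")
      case True
      then show ?thesis using p by (simp add: path_degree_def)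
    next
      case pne: False
      then obtain u where u: "along u p" "path_len p \<le> full_len u" using p by (auto simp: alive_def)
      obtain a c t where P: "u \<in> bt_verts G" "(u, f) \<in> arrows G" "a < val u" "c < val u" "f = spoke u a" "f = spoke u c"
        "a + t * val u = c + path_len p"
        "l = weight u (spoke u a) - weight u (spoke u c) + turn_degree u * int t"
        using along_cases[OF p(1) u(1) pne] p by metis
      have ac: "a = c" using P spoke_inj by metis
      then have len: "path_len p = t * val u" using P by simp
      have "1 \<le> t" "t \<le> turns u"
        using len path_len_pos[OF pne] u(2) val_pos[OF P(1)] by (simp_all add: full_len_turns Suc_le_eq)
      then show ?thesis using P ac cycle_of_iff by auto
    qed
  qed
  obtain u0 where u0: "f \<in> cycle_of G u0" using edge_in_cycle[OF f] by blast
  have top: "int (m * e) \<in> degrees f f"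
    using loop[OF u0 turns_pos order_refl] turn_degree_turns[of u0] by simp
  show ?thesis
  proof (cases "f \<in> cycle_of G exc")
    case True
    have "l \<in> (\<lambda>t. int (t * e)) ` {0..m}" if l: "l \<in> degrees f f" for l
    proof -
      consider "l = 0" | u t where "u \<noteq> exc" "1 \<le> t" "t \<le> turns u" "l = turn_degree u * int t"
        | t where "t \<le> m" "l = int e * int t"
        using cases[OF l] unfolding turns_def turn_degree_def by (metis (full_types))
      then show ?thesis
      proof cases
        case 1
        then show ?thesis by (intro image_eqI[of _ _ 0]) auto
      next
        case (2 u t)
        then have "l = int (m * e)" by (simp add: turns_def turn_degree_def)
        then show ?thesis by (intro image_eqI[of _ _ m]) auto
      next
        case (3 t)
        then show ?thesis by (intro image_eqI[of _ _ t]) auto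
      qed
    qed
    moreover have "int (t * e) \<in> degrees f f" if "t \<le> m" for t
    proof (cases "t = 0")
      case False
      then show ?thesis using loop[OF True, of t] that by (simp add: turns_def turn_degree_def mult.commute)
    qed (use zero in simp)
    ultimately show ?thesis using True by auto
  next
    case False
    have "l \<in> {0, int (m * e)}" if l: "l \<in> degrees f f" for l
    proof -
      from cases[OF l] show ?thesis
      proof
        assume "\<exists>u t. f \<in> cycle_of G u \<and> 1 \<le> t \<and> t \<le> turns u \<and> l = turn_degree u * int t"
        then obtain u t where *: "f \<in> cycle_of G u" "1 \<le> t" "t \<le> turns u" "l = turn_degree u * int t" by blast
        then have "u \<noteq> exc" using False by blast
        then show ?thesis using * by (simp add: turns_def turn_degree_def)
      qed simp
    qed
    then show ?thesis using False zero top by auto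
  qed
qed

section \<open>The graded Cartan matrix\<close>

text \<open>Each occurring degree has dimension one, so the entry is a sum of distinct monomials;
  injectivity of \<open>\<delta>\<close> allows the index set of the claimed formula.\<close>

lemma cartan_entry:
  assumes ij: "i \<in> {1..e}" "j \<in> {1..e}"
    and D: "degrees (green_edge G s i) (green_edge G s j) = \<delta> ` T" and T: "finite T" "inj_on \<delta> T"
  shows "graded_cartan TYPE('k::field) G s i j = (\<Sum>t \<in> T. Poly_Mapping.single (\<delta> t) 1)"
proof -
  let ?f = "\<lambda>l. Poly_Mapping.single l (int (brauer_hom_dim TYPE('k) G s (green_edge G s i) (green_edge G s j) l))"
  have f: "?f l = (if l \<in> \<delta> ` T then Poly_Mapping.single l 1 else 0)" for l
    unfolding hom_dim[OF green_edge(1)[OF ij(1)] green_edge(1)[OF ij(2)]] D[symmetric] degrees_def by simp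
  have "Sum_any ?f = (\<Sum>l \<in> \<delta> ` T. ?f l)"
    by (rule Sum_any.expand_superset) (use T f in \<open>auto split: if_splits\<close>)
  also have "\<dots> = (\<Sum>l \<in> \<delta> ` T. Poly_Mapping.single l 1)" by (rule sum.cong) (simp_all add: f)
  also have "\<dots> = (\<Sum>t \<in> T. Poly_Mapping.single (\<delta> t) 1)" by (rule sum.reindex_cong[OF T(2)]) simp_all
  finally show ?thesis unfolding graded_cartan_def .
qed

end

lemma qvar_power: "qvar ^ n = Poly_Mapping.single (int n) 1"
  by (induction n) (simp_all add: qvar_def mult_single)

theorem proposition6p1:
  fixes G :: "'v brauer_tree" and s :: "'v set" and m e :: nat
    and C :: "nat \<Rightarrow> nat \<Rightarrow> laurent" and S :: "nat \<Rightarrow> 'v set"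
  assumes "CHAR('k::alg_closed_field) > 0"
    and "brauer_tree_of_type m e G"
    and "s \<in> bt_incident G (bt_exc G)"
  defines "C \<equiv> graded_cartan TYPE('k) G s"
    and "S \<equiv> green_edge G s"
  shows
    "(\<forall>i \<in> {1..e}. \<forall>j \<in> {1..e}.
        (\<nexists>u. S i \<in> cycle_of G u \<and> S j \<in> cycle_of G u) \<longrightarrow> C i j = 0)
   \<and> (\<forall>i \<in> {1..e}.
        (S i \<in> cycle_of G (bt_exc G) \<longrightarrow> C i i = (\<Sum>t = 0..m. qvar ^ (t * e))) \<and>
        (S i \<notin> cycle_of G (bt_exc G) \<longrightarrow> C i i = 1 + qvar ^ (m * e)))
   \<and> (\<forall>i \<in> {1..e}. \<forall>j \<in> {1..e}. i \<noteq> j \<longrightarrow>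
        (\<exists>u. u \<noteq> bt_exc G \<and> S i \<in> cycle_of G u \<and> S j \<in> cycle_of G u) \<longrightarrow>
        (i > j \<longrightarrow> C i j = 1) \<and> (i < j \<longrightarrow> C i j = qvar ^ (m * e)))
   \<and> (\<forall>i \<in> {1..e}. \<forall>j \<in> {1..e}. i \<noteq> j \<longrightarrow>
        S i \<in> cycle_of G (bt_exc G) \<and> S j \<in> cycle_of G (bt_exc G) \<longrightarrow>
        (i > j \<longrightarrow> C i j = (\<Sum>t = 0..m - 1. qvar ^ (i - j + t * e))) \<and>
        (i < j \<longrightarrow> C i j = (\<Sum>t = 1..m. qvar ^ (t * e - (j - i)))))"
proof -
  interpret green G m e s
    by unfold_locales (use assms in auto)
  have S: "S i \<in> bt_edges G" "num (S i) = i" if "i \<in> {1..e}" for i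
    using green_edge[OF that] by (simp_all add: S_def)
  have entry: "C i j = (\<Sum>t \<in> T. Poly_Mapping.single (\<delta> t) 1)"
    if "i \<in> {1..e}" "j \<in> {1..e}" "degrees (S i) (S j) = \<delta> ` T" "finite T" "inj_on \<delta> T" for i j \<delta> and T :: "nat set"
    using cartan_entry[where 'k = 'k] that unfolding C_def S_def by blast
  have inj: "inj_on (\<lambda>t. x + turn_degree u * int t) T" for x u T
    using turn_degree_pos[of u] by (auto simp: inj_on_def)
  have distinct: "S i \<noteq> S j" if "i \<noteq> j" "i \<in> {1..e}" "j \<in> {1..e}" for i j
    using S that by metis
  show ?thesis
  proof (intro conjI ballI impI)
    fix i j assume ij: "i \<in> {1..e}" "j \<in> {1..e}" and no: "\<nexists>u. S i \<in> cycle_of G u \<and> S j \<in> cycle_of G u"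
    \<comment> \<open>Every edge lies on some cycle, so \<open>i = j\<close> does not occur
      here.\<close>
    have "S i \<noteq> S j" using edge_in_cycle[OF S(1)[OF ij(1)]] no by metis
    then have "degrees (S i) (S j) = int ` {}" using degrees_disjoint no by simp
    from entry[OF ij this] show "C i j = 0" by simp
  next
    fix i assume i: "i \<in> {1..e}" and "S i \<in> cycle_of G exc"
    then have "degrees (S i) (S i) = (\<lambda>t. int (t * e)) ` {0..m}" using degrees_same[OF S(1)[OF i]] by simp
    from entry[OF i i this] show "C i i = (\<Sum>t = 0..m. qvar ^ (t * e))"
      using e_pos by (simp add: inj_on_def qvar_power)
  next
    fix i assume i: "i \<in> {1..e}" and "S i \<notin> cycle_of G exc"
    then have "degrees (S i) (S i) = (\<lambda>t. int (t * (m * e))) ` {0, 1}" using degrees_same[OF S(1)[OF i]] by simp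
    from entry[OF i i this] show "C i i = 1 + qvar ^ (m * e)"
      using e_pos m_pos by (simp add: inj_on_def qvar_power)
  next
    fix i j assume ij: "i \<in> {1..e}" "j \<in> {1..e}" and ne: "i \<noteq> j"
      and "\<exists>u. u \<noteq> exc \<and> S i \<in> cycle_of G u \<and> S j \<in> cycle_of G u"
    then obtain u where u: "u \<noteq> exc" "S i \<in> cycle_of G u" "S j \<in> cycle_of G u" by blast
    \<comment> \<open>Off the exceptional vertex the weights vanish and only one turn is allowed, so
      \<open>t\<close> is 0 for \<open>i > j\<close> and 1 for \<open>i < j\<close>.\<close>
    have D: "degrees (S i) (S j) = (\<lambda>t. 0 + turn_degree u * int t) ` (if j < i then {..<1} else {1..1})"
      using degrees_distinct[OF u(2,3) distinct[OF ne ij]] S(2)[OF ij(1)] S(2)[OF ij(2)] u(1)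
      by (simp add: weight_def turns_def)
    have "C i j = (\<Sum>t \<in> (if j < i then {..<1} else {1..1}). Poly_Mapping.single (0 + turn_degree u * int t) 1)"
      by (rule entry[OF ij D _ inj]) simp
    then show "i > j \<Longrightarrow> C i j = 1" "i < j \<Longrightarrow> C i j = qvar ^ (m * e)"
      using u(1) by (simp_all add: qvar_power turn_degree_def)
  next
    fix i j assume ij: "i \<in> {1..e}" "j \<in> {1..e}" and ne: "i \<noteq> j"
      and x: "S i \<in> cycle_of G exc \<and> S j \<in> cycle_of G exc"
    have D: "degrees (S i) (S j) = (\<lambda>t. (int i - int j) + turn_degree exc * int t) ` (if j < i then {..<m} else {1..m})"
      using degrees_distinct[of "S i" exc "S j"] x distinct[OF ne ij] S(2)[OF ij(1)] S(2)[OF ij(2)]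
      by (simp add: weight_def turns_def)
    have C: "C i j = (\<Sum>t \<in> (if j < i then {..<m} else {1..m}).
        Poly_Mapping.single ((int i - int j) + turn_degree exc * int t) 1)"
      by (rule entry[OF ij D _ inj]) simp
    show "C i j = (\<Sum>t = 0..m - 1. qvar ^ (i - j + t * e))" if "i > j"
    proof -
      \<comment> \<open>This uses \<open>m \<ge> 1\<close>: with truncated subtraction the left side
        is never empty.\<close>
      have "{0..m - 1} = {..<m}" using m_pos by auto
      then show ?thesis using that unfolding C
        by (simp add: qvar_power turn_degree_def of_nat_diff algebra_simps)
    qed
    show "C i j = (\<Sum>t = 1..m. qvar ^ (t * e - (j - i)))" if "i < j"
    proof -
      \<comment> \<open>The exponent in the claim is a difference of natural numbers; it is not
        truncated because \<open>j \<le> e\<close> and \<open>e \<le> t * e\<close>.\<close>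
      have summand: "Poly_Mapping.single (int i - int j + turn_degree exc * int t) 1 = qvar ^ (t * e - (j - i))"
        if t: "t \<in> {1..m}" for t
      proof -
        have "e \<le> t * e" using mult_le_mono1[of 1 t e] t by simp
        moreover have "j \<le> e" using ij by simp
        ultimately have "j - i \<le> t * e" by linarith
        then show ?thesis using \<open>i < j\<close>
          by (simp add: qvar_power turn_degree_def of_nat_diff algebra_simps)
      qed
      have T: "(if j < i then {..<m} else {1..m}) = {1..m}" using that by simp
      show ?thesis unfolding C T by (rule sum.cong[OF refl]) (rule summand)
    qed
  qed
qed

end
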